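(* Let $X$ be a smooth projective connected curve over $\mathbb{C}$, let $L$ be a line bundle on $X$, let $p\ge 1$, and let $0\ne\alpha\in K_{p,1}(X,L)$ be a Koszul class of rank $p+2$, represented by an element of $\bigwedge^pW\otimes H^0(X,L)$ with $W\subset H^0(X,L)$ a linear subspace of dimension $p+2$. Then there exist a rank 2 vector bundle $E$ on $X$ with $\det E\cong L$ and a section $t\in H^0(X,E)$ such that $\alpha=\gamma(W,t)$ (for some admissible choice of the data $U$ and its basis used in the definition of $\gamma(W,t)$).
   Context: Koszul cohomology: for a line bundle $L$ on $X$ put $V=H^0(X,L)$. For $p\ge 1$, $K_{p,1}(X,L)$ is the cohomology at the middle term of the Koszul complex $$\bigwedge^{p+1}V\rightarrow \bigwedge^{p}V\otimes H^0(X,L)\rightarrow \bigwedge^{p-1}V\otimes H^0(X,L^{2}),$$ where the differentials are $v_1\wedge\dots\wedge v_k\otimes s\mapsto \sum_i(-1)^i v_1\wedge\dots\widehat{v_i}\dots\wedge v_k\otimes v_i s$ (and $s=1$ for the first map). Rank: the rank of a Koszul class $\alpha\in K_{p,1}(X,L)$ is the minimal dimension of a linear subspace $W\subset H^0(X,L)$ such that $\alpha$ is represented by an element of $\bigwedge^pW\otimes H^0(X,L)$. The class $\gamma(W,t)$: let $E$ be a rank two vector bundle on $X$ with an isomorphism $\det E\cong L$. Let $d:\bigwedge^2H^0(X,E)\rightarrow V=H^0(X,L)$ be the determinant map and, for $t\in H^0(X,E)$, let $d_t:H^0(X,E)\rightarrow V$ be $d_t(u)=d(t\wedge u)$. Let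 $W\subset V$ be a linear subspace of dimension $p+2$, $p\ge 1$, contained in the image of $d_t$. An admissible choice is a subspace $U\subset H^0(X,E)$ with $U\cap\ker(d_t)=0$, $\dim U=p+2$ and $d_t(U)=W$. Choose a basis $e_2,\dots,e_{p+3}$ of $U$ and put $$\gamma=\sum_{2\le i<j\le p+3}(-1)^{i+j}\,d(t\wedge e_2)\wedge\dots\wedge\widehat{d(t\wedge e_i)}\wedge\dots\wedge\widehat{d(t\wedge e_j)}\wedge\dots\wedge d(t\wedge e_{p+3})\otimes d(e_i\wedge e_j)\in\bigwedge^pW\otimes V .$$ Equivalently, up to a nonzero scalar, $\gamma$ is the restriction of $d$ to $\bigwedge^2U$, viewed in $\bigwedge^2U^\vee\otimes V\cong\bigwedge^pU\otimes V$ and transported by $d_t:U\cong W$ (changing the basis of $U$ multiplies $\gamma$ by a nonzero scalar). The element $\gamma$ lies in the kernel of the Koszul differential to $\bigwedge^{p-1}V\otimes H^0(X,L^2)$, and $\gamma(W,t)$ denotes its class in $K_{p,1}(X,L)$. *)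

theory Defs
  imports "HOL-Analysis.Analysis" "HOL-Library.Poly_Mapping" "HOL-Library.Function_Algebras"
begin

section \<open>Projective space and closed subvarieties\<close>

text \<open>A point of the projective space of \<open>complex ^ 'n\<close> (of dimension \<open>CARD('n) - 1\<close>) is a
  line through the origin.\<close>

type_synonym 'n pt = "(complex ^ 'n) set"

definition pspace :: "'n::finite pt set" where
  "pspace = {l. \<exists>v. v \<noteq> 0 \<and> l = range (\<lambda>c. c *s v)}"

text \<open>Homogeneous polynomials of degree \<open>d\<close>, as polynomial functions (the ground field is infinite).\<close>

definition form :: "nat \<Rightarrow> (complex ^ 'n::finite \<Rightarrow> complex) \<Rightarrow> bool" where
  "form d F \<longleftrightarrow> (\<exists>a :: ('n \<Rightarrow> nat) \<Rightarrow> complex.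
     F = (\<lambda>v. \<Sum>m | (\<Sum>i\<in>UNIV. m i) = d. a m * (\<Prod>i\<in>UNIV. (v $ i) ^ m i)))"

definition zariski_open :: "'n::finite pt set \<Rightarrow> bool" where
  "zariski_open U \<longleftrightarrow> (\<exists>S. (\<forall>F\<in>S. \<exists>d. form d F) \<and>
     U = {l \<in> pspace. \<exists>F\<in>S. \<exists>v\<in>l. F v \<noteq> 0})"

definition zariski :: "'n::finite pt topology" where
  "zariski = topology zariski_open"

lemma finite_exponents: "finite {m :: 'n::finite \<Rightarrow> nat. (\<Sum>i\<in>UNIV. m i) = d}"
proof (rule finite_subset)
  show "{m :: 'n \<Rightarrow> nat. (\<Sum>i\<in>UNIV. m i) = d} \<subseteq> Pi\<^sub>E UNIV (\<lambda>_. {..d})"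
    by (auto simp: PiE_def) (metis finite_class.finite_UNIV iso_tuple_UNIV_I member_le_sum zero_le)
  show "finite (Pi\<^sub>E (UNIV :: 'n set) (\<lambda>_. {..d}))"
    by (intro finite_PiE) auto
qed

lemma form_scale:
  assumes "form d F"
  shows "F (c *s v) = c ^ d * F v"
proof -
  obtain a where F: "F = (\<lambda>v. \<Sum>m | (\<Sum>i\<in>UNIV. m i) = d. a m * (\<Prod>i\<in>UNIV. (v $ i) ^ m i))"
    using assms unfolding form_def by blast
  have "(\<Prod>i\<in>UNIV. ((c *s v) $ i) ^ m i) = c ^ d * (\<Prod>i\<in>UNIV. (v $ i) ^ m i)"
    if "(\<Sum>i\<in>UNIV. m i) = d" for m :: "'a \<Rightarrow> nat"
    using that by (simp add: power_mult_distrib prod.distrib flip: power_sum)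
  then show ?thesis
    unfolding F by (auto simp: sum_distrib_left intro!: sum.cong)
qed

lemma form_mult:
  fixes F G :: "complex ^ 'n::finite \<Rightarrow> complex"
  assumes "form d F" "form e G"
  shows "form (d + e) (\<lambda>v. F v * G v)"
proof -
  define E where "E k = {m :: 'n \<Rightarrow> nat. (\<Sum>i\<in>UNIV. m i) = k}" for k
  have fin: "finite (E k)" for k
    unfolding E_def by (rule finite_exponents)
  define M where "M v m = (\<Prod>i\<in>UNIV. (v $ i) ^ m i)" for v :: "complex ^ 'n" and m :: "'n \<Rightarrow> nat"
  have M: "M v (\<lambda>i. m i + m' i) = M v m * M v m'" for v m m'
    by (simp add: M_def power_add prod.distrib)
  obtain a b where F: "F = (\<lambda>v. \<Sum>m\<in>E d. a m * M v m)" and G: "G = (\<lambda>v. \<Sum>m\<in>E e. b m * M v m)"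
    using assms unfolding form_def E_def M_def by blast
  define s where "s = (\<lambda>(m :: 'n \<Rightarrow> nat, m' :: 'n \<Rightarrow> nat) i. m i + m' i)"
  define c where "c k = (\<Sum>(m, m') \<in> {q \<in> E d \<times> E e. s q = k}. a m * b m')" for k
  have "F v * G v = (\<Sum>k\<in>E (d + e). c k * M v k)" for v
  proof -
    have "F v * G v = (\<Sum>(m, m')\<in>E d \<times> E e. a m * b m' * M v (s (m, m')))"
      by (simp add: F G sum_product sum.cartesian_product s_def M mult_ac)
    also have "\<dots> = (\<Sum>q\<in>E d \<times> E e. a (fst q) * b (snd q) * M v (s q))"
      by (simp add: case_prod_beta)
    also have "\<dots> = (\<Sum>k\<in>E (d + e). \<Sum>q\<in>{q \<in> E d \<times> E e. s q = k}. a (fst q) * b (snd q) * M v (s q))"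
      by (rule sum.group [symmetric]) (auto simp: fin, auto simp: E_def s_def sum.distrib)
    also have "\<dots> = (\<Sum>k\<in>E (d + e). c k * M v k)"
      by (auto simp: c_def sum_distrib_right case_prod_beta intro!: sum.cong)
    finally show ?thesis .
  qed
  then show ?thesis
    unfolding form_def E_def M_def by blast
qed

lemma istopology_zariski_open: "istopology (zariski_open :: 'n::finite pt set \<Rightarrow> bool)"
  unfolding istopology_def
proof (intro conjI allI impI)
  fix U V :: "'n pt set"
  assume "zariski_open U" "zariski_open V"
  then obtain S T where
    S: "\<forall>F\<in>S. \<exists>d. form d F" "U = {l \<in> pspace. \<exists>F\<in>S. \<exists>v\<in>l. F v \<noteq> 0}" and
    T: "\<forall>F\<in>T. \<exists>d. form d F" "V = {l \<in> pspace. \<exists>F\<in>T. \<exists>v\<in>l. F v \<noteq> 0}"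
    unfolding zariski_open_def by blast
  define R where "R = {(\<lambda>v. F v * G v) |F G. F \<in> S \<and> G \<in> T}"
  have "\<exists>d. form d H" if "H \<in> R" for H
    using that S(1) T(1) form_mult unfolding R_def by blast
  moreover have "U \<inter> V = {l \<in> pspace. \<exists>H\<in>R. \<exists>v\<in>l. H v \<noteq> 0}"
  proof (intro equalityI subsetI)
    fix l assume l: "l \<in> U \<inter> V"
    then obtain F G v w where *: "F \<in> S" "G \<in> T" "v \<in> l" "w \<in> l" "F v \<noteq> 0" "G w \<noteq> 0" "l \<in> pspace"
      using S(2) T(2) by blast
    obtain u where u: "l = range (\<lambda>c. c *s u)"
      using \<open>l \<in> pspace\<close> unfolding pspace_def by blast
    have "u = 1 *s u" by simp
    then have "u \<in> l" unfolding u by blast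
    moreover have "F u \<noteq> 0" "G u \<noteq> 0"
      using * S(1) T(1) u form_scale by (metis (no_types, lifting) imageE mult_zero_right)+
    moreover have "(\<lambda>v. F v * G v) \<in> R"
      using * unfolding R_def by blast
    ultimately show "l \<in> {l \<in> pspace. \<exists>H\<in>R. \<exists>v\<in>l. H v \<noteq> 0}"
      using \<open>l \<in> pspace\<close> by (intro CollectI conjI bexI [of _ "\<lambda>v. F v * G v"] bexI [of _ u]) simp_all
  next
    fix l assume "l \<in> {l \<in> pspace. \<exists>H\<in>R. \<exists>v\<in>l. H v \<noteq> 0}"
    then obtain F G v where "l \<in> pspace" "F \<in> S" "G \<in> T" "v \<in> l" "F v \<noteq> 0" "G v \<noteq> 0"
      unfolding R_def by auto
    then show "l \<in> U \<inter> V"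
      unfolding S(2) T(2) by blast
  qed
  ultimately show "zariski_open (U \<inter> V)"
    unfolding zariski_open_def by blast
next
  fix K :: "'n pt set set"
  assume "\<forall>U\<in>K. zariski_open U"
  then have "\<forall>U\<in>K. \<exists>S. (\<forall>F\<in>S. \<exists>d. form d F) \<and>
      U = {l \<in> pspace. \<exists>F\<in>S. \<exists>v\<in>l. F v \<noteq> 0}"
    unfolding zariski_open_def .
  from bchoice [OF this] obtain S where S: "\<forall>U\<in>K. (\<forall>F\<in>S U. \<exists>d. form d F) \<and>
      U = {l \<in> pspace. \<exists>F\<in>S U. \<exists>v\<in>l. F v \<noteq> 0}" ..
  have mem: "l \<in> U \<longleftrightarrow> l \<in> pspace \<and> (\<exists>F\<in>S U. \<exists>v\<in>l. F v \<noteq> 0)" if "U \<in> K" for U l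
    using eqset_imp_iff [OF conjunct2 [OF bspec [OF S that]], of l] by simp
  show "zariski_open (\<Union>K)"
    unfolding zariski_open_def
  proof (intro exI conjI)
    show "\<forall>F\<in>\<Union>(S ` K). \<exists>d. form d F"
      using S by auto
    show "\<Union>K = {l \<in> pspace. \<exists>F\<in>\<Union>(S ` K). \<exists>v\<in>l. F v \<noteq> 0}"
    proof (intro equalityI subsetI)
      fix l assume "l \<in> \<Union>K"
      then obtain U where U: "U \<in> K" "l \<in> U" ..
      then obtain F v where "l \<in> pspace" "F \<in> S U" "v \<in> l" "F v \<noteq> 0"
        using mem [OF U(1), of l] by blast
      with U(1) show "l \<in> {l \<in> pspace. \<exists>F\<in>\<Union>(S ` K). \<exists>v\<in>l. F v \<noteq> 0}"
        by blast
    next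
      fix l assume "l \<in> {l \<in> pspace. \<exists>F\<in>\<Union>(S ` K). \<exists>v\<in>l. F v \<noteq> 0}"
      then obtain U F v where U: "U \<in> K" and "l \<in> pspace" "F \<in> S U" "v \<in> l" "F v \<noteq> 0"
        by blast
      then have "l \<in> U"
        using mem [OF U, of l] by blast
      with U show "l \<in> \<Union>K" ..
    qed
  qed
qed

lemma openin_zariski: "openin zariski U \<longleftrightarrow> zariski_open U"
  by (simp add: zariski_def istopology_zariski_open topology_inverse')

lemma topspace_zariski: "topspace zariski = (pspace :: 'n::finite pt set)"
proof -
  have "form 0 (\<lambda>v :: complex ^ 'n. 1)"
    unfolding form_def
  proof (intro exI [of _ "\<lambda>_. 1"] ext)
    have "{m :: 'n \<Rightarrow> nat. (\<Sum>i\<in>UNIV. m i) = 0} = {\<lambda>_. 0}" by auto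
    then show "1 = (\<Sum>m | (\<Sum>i\<in>UNIV. m i) = 0. 1 * (\<Prod>i\<in>UNIV. (v $ i) ^ m i))" for v :: "complex ^ 'n"
      by simp
  qed
  then have "zariski_open (pspace :: 'n pt set)"
    unfolding zariski_open_def by (intro exI [of _ "{\<lambda>v. 1}"]) (auto simp: pspace_def)
  moreover have "U \<subseteq> pspace" if "zariski_open U" for U :: "'n pt set"
    using that unfolding zariski_open_def by blast
  ultimately show ?thesis
    unfolding topspace_def openin_zariski by blast
qed

abbreviation ztop :: "'n::finite pt set \<Rightarrow> 'n pt topology" where
  "ztop X \<equiv> subtopology zariski X"

section \<open>Smooth projective connected curves\<close>

definition irreducible_closed :: "'a topology \<Rightarrow> 'a set \<Rightarrow> bool" where
  "irreducible_closed T Z \<longleftrightarrow> closedin T Z \<and> Z \<noteq> {} \<and>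
     (\<forall>A B. closedin T A \<and> closedin T B \<and> Z = A \<union> B \<longrightarrow> Z = A \<or> Z = B)"

definition krull_dim :: "'a topology \<Rightarrow> enat" where
  "krull_dim T = Sup {enat n |n. \<exists>Z :: nat \<Rightarrow> 'a set.
     (\<forall>i\<le>n. irreducible_closed T (Z i)) \<and> (\<forall>i<n. Z i \<subset> Z (Suc i))}"

text \<open>The Zariski tangent space, at a nonzero vector of the line \<open>l\<close>, of the affine cone over \<open>X\<close>:
  the common kernel of the differentials of all forms vanishing on \<open>X\<close>. (By homogeneity it does
  not depend on the nonzero vector.) Its dimension is one more than that of the tangent space of
  \<open>X\<close> at \<open>l\<close>.\<close>

definition cone_tangent :: "'n::finite pt set \<Rightarrow> 'n pt \<Rightarrow> (complex ^ 'n) set" where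
  "cone_tangent X l = {w. \<forall>d F. form d F \<and> (\<forall>m\<in>X. \<forall>v\<in>m. F v = 0) \<longrightarrow>
     (\<forall>v\<in>l. v \<noteq> 0 \<longrightarrow> deriv (\<lambda>z. F (v + z *s w)) 0 = 0)}"

text \<open>Smoothness is the Jacobian criterion. For connected \<open>X\<close> of dimension one, every point
  has local dimension one unless \<open>X\<close> has an isolated point, which connectedness excludes.\<close>

definition smooth_projective_connected_curve :: "'n::finite pt set \<Rightarrow> bool" where
  "smooth_projective_connected_curve X \<longleftrightarrow>
     closedin zariski X \<and> connected_space (ztop X) \<and> krull_dim (ztop X) = 1 \<and>
     (\<forall>l\<in>X. vec.dim (cone_tangent X l) = 1 + 1)"

text \<open>\<open>f\<close> is a regular function on the open subset \<open>U\<close> of \<open>X\<close>; its values outside \<open>U\<close> are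
  irrelevant.\<close>

definition regular_on :: "'n::finite pt set \<Rightarrow> 'n pt set \<Rightarrow> ('n pt \<Rightarrow> complex) \<Rightarrow> bool" where
  "regular_on X U f \<longleftrightarrow> (\<forall>l\<in>U. \<exists>V d G H. openin (ztop X) V \<and> l \<in> V \<and> V \<subseteq> U \<and>
     form d G \<and> form d H \<and> (\<forall>m\<in>V. \<forall>v\<in>m. v \<noteq> 0 \<longrightarrow> H v \<noteq> 0 \<and> f m = G v / H v))"

section \<open>Vector bundles\<close>

text \<open>An algebraic vector bundle of rank \<open>CARD('r)\<close> is given by a Zariski open cover and
  transition matrices of regular functions satisfying the cocycle condition. Local
  sections \<open>s i\<close> over \<open>patch i\<close> glue by \<open>s i = trans i j *v s j\<close>. Line bundles are the
  case \<open>'r = 1\<close>. Choosing a trivialising neighbourhood of every point shows that each bundle is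
  isomorphic to one whose cover is indexed by points, so \<open>'i = 'n pt\<close> is no restriction.\<close>

record ('n, 'i, 'r) vbundle =
  indices :: "'i set"
  patch :: "'i \<Rightarrow> 'n pt set"
  trans :: "'i \<Rightarrow> 'i \<Rightarrow> 'n pt \<Rightarrow> complex ^ 'r ^ 'r"

definition vector_bundle ::
    "'n::finite pt set \<Rightarrow> ('n, 'i, 'r::finite) vbundle \<Rightarrow> bool" where
  "vector_bundle X E \<longleftrightarrow>
     (\<forall>i\<in>indices E. openin (ztop X) (patch E i)) \<and>
     (\<Union>i\<in>indices E. patch E i) = X \<and>
     (\<forall>i\<in>indices E. \<forall>j\<in>indices E. \<forall>a b.
        regular_on X (patch E i \<inter> patch E j) (\<lambda>x. trans E i j x $ a $ b)) \<and>
     (\<forall>i\<in>indices E. \<forall>x\<in>patch E i. trans E i i x = mat 1) \<and>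
     (\<forall>i\<in>indices E. \<forall>j\<in>indices E. \<forall>k\<in>indices E. \<forall>x\<in>patch E i \<inter> patch E j \<inter> patch E k.
        trans E i j x ** trans E j k x = trans E i k x)"

abbreviation line_bundle :: "'n::finite pt set \<Rightarrow> ('n, 'i, 1) vbundle \<Rightarrow> bool" where
  "line_bundle X L \<equiv> vector_bundle X L"

text \<open>Sections are extended by zero outside the patches, so that equality of sections is equality
  of functions and \<open>H0 X E\<close> is a subspace for the pointwise operations.\<close>

type_synonym ('n, 'i, 'r) sect = "'i \<Rightarrow> 'n pt \<Rightarrow> complex ^ 'r"

definition H0 :: "'n::finite pt set \<Rightarrow> ('n, 'i, 'r::finite) vbundle \<Rightarrow> ('n, 'i, 'r) sect set" where
  "H0 X E = {s.
     (\<forall>i\<in>indices E. \<forall>a. regular_on X (patch E i) (\<lambda>x. s i x $ a)) \<and>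
     (\<forall>i\<in>indices E. \<forall>j\<in>indices E. \<forall>x\<in>patch E i \<inter> patch E j. s i x = trans E i j x *v s j x) \<and>
     (\<forall>i x. \<not> (i \<in> indices E \<and> x \<in> patch E i) \<longrightarrow> s i x = 0)}"

definition sect_scale ::
    "complex \<Rightarrow> ('i \<Rightarrow> 'p \<Rightarrow> complex ^ 'r::finite) \<Rightarrow> ('i \<Rightarrow> 'p \<Rightarrow> complex ^ 'r)" where
  "sect_scale c s = (\<lambda>i x. c *s s i x)"

global_interpretation sect: vector_space
  "sect_scale :: complex \<Rightarrow> ('i \<Rightarrow> 'p \<Rightarrow> complex ^ 'r::finite) \<Rightarrow> ('i \<Rightarrow> 'p \<Rightarrow> complex ^ 'r)"
  by unfold_locales (auto simp: sect_scale_def fun_eq_iff vec_eq_iff algebra_simps)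

text \<open>\<open>W\<close> is a linear subspace of (finite) dimension \<open>k\<close>. The library's \<open>sect.dim\<close> is \<open>0\<close> for
  infinite-dimensional spaces and is therefore avoided.\<close>

definition subspace_of_dim ::
    "nat \<Rightarrow> ('i \<Rightarrow> 'p \<Rightarrow> complex ^ 'r::finite) set \<Rightarrow> bool" where
  "subspace_of_dim k W \<longleftrightarrow>
     (\<exists>B. finite B \<and> card B = k \<and> sect.independent B \<and> sect.span B = W)"

definition tensor_square :: "('n, 'i, 1) vbundle \<Rightarrow> ('n, 'i, 1) vbundle" where
  "tensor_square L = L\<lparr>trans := (\<lambda>i j x. trans L i j x ** trans L i j x)\<rparr>"

definition sect_mult ::
    "('n, 'i, 1) sect \<Rightarrow> ('n, 'i, 1) sect \<Rightarrow> ('n, 'i, 1) sect" where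
  "sect_mult v s = (\<lambda>i x. \<chi> k. v i x $ k * s i x $ k)"

definition det_bundle :: "('n, 'i, 'r::finite) vbundle \<Rightarrow> ('n, 'i, 1) vbundle" where
  "det_bundle E =
     \<lparr>indices = indices E, patch = patch E, trans = (\<lambda>i j x. mat (det (trans E i j x)))\<rparr>"

text \<open>An isomorphism \<open>E \<rightarrow> F\<close>, in the given trivialisations: \<open>\<phi> i j\<close> is its matrix over the
  intersection of patch \<open>i\<close> of \<open>F\<close> and patch \<open>j\<close> of \<open>E\<close>. The two covers may be different.\<close>

definition bundle_iso ::
    "'n::finite pt set \<Rightarrow> ('n, 'j, 'r::finite) vbundle \<Rightarrow> ('n, 'i, 'r) vbundle \<Rightarrow>
     ('i \<Rightarrow> 'j \<Rightarrow> 'n pt \<Rightarrow> complex ^ 'r ^ 'r) \<Rightarrow> bool" where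
  "bundle_iso X E F \<phi> \<longleftrightarrow>
     (\<forall>i\<in>indices F. \<forall>j\<in>indices E.
        (\<forall>a b. regular_on X (patch F i \<inter> patch E j) (\<lambda>x. \<phi> i j x $ a $ b)) \<and>
        (\<forall>x\<in>patch F i \<inter> patch E j. invertible (\<phi> i j x))) \<and>
     (\<forall>i\<in>indices F. \<forall>i'\<in>indices F. \<forall>j\<in>indices E. \<forall>j'\<in>indices E.
        \<forall>x\<in>patch F i \<inter> patch F i' \<inter> patch E j \<inter> patch E j'.
          \<phi> i j x ** trans E j j' x = trans F i i' x ** \<phi> i' j' x)"

text \<open>The induced map on sections; the choice of \<open>j\<close> is immaterial for \<open>s \<in> H0 X E\<close>.\<close>

definition apply_iso ::
    "('n, 'j, 'r::finite) vbundle \<Rightarrow> ('n, 'i, 'r) vbundle \<Rightarrow>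
     ('i \<Rightarrow> 'j \<Rightarrow> 'n pt \<Rightarrow> complex ^ 'r ^ 'r) \<Rightarrow> ('n, 'j, 'r) sect \<Rightarrow> ('n, 'i, 'r) sect" where
  "apply_iso E F \<phi> s = (\<lambda>i x. if i \<in> indices F \<and> x \<in> patch F i
     then (let j = (SOME j. j \<in> indices E \<and> x \<in> patch E j) in \<phi> i j x *v s j x) else 0)"

text \<open>\<open>det_map E L \<phi> t u\<close> is the section \<open>d(t \<and> u)\<close> of \<open>L\<close>, where \<open>\<phi>\<close> identifies \<open>det E\<close> with \<open>L\<close>.\<close>

definition det_map ::
    "('n, 'j, 2) vbundle \<Rightarrow> ('n, 'i, 1) vbundle \<Rightarrow> ('i \<Rightarrow> 'j \<Rightarrow> 'n pt \<Rightarrow> complex ^ 1 ^ 1) \<Rightarrow>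
     ('n, 'j, 2) sect \<Rightarrow> ('n, 'j, 2) sect \<Rightarrow> ('n, 'i, 1) sect" where
  "det_map E L \<phi> t u = apply_iso (det_bundle E) L \<phi>
     (\<lambda>j x. \<chi> k. det (vector [t j x, u j x] :: complex ^ 2 ^ 2))"

section \<open>Exterior powers tensored with a space\<close>

text \<open>\<open>\<Lambda>\<^sup>p V \<otimes> S\<close> is the space \<open>formal p V S\<close> of formal complex linear combinations of symbols
  \<open>(v\<^sub>1 \<and> \<dots> \<and> v\<^sub>p) \<otimes> s\<close>, encoded as \<open>([v\<^sub>1, \<dots>, v\<^sub>p], s)\<close>, modulo the subspace \<open>relations\<close>
  spanned by the multilinear and alternating relators. Elements are handled through their
  representatives in \<open>formal p V S\<close>.\<close>

type_synonym ('v, 's) comb = "('v list \<times> 's) \<Rightarrow>\<^sub>0 complex"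

definition comb_scale :: "complex \<Rightarrow> ('k \<Rightarrow>\<^sub>0 complex) \<Rightarrow> ('k \<Rightarrow>\<^sub>0 complex)" where
  "comb_scale c x = Poly_Mapping.map ((*) c) x"

lemma lookup_comb_scale: "Poly_Mapping.lookup (comb_scale c x) k = c * Poly_Mapping.lookup x k"
  unfolding comb_scale_def Poly_Mapping.map.rep_eq by (simp add: when_def)

global_interpretation comb: vector_space "comb_scale :: complex \<Rightarrow> ('k \<Rightarrow>\<^sub>0 complex) \<Rightarrow> ('k \<Rightarrow>\<^sub>0 complex)"
  by unfold_locales
    (rule poly_mapping_eqI, simp add: lookup_comb_scale lookup_add distrib_left distrib_right mult.assoc)+

definition symbols :: "nat \<Rightarrow> 'v set \<Rightarrow> 's set \<Rightarrow> ('v list \<times> 's) set" where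
  "symbols p V S = {vs. length vs = p \<and> set vs \<subseteq> V} \<times> S"

definition formal :: "nat \<Rightarrow> 'v set \<Rightarrow> 's set \<Rightarrow> ('v, 's) comb set" where
  "formal p V S = {x. Poly_Mapping.keys x \<subseteq> symbols p V S}"

inductive_set relators ::
    "(complex \<Rightarrow> 'v \<Rightarrow> 'v) \<Rightarrow> (complex \<Rightarrow> 's \<Rightarrow> 's) \<Rightarrow> nat \<Rightarrow> 'v::ab_group_add set \<Rightarrow>
     's::ab_group_add set \<Rightarrow> ('v, 's) comb set"
  for scV scS p V S where
  add_V: "(vs, s) \<in> symbols p V S \<Longrightarrow> i < p \<Longrightarrow> a \<in> V \<Longrightarrow> b \<in> V \<Longrightarrow>
      Poly_Mapping.single (vs[i := a + b], s) 1 - Poly_Mapping.single (vs[i := a], s) 1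
        - Poly_Mapping.single (vs[i := b], s) 1 \<in> relators scV scS p V S"
| scale_V: "(vs, s) \<in> symbols p V S \<Longrightarrow> i < p \<Longrightarrow> a \<in> V \<Longrightarrow>
      Poly_Mapping.single (vs[i := scV c a], s) 1 - Poly_Mapping.single (vs[i := a], s) c
        \<in> relators scV scS p V S"
| alternating: "(vs, s) \<in> symbols p V S \<Longrightarrow> i < j \<Longrightarrow> j < p \<Longrightarrow> vs ! i = vs ! j \<Longrightarrow>
      Poly_Mapping.single (vs, s) 1 \<in> relators scV scS p V S"
| add_S: "(vs, s) \<in> symbols p V S \<Longrightarrow> s' \<in> S \<Longrightarrow>
      Poly_Mapping.single (vs, s + s') 1 - Poly_Mapping.single (vs, s) 1
        - Poly_Mapping.single (vs, s') 1 \<in> relators scV scS p V S"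
| scale_S: "(vs, s) \<in> symbols p V S \<Longrightarrow>
      Poly_Mapping.single (vs, scS c s) 1 - Poly_Mapping.single (vs, s) c
        \<in> relators scV scS p V S"

definition relations ::
    "(complex \<Rightarrow> 'v \<Rightarrow> 'v) \<Rightarrow> (complex \<Rightarrow> 's \<Rightarrow> 's) \<Rightarrow> nat \<Rightarrow> 'v::ab_group_add set \<Rightarrow>
     's::ab_group_add set \<Rightarrow> ('v, 's) comb set" where
  "relations scV scS p V S = comb.span (relators scV scS p V S)"

section \<open>Koszul cohomology\<close>

text \<open>The Koszul differential on formal combinations, for a product \<open>\<mu> v s\<close>. List positions start
  at \<open>0\<close>, whence the exponent \<open>Suc i\<close>.\<close>

definition koszul_diff :: "('v \<Rightarrow> 's \<Rightarrow> 's') \<Rightarrow> ('v, 's) comb \<Rightarrow> ('v, 's') comb" where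
  "koszul_diff \<mu> x = (\<Sum>(vs, s)\<in>Poly_Mapping.keys x. \<Sum>i<length vs.
     Poly_Mapping.single (take i vs @ drop (Suc i) vs, \<mu> (vs ! i) s)
       ((-1) ^ Suc i * Poly_Mapping.lookup x (vs, s)))"

definition koszul_cycles ::
    "'n::finite pt set \<Rightarrow> ('n, 'i, 1) vbundle \<Rightarrow> nat \<Rightarrow> (('n, 'i, 1) sect, ('n, 'i, 1) sect) comb set"
    where
  "koszul_cycles X L p = {x \<in> formal p (H0 X L) (H0 X L).
     koszul_diff sect_mult x
       \<in> relations sect_scale sect_scale (p - 1) (H0 X L) (H0 X (tensor_square L))}"

text \<open>For the first map, \<open>\<Lambda>\<^sup>p\<^sup>+\<^sup>1 V\<close> is written as \<open>\<Lambda>\<^sup>p\<^sup>+\<^sup>1 V \<otimes> \<complex>\<close>.\<close>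

definition koszul_boundaries ::
    "'n::finite pt set \<Rightarrow> ('n, 'i, 1) vbundle \<Rightarrow> nat \<Rightarrow> (('n, 'i, 1) sect, ('n, 'i, 1) sect) comb set"
    where
  "koszul_boundaries X L p = {x \<in> formal p (H0 X L) (H0 X L).
     \<exists>y\<in>formal (p + 1) (H0 X L) (UNIV :: complex set).
       x - koszul_diff (\<lambda>v c. sect_scale c v) y
         \<in> relations sect_scale sect_scale p (H0 X L) (H0 X L)}"

text \<open>The class of a cycle: its coset modulo the boundaries (which contain the relations), as a set
  of formal combinations.\<close>

definition koszul_class ::
    "'n::finite pt set \<Rightarrow> ('n, 'i, 1) vbundle \<Rightarrow> nat \<Rightarrow> (('n, 'i, 1) sect, ('n, 'i, 1) sect) comb \<Rightarrow>
     (('n, 'i, 1) sect, ('n, 'i, 1) sect) comb set" where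
  "koszul_class X L p x =
     {y \<in> formal p (H0 X L) (H0 X L). y - x \<in> koszul_boundaries X L p}"

definition K1 ::
    "'n::finite pt set \<Rightarrow> ('n, 'i, 1) vbundle \<Rightarrow> nat \<Rightarrow>
     (('n, 'i, 1) sect, ('n, 'i, 1) sect) comb set set" where
  "K1 X L p = koszul_class X L p ` koszul_cycles X L p"

text \<open>\<open>\<alpha>\<close> is represented by an element of \<open>\<Lambda>\<^sup>p W \<otimes> H0 X L\<close>.\<close>

definition represented_over ::
    "'n::finite pt set \<Rightarrow> ('n, 'i, 1) vbundle \<Rightarrow> nat \<Rightarrow> ('n, 'i, 1) sect set \<Rightarrow>
     (('n, 'i, 1) sect, ('n, 'i, 1) sect) comb set \<Rightarrow> bool" where
  "represented_over X L p W \<alpha> \<longleftrightarrow>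
     (\<exists>x\<in>formal p W (H0 X L). x \<in> koszul_cycles X L p \<and> \<alpha> = koszul_class X L p x)"

definition koszul_rank ::
    "'n::finite pt set \<Rightarrow> ('n, 'i, 1) vbundle \<Rightarrow> nat \<Rightarrow>
     (('n, 'i, 1) sect, ('n, 'i, 1) sect) comb set \<Rightarrow> nat" where
  "koszul_rank X L p \<alpha> =
     (LEAST k. \<exists>W. W \<subseteq> H0 X L \<and> subspace_of_dim k W \<and> represented_over X L p W \<alpha>)"

section \<open>The classes \<open>\<gamma>(W, t)\<close>\<close>

definition admissible ::
    "'n::finite pt set \<Rightarrow> ('n, 'j, 2) vbundle \<Rightarrow> ('n, 'i, 1) vbundle \<Rightarrow>
     ('i \<Rightarrow> 'j \<Rightarrow> 'n pt \<Rightarrow> complex ^ 1 ^ 1) \<Rightarrow> nat \<Rightarrow> ('n, 'i, 1) sect set \<Rightarrow> ('n, 'j, 2) sect \<Rightarrow>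
     ('n, 'j, 2) sect set \<Rightarrow> bool" where
  "admissible X E L \<phi> p W t U \<longleftrightarrow>
     U \<subseteq> H0 X E \<and> subspace_of_dim (p + 2) U \<and>
     U \<inter> {u \<in> H0 X E. det_map E L \<phi> t u = 0} = {0} \<and>
     det_map E L \<phi> t ` U = W"

definition basis_2_to :: "nat \<Rightarrow> (nat \<Rightarrow> 'i \<Rightarrow> 'p \<Rightarrow> complex ^ 'r::finite) \<Rightarrow>
    ('i \<Rightarrow> 'p \<Rightarrow> complex ^ 'r) set \<Rightarrow> bool" where
  "basis_2_to m e U \<longleftrightarrow>
     inj_on e {2..m} \<and> sect.independent (e ` {2..m}) \<and> sect.span (e ` {2..m}) = U"

definition gamma ::
    "('n, 'j, 2) vbundle \<Rightarrow> ('n, 'i, 1) vbundle \<Rightarrow> ('i \<Rightarrow> 'j \<Rightarrow> 'n pt \<Rightarrow> complex ^ 1 ^ 1) \<Rightarrow> nat \<Rightarrow>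
     ('n, 'j, 2) sect \<Rightarrow> (nat \<Rightarrow> ('n, 'j, 2) sect) \<Rightarrow>
     (('n, 'i, 1) sect, ('n, 'i, 1) sect) comb" where
  "gamma E L \<phi> p t e = (\<Sum>(i, j)\<in>{(i, j). 2 \<le> i \<and> i < j \<and> j \<le> p + 3}.
     Poly_Mapping.single
       (map (\<lambda>k. det_map E L \<phi> t (e k)) (filter (\<lambda>k. k \<noteq> i \<and> k \<noteq> j) [2..<p + 4]),
        det_map E L \<phi> (e i) (e j))
       ((-1) ^ (i + j)))"

end

theory Submission
  imports Defs "HOL-Computational_Algebra.Polynomial"
begin

text \<open>Let \<open>w\<^sub>2, \<dots>, w\<^sub>p\<^sub>+\<^sub>3\<close> be a basis of \<open>W\<close>. An element of \<open>\<Lambda>\<^sup>p W \<otimes> H\<^sup>0(X, L)\<close> has coefficients \<open>A\<^sub>i\<^sub>j \<in> H\<^sup>0(X, L)\<close> with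
  \<open>2 \<le> i < j \<le> p + 3\<close>, because a basis vector of \<open>\<Lambda>\<^sup>p W\<close> omits two of the \<open>w\<^sub>k\<close> (lemma \<open>tensor_normal_form\<close>). It is a
  cycle only if \<open>w\<^sub>a A\<^sub>b\<^sub>c - w\<^sub>b A\<^sub>a\<^sub>c + w\<^sub>c A\<^sub>a\<^sub>b = 0\<close> in \<open>H\<^sup>0(X, L\<^sup>2)\<close> for all \<open>a < b < c\<close> (lemma \<open>pluecker_from_cycle\<close>). With
  \<open>A\<^sub>1\<^sub>k = w\<^sub>k\<close> one obtains a skew matrix of sections of \<open>L\<close>. Where \<open>w\<^sub>2\<close> does not vanish, these relations make the
  matrix decomposable, hence of rank two, and so it satisfies the Pluecker relations everywhere.

  Such a matrix comes from a bundle \<open>E\<close> of rank two with determinant \<open>L\<close> and sections \<open>s\<^sub>1, \<dots>, s\<^sub>p\<^sub>+\<^sub>3\<close> with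
  \<open>s\<^sub>j \<and> s\<^sub>k = A\<^sub>j\<^sub>k\<close> (lemma \<open>bundle_of_skew_matrix\<close>). The local rings of \<open>X\<close> are discrete valuation rings, so that near
  every point some entry \<open>A\<^sub>a\<^sub>b\<close> divides all the others (lemma \<open>common_divisor\<close>). There \<open>A\<close> is the wedge product of the
  regular rows \<open>A\<^sub>a\<^sub>j / A\<^sub>a\<^sub>b\<close> and \<open>A\<^sub>b\<^sub>j\<close>, and the columns of the matrix with these two rows are the \<open>s\<^sub>j\<close> in
  a local trivialisation of \<open>E\<close>. The zeros of \<open>A\<close> are isolated, and it suffices to place each of them in a single patch. Now \<open>t = s\<^sub>1\<close>
  and the span \<open>U\<close> of the \<open>e\<^sub>k = s\<^sub>k\<close> with \<open>k \<ge> 2\<close> give \<open>d(t \<and> e\<^sub>k) = w\<^sub>k\<close> and \<open>d(e\<^sub>i \<and> e\<^sub>j) = A\<^sub>i\<^sub>j\<close>, so that \<open>\<gamma>(W, t)\<close> is the class of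
  the given element.

  The facts on curves that enter are derived from the description of \<open>X\<close> by homogeneous equations. The
  Jacobian criterion bounds the cotangent space by dimension one, whence a local parameter by the argument of
  Nakayama's lemma (lemma \<open>local_parameter_exists\<close>). Orders of vanishing are finite by Krull's argument
  (lemma \<open>finite_order\<close>), which uses the Hilbert basis theorem. Since \<open>X\<close> is connected, a section of a line
  bundle that vanishes near one point vanishes (lemma \<open>nonzero_section_not_locally_zero\<close>).\<close>

section \<open>Noetherian rings and the Hilbert basis theorem\<close>

text \<open>The ideal of a subring \<open>R\<close> generated by \<open>G\<close>. Rings are subsets of an ambient commutative ring, so
  that rings of polynomial functions in varying sets of variables can share one type.\<close>

inductive_set ideal_gen :: "'a::comm_ring_1 set \<Rightarrow> 'a set \<Rightarrow> 'a set" for R G where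
  zero: "0 \<in> ideal_gen R G"
| step: "r \<in> R \<Longrightarrow> g \<in> G \<Longrightarrow> x \<in> ideal_gen R G \<Longrightarrow> r * g + x \<in> ideal_gen R G"

definition is_subring :: "'a::comm_ring_1 set \<Rightarrow> bool" where
  "is_subring R \<longleftrightarrow> 0 \<in> R \<and> 1 \<in> R \<and> (\<forall>x\<in>R. - x \<in> R) \<and> (\<forall>x\<in>R. \<forall>y\<in>R. x + y \<in> R \<and> x * y \<in> R)"

text \<open>Every subset, not only every ideal, is required to lie in the ideal generated by a finite part of
  it; for a subring this is the usual condition.\<close>

definition noetherian :: "'a::comm_ring_1 set \<Rightarrow> bool" where
  "noetherian R \<longleftrightarrow> (\<forall>J\<subseteq>R. \<exists>G\<subseteq>J. finite G \<and> J \<subseteq> ideal_gen R G)"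

lemma ideal_gen_add: "x \<in> ideal_gen R G \<Longrightarrow> y \<in> ideal_gen R G \<Longrightarrow> x + y \<in> ideal_gen R G"
  by (induction rule: ideal_gen.induct) (auto simp: add.assoc intro: ideal_gen.step)

lemma ideal_gen_mult:
  assumes "is_subring R" "r \<in> R" "x \<in> ideal_gen R G"
  shows "r * x \<in> ideal_gen R G"
  using assms(3)
proof induction
  case zero
  then show ?case by (simp add: ideal_gen.zero)
next
  case (step s g x)
  have "(r * s) * g + r * x \<in> ideal_gen R G"
    using assms step by (intro ideal_gen.step) (auto simp: is_subring_def)
  then show ?case by (simp add: algebra_simps)
qed

lemma ideal_gen_superset: "is_subring R \<Longrightarrow> g \<in> G \<Longrightarrow> g \<in> ideal_gen R G"
  using ideal_gen.step[of 1 R g G 0] by (simp add: is_subring_def ideal_gen.zero)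

lemma ideal_gen_subset:
  assumes "is_subring R" "G \<subseteq> ideal_gen R H"
  shows "ideal_gen R G \<subseteq> ideal_gen R H"
proof
  fix x assume "x \<in> ideal_gen R G"
  then show "x \<in> ideal_gen R H"
    by induction (use assms in \<open>auto intro: ideal_gen.zero ideal_gen_add ideal_gen_mult\<close>)
qed

lemma ideal_gen_mono:
  assumes "G \<subseteq> H"
  shows "ideal_gen R G \<subseteq> ideal_gen R H"
proof
  fix x assume "x \<in> ideal_gen R G"
  then show "x \<in> ideal_gen R H"
    by induction (use assms in \<open>auto intro: ideal_gen.intros\<close>)
qed

lemma ideal_gen_finite:
  assumes "x \<in> ideal_gen R J"
  shows "\<exists>G\<subseteq>J. finite G \<and> x \<in> ideal_gen R G"
  using assms
proof induction
  case zero
  then show ?case by (intro exI[of _ "{}"]) (auto intro: ideal_gen.zero)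
next
  case (step r g x)
  then obtain G where G: "G \<subseteq> J" "finite G" "x \<in> ideal_gen R G" by blast
  have "r * g + x \<in> ideal_gen R (insert g G)"
    using step(1) G(3) ideal_gen_mono[of G "insert g G" R] by (intro ideal_gen.step) auto
  then show ?case using G step(2) by (intro exI[of _ "insert g G"]) auto
qed

lemma ideal_gen_sum:
  assumes "is_subring R" "finite A" "\<And>a. a \<in> A \<Longrightarrow> f a \<in> ideal_gen R G"
  shows "sum f A \<in> ideal_gen R G"
  using assms(2,3) by (induction) (auto intro: ideal_gen.zero ideal_gen_add)

lemma ideal_gen_image_sum:
  assumes "is_subring R" "finite A" "x \<in> ideal_gen R (a ` A)"
  shows "\<exists>c. (\<forall>j. c j \<in> R) \<and> x = (\<Sum>j\<in>A. c j * a j)"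
  using assms(3)
proof induction
  case zero
  then show ?case using assms(1) by (intro exI[of _ "\<lambda>_. 0"]) (auto simp: is_subring_def)
next
  case (step r g x)
  then obtain c i where c: "\<forall>j. c j \<in> R" "x = (\<Sum>j\<in>A. c j * a j)" and i: "i \<in> A" "g = a i"
    by blast
  have "r * g + x = (\<Sum>j\<in>A. (if j = i then r else 0) * a j + c j * a j)"
    using i assms(2) by (simp add: sum.distrib c(2) if_distrib[of "\<lambda>t. t * _"] sum.delta cong: if_cong)
  then show ?case
    using c(1) step(1) assms(1)
    by (intro exI[of _ "\<lambda>j. (if j = i then r else 0) + c j"])
       (auto simp: is_subring_def distrib_right)
qed

text \<open>The ascending chain condition, in the form in which it is applied: some member of the sequence is
  a combination of the earlier ones.\<close>

lemma noetherian_sequence: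
  fixes a :: "nat \<Rightarrow> 'a::comm_ring_1"
  assumes "is_subring R" "noetherian R" "\<And>n. a n \<in> R"
  shows "\<exists>K c. (\<forall>j. c j \<in> R) \<and> a K = (\<Sum>j<K. c j * a j)"
proof -
  obtain G where G: "G \<subseteq> range a" "finite G" "range a \<subseteq> ideal_gen R G"
    using assms(2,3) unfolding noetherian_def by (metis image_subsetI)
  obtain I where I: "finite I" "G = a ` I"
    using G(1,2) by (meson finite_subset_image)
  obtain K where "I \<subseteq> {..<K}"
    using I(1) unfolding finite_nat_iff_bounded by blast
  then have "a K \<in> ideal_gen R (a ` {..<K})"
    using G(3) ideal_gen_mono[of G "a ` {..<K}" R] I(2) by blast
  from ideal_gen_image_sum[OF assms(1) _ this] show ?thesis by auto
qed

text \<open>Polynomials with coefficients in \<open>R\<close>.\<close>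

definition poly_over :: "'a::comm_ring_1 set \<Rightarrow> 'a poly set" where
  "poly_over R = {p. \<forall>i. coeff p i \<in> R}"

lemma is_subring_sum:
  assumes "is_subring R" "\<And>a. a \<in> A \<Longrightarrow> f a \<in> R"
  shows "sum f A \<in> R"
  using assms(2) by (induction A rule: infinite_finite_induct) (use assms(1) in \<open>auto simp: is_subring_def\<close>)

lemma is_subring_poly_over: "is_subring R \<Longrightarrow> is_subring (poly_over R)"
  unfolding is_subring_def[of "poly_over R"] poly_over_def
  by (auto simp: coeff_mult is_subring_def intro!: is_subring_sum)

lemma monom_in_poly_over: "is_subring R \<Longrightarrow> c \<in> R \<Longrightarrow> monom c n \<in> poly_over R"
  by (auto simp: poly_over_def is_subring_def)

text \<open>The proof is the classical one: if the ideal \<open>I\<close> is not finitely generated, polynomials \<open>g k\<close> of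
  least degree outside the ideal of their predecessors have a leading coefficient that is a
  combination of earlier ones, and cancelling it lowers the degree.\<close>

theorem hilbert_basis:
  assumes R: "is_subring R" "noetherian R"
  shows "noetherian (poly_over R)"
  unfolding noetherian_def
proof (intro allI impI)
  fix J assume J: "J \<subseteq> poly_over R"
  let ?P = "poly_over R"
  note P = is_subring_poly_over[OF R(1)]
  define I where "I = ideal_gen ?P J"
  have IP: "I \<subseteq> ?P"
  proof
    fix x assume "x \<in> I"
    then show "x \<in> ?P" unfolding I_def
      by induction (use J P in \<open>auto simp: is_subring_def\<close>)
  qed
  have "\<exists>G\<subseteq>I. finite G \<and> I \<subseteq> ideal_gen ?P G"
  proof (rule ccontr)
    assume "\<not> ?thesis"
    then have bad: "\<exists>p. p \<in> I - ideal_gen ?P G" if "finite G" "G \<subseteq> I" for G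
      using that by blast
    define nxt where "nxt G = (ARG_MIN degree p. p \<in> I - ideal_gen ?P G)" for G
    have nxt: "nxt G \<in> I - ideal_gen ?P G"
      "\<And>q. q \<in> I - ideal_gen ?P G \<Longrightarrow> degree (nxt G) \<le> degree q" if fG: "finite G" "G \<subseteq> I" for G
    proof -
      obtain p where p: "p \<in> I - ideal_gen ?P G" using bad[OF fG] by blast
      show "nxt G \<in> I - ideal_gen ?P G"
        unfolding nxt_def by (rule arg_min_natI) (rule p)
      show "degree (nxt G) \<le> degree q" if "q \<in> I - ideal_gen ?P G" for q
        unfolding nxt_def by (rule arg_min_nat_le) (rule that)
    qed
    define S where "S = rec_nat {} (\<lambda>_ G. insert (nxt G) G)"
    define g where "g k = nxt (S k)" for k
    have S0: "S 0 = {}" and SSuc: "S (Suc k) = insert (g k) (S k)" for k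
      by (auto simp: S_def g_def)
    have S: "finite (S k)" "S k \<subseteq> I" "S k = g ` {..<k}" for k
      by (induction k) (use nxt in \<open>auto simp: S0 SSuc g_def lessThan_Suc\<close>)
    have g: "g k \<in> I" "g k \<notin> ideal_gen ?P (S k)" for k
      using nxt(1)[OF S(1,2)] by (auto simp: g_def)
    have mono: "degree (g j) \<le> degree (g k)" if "j < k" for j k
    proof -
      have "S j \<subseteq> S k" using that by (auto simp: S(3))
      then have "g k \<in> I - ideal_gen ?P (S j)" using g ideal_gen_mono[of "S j" "S k" ?P] by blast
      then show ?thesis using nxt(2)[OF S(1,2)] by (simp add: g_def)
    qed
    have "coeff (g k) (degree (g k)) \<in> R" for k
      using g(1) IP by (auto simp: poly_over_def)
    from noetherian_sequence[OF R, of "\<lambda>k. lead_coeff (g k)", OF this] obtain K c where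
      c: "\<forall>j. c j \<in> R" "lead_coeff (g K) = (\<Sum>j<K. c j * lead_coeff (g j))" by blast
    (* q has the same leading term as g K. *)
    define q where "q = (\<Sum>j<K. monom (c j) (degree (g K) - degree (g j)) * g j)"
    have q: "q \<in> ideal_gen ?P (S K)" unfolding q_def
      by (intro ideal_gen_sum ideal_gen_mult ideal_gen_superset P monom_in_poly_over R)
         (auto simp: c S(3))
    have "ideal_gen ?P (S K) \<subseteq> I" unfolding I_def
      using S(2)[of K] by (intro ideal_gen_subset P) (simp add: I_def)
    then have qI: "q \<in> I" using q by blast
    have nI: "- x \<in> ideal_gen ?P G" if "x \<in> ideal_gen ?P G" for x G
      using ideal_gen_mult[OF P _ that, of "-1"] P by (auto simp: is_subring_def)
    have "g K - q \<in> I" using ideal_gen_add[of "g K" ?P J "- q"] nI g(1) qI by (auto simp: I_def)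
    moreover have nq: "g K - q \<notin> ideal_gen ?P (S K)"
      using ideal_gen_add[of "g K - q" ?P "S K" q] q g(2) by auto
    ultimately have le: "degree (g K) \<le> degree (g K - q)"
      using nxt(2)[OF S(1,2)] by (simp add: g_def)
    have "coeff q (degree (g K)) = (\<Sum>j<K. c j * lead_coeff (g j))"
      unfolding q_def coeff_sum using mono by (intro sum.cong) (auto simp: coeff_monom_mult)
    then have "coeff (g K - q) (degree (g K)) = 0" using c(2) by simp
    moreover have "degree q \<le> degree (g K)"
    proof -
      have "degree (monom (c j) (degree (g K) - degree (g j)) * g j) \<le> degree (g K)" if "j < K" for j
      proof (rule degree_le, safe)
        fix i assume i: "degree (g K) < i"
        then have "coeff (g j) (i - (degree (g K) - degree (g j))) = 0"
          using mono[OF that] by (intro coeff_eq_0) auto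
        then show "coeff (monom (c j) (degree (g K) - degree (g j)) * g j) i = 0"
          by (simp add: coeff_monom_mult)
      qed
      then show ?thesis unfolding q_def by (intro degree_sum_le) auto
    qed
    then have "degree (g K - q) \<le> degree (g K)" by (simp add: degree_diff_le)
    ultimately have "g K - q = 0" using le
      by (metis antisym leading_coeff_0_iff)
    then show False using nq by (simp add: ideal_gen.zero)
  qed
  then obtain G where G: "G \<subseteq> I" "finite G" "I \<subseteq> ideal_gen ?P G" by blast
  have "\<forall>x\<in>G. \<exists>H\<subseteq>J. finite H \<and> x \<in> ideal_gen ?P H"
    using G(1) ideal_gen_finite unfolding I_def by blast
  then obtain H where H: "\<forall>x\<in>G. H x \<subseteq> J \<and> finite (H x) \<and> x \<in> ideal_gen ?P (H x)" by metis
  have "G \<subseteq> ideal_gen ?P (\<Union>(H ` G))"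
  proof
    fix x assume "x \<in> G"
    then show "x \<in> ideal_gen ?P (\<Union>(H ` G))"
      using H ideal_gen_mono[of "H x" "\<Union>(H ` G)" ?P] by blast
  qed
  then have "ideal_gen ?P G \<subseteq> ideal_gen ?P (\<Union>(H ` G))" by (rule ideal_gen_subset[OF P])
  moreover have "J \<subseteq> I" unfolding I_def using ideal_gen_superset[OF P] by blast
  ultimately have "J \<subseteq> ideal_gen ?P (\<Union>(H ` G))" using G(3) by blast
  moreover have "\<Union>(H ` G) \<subseteq> J" "finite (\<Union>(H ` G))" using H G(2) by auto
  ultimately show "\<exists>G\<subseteq>J. finite G \<and> J \<subseteq> ideal_gen ?P G" by blast
qed

lemma noetherian_image:
  assumes "noetherian R" "f 0 = 0" "\<And>x y. f (x + y) = f x + f y" "\<And>x y. f (x * y) = f x * f y"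
  shows "noetherian (f ` R)"
  unfolding noetherian_def
proof (intro allI impI)
  fix J assume J: "J \<subseteq> f ` R"
  obtain G where G: "G \<subseteq> {r \<in> R. f r \<in> J}" "finite G" "{r \<in> R. f r \<in> J} \<subseteq> ideal_gen R G"
    using assms(1) unfolding noetherian_def by (metis (no_types, lifting) mem_Collect_eq subsetI)
  have *: "f x \<in> ideal_gen (f ` R) (f ` G)" if "x \<in> ideal_gen R G" for x
    using that by induction (auto simp: assms intro: ideal_gen.intros)
  show "\<exists>G\<subseteq>J. finite G \<and> J \<subseteq> ideal_gen (f ` R) G"
    using G J * by (intro exI[of _ "f ` G"]) blast
qed

section \<open>Polynomial functions\<close>

text \<open>Polynomial functions on \<open>complex ^ 'n\<close> in the coordinates indexed by \<open>I\<close>. Adjoining coordinates one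
  at a time makes them a Noetherian ring.\<close>

inductive_set polyfun :: "'n set \<Rightarrow> (complex ^ 'n \<Rightarrow> complex) set" for I where
  const: "(\<lambda>_. c) \<in> polyfun I"
| coord: "i \<in> I \<Longrightarrow> (\<lambda>v. v $ i) \<in> polyfun I"
| add: "f \<in> polyfun I \<Longrightarrow> g \<in> polyfun I \<Longrightarrow> (\<lambda>v. f v + g v) \<in> polyfun I"
| mult: "f \<in> polyfun I \<Longrightarrow> g \<in> polyfun I \<Longrightarrow> (\<lambda>v. f v * g v) \<in> polyfun I"

lemma is_subring_polyfun: "is_subring (polyfun I)"
  unfolding is_subring_def
proof (intro conjI ballI)
  show "0 \<in> polyfun I" "1 \<in> polyfun I"
    using polyfun.const[of 0 I] polyfun.const[of 1 I] by (simp_all add: zero_fun_def one_fun_def)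
  fix f g :: "complex ^ 'a \<Rightarrow> complex" assume f: "f \<in> polyfun I" and g: "g \<in> polyfun I"
  show "- f \<in> polyfun I" using polyfun.mult[OF polyfun.const f, of "-1"] by (simp add: fun_Compl_def)
  show "f + g \<in> polyfun I" using polyfun.add[OF f g] by (simp add: plus_fun_def)
  show "f * g \<in> polyfun I" using polyfun.mult[OF f g] by (simp add: times_fun_def)
qed

lemma polyfun_mono: "f \<in> polyfun I \<Longrightarrow> I \<subseteq> J \<Longrightarrow> f \<in> polyfun J"
  by (induction rule: polyfun.induct) (auto intro: polyfun.intros)

lemma polyfun_sum: "(\<And>a. a \<in> A \<Longrightarrow> f a \<in> polyfun I) \<Longrightarrow> (\<lambda>v. \<Sum>a\<in>A. f a v) \<in> polyfun I"
  by (induction A rule: infinite_finite_induct) (auto intro: polyfun.intros)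

lemma polyfun_prod: "(\<And>a. a \<in> A \<Longrightarrow> f a \<in> polyfun I) \<Longrightarrow> (\<lambda>v. \<Prod>a\<in>A. f a v) \<in> polyfun I"
  by (induction A rule: infinite_finite_induct) (auto intro: polyfun.intros)

lemma polyfun_power: "f \<in> polyfun I \<Longrightarrow> (\<lambda>v. f v ^ k) \<in> polyfun I"
  by (induction k) (auto intro: polyfun.intros)

lemma polyfun_insert:
  "polyfun (insert i I) = (\<lambda>p. poly p (\<lambda>v. v $ i)) ` poly_over (polyfun I)"
proof (intro equalityI subsetI)
  fix f assume "f \<in> polyfun (insert i I)"
  then show "f \<in> (\<lambda>p. poly p (\<lambda>v. v $ i)) ` poly_over (polyfun I)"
  proof induction
    case (const c)
    have "monom (\<lambda>_. c) 0 \<in> poly_over (polyfun I)"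
      by (intro monom_in_poly_over is_subring_polyfun polyfun.const)
    moreover have "poly (monom (\<lambda>_. c) 0) (\<lambda>v. v $ i) = (\<lambda>_. c)"
      by (simp add: poly_monom)
    ultimately show ?case by (metis imageI)
  next
    case (coord j)
    show ?case
    proof (cases "j = i")
      case True
      have "monom 1 1 \<in> poly_over (polyfun I)"
        using is_subring_polyfun[of I] by (intro monom_in_poly_over) (auto simp: is_subring_def)
      moreover have "poly (monom 1 1) (\<lambda>v :: complex ^ 'a. v $ i) = (\<lambda>v. v $ i)"
        by (simp only: poly_monom power_one_right mult_1_left)
      ultimately show ?thesis using True by (metis imageI)
    next
      case False
      have "monom (\<lambda>v. v $ j) 0 \<in> poly_over (polyfun I)"
        using False coord by (intro monom_in_poly_over is_subring_polyfun polyfun.coord) auto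
      moreover have "poly (monom (\<lambda>v :: complex ^ 'a. v $ j) 0) (\<lambda>v. v $ i) = (\<lambda>v. v $ j)"
        by (simp add: poly_monom)
      ultimately show ?thesis by (metis imageI)
    qed
  next
    case (add f g)
    then obtain p q where p: "p \<in> poly_over (polyfun I)" "f = poly p (\<lambda>v. v $ i)"
      and q: "q \<in> poly_over (polyfun I)" "g = poly q (\<lambda>v. v $ i)" by blast
    have "p + q \<in> poly_over (polyfun I)"
      using p q is_subring_poly_over[OF is_subring_polyfun] by (auto simp: is_subring_def)
    moreover have "(\<lambda>v. f v + g v) = poly (p + q) (\<lambda>v. v $ i)"
      by (simp add: p q plus_fun_def)
    ultimately show ?case by blast
  next
    case (mult f g)
    then obtain p q where p: "p \<in> poly_over (polyfun I)" "f = poly p (\<lambda>v. v $ i)"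
      and q: "q \<in> poly_over (polyfun I)" "g = poly q (\<lambda>v. v $ i)" by blast
    have "p * q \<in> poly_over (polyfun I)"
      using p q is_subring_poly_over[OF is_subring_polyfun] by (auto simp: is_subring_def)
    moreover have "(\<lambda>v. f v * g v) = poly (p * q) (\<lambda>v. v $ i)"
      by (simp add: p q times_fun_def)
    ultimately show ?case by blast
  qed
next
  fix f assume "f \<in> (\<lambda>p. poly p (\<lambda>v. v $ i)) ` poly_over (polyfun I)"
  then obtain p where p: "p \<in> poly_over (polyfun I)" and f: "f = poly p (\<lambda>v. v $ i)" by blast
  have R: "is_subring (polyfun (insert i I))" by (rule is_subring_polyfun)
  have "(\<lambda>v. v $ i) ^ n \<in> polyfun (insert i I)" for n
  proof (induction n)
    case 0
    show ?case unfolding power_0 using R by (simp only: is_subring_def)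
  next
    case (Suc n)
    show ?case unfolding power_Suc
      using R Suc polyfun.coord[of i "insert i I"] by (simp only: is_subring_def) blast
  qed
  moreover have "coeff p n \<in> polyfun (insert i I)" for n
    using p polyfun_mono[of "coeff p n" I "insert i I"] by (auto simp: poly_over_def)
  ultimately have "coeff p n * (\<lambda>v. v $ i) ^ n \<in> polyfun (insert i I)" for n
    using R by (auto simp: is_subring_def)
  then show "f \<in> polyfun (insert i I)"
    unfolding f poly_altdef by (intro is_subring_sum R) auto
qed

lemma noetherian_polyfun: "finite I \<Longrightarrow> noetherian (polyfun I)"
proof (induction I rule: finite_induct)
  case empty
  have C: "f \<in> range (\<lambda>c _. c)" if "f \<in> polyfun {}" for f :: "complex ^ 'a \<Rightarrow> complex"
    using that by induction auto
  show ?case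
    unfolding noetherian_def
  proof (intro allI impI)
    fix J :: "(complex ^ 'a \<Rightarrow> complex) set" assume J: "J \<subseteq> polyfun {}"
    show "\<exists>G\<subseteq>J. finite G \<and> J \<subseteq> ideal_gen (polyfun {}) G"
    proof (cases "J \<subseteq> {0}")
      case True
      then show ?thesis by (intro exI[of _ "{}"]) (auto intro: ideal_gen.zero)
    next
      case False
      then obtain g where g: "g \<in> J" "g \<noteq> 0" by auto
      then obtain c where c: "g = (\<lambda>_. c)" using C J by blast
      then have c0: "c \<noteq> 0" using g(2) by (auto simp: zero_fun_def)
      have "f \<in> ideal_gen (polyfun {}) {g}" if fJ: "f \<in> J" for f
      proof -
        obtain d where d: "f = (\<lambda>_. d)" using C J fJ by blast
        have "(\<lambda>_. d / c) * g + 0 \<in> ideal_gen (polyfun {}) {g}"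
          by (intro ideal_gen.intros polyfun.const) auto
        moreover have "(\<lambda>_. d / c) * g + 0 = f" using c0 by (simp add: c d times_fun_def)
        ultimately show ?thesis by simp
      qed
      then show ?thesis using g(1) by (intro exI[of _ "{g}"]) auto
    qed
  qed
next
  case (insert i I)
  show ?case unfolding polyfun_insert
    by (intro noetherian_image hilbert_basis is_subring_polyfun insert.IH) auto
qed

text \<open>The first-order Taylor expansion at \<open>u\<close>, with polynomial coefficients. The value of \<open>g i\<close> at \<open>0\<close> is
  the partial derivative, and expanding \<open>g i\<close> once more gives the second-order expansion.\<close>

lemma polyfun_expansion:
  fixes f :: "complex ^ 'n::finite \<Rightarrow> complex"
  assumes "f \<in> polyfun UNIV"
  shows "\<exists>g. (\<forall>i. g i \<in> polyfun UNIV) \<and> (\<forall>y. f (u + y) = f u + (\<Sum>i\<in>UNIV. y $ i * g i y))"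
  using assms
proof induction
  case (const c)
  show ?case by (rule exI[of _ "\<lambda>_ _. 0"]) (auto intro: polyfun.const)
next
  case (coord i)
  show ?case
    by (rule exI[of _ "\<lambda>j _. if j = i then 1 else 0"])
       (auto intro: polyfun.const simp: if_distrib[of "\<lambda>t. _ * t"] cong: if_cong)
next
  case (add f f')
  then obtain g g' where g: "\<forall>i. g i \<in> polyfun UNIV" "\<forall>y. f (u + y) = f u + (\<Sum>i\<in>UNIV. y $ i * g i y)"
    and g': "\<forall>i. g' i \<in> polyfun UNIV" "\<forall>y. f' (u + y) = f' u + (\<Sum>i\<in>UNIV. y $ i * g' i y)" by blast
  show ?case
    by (rule exI[of _ "\<lambda>i y. g i y + g' i y"])
       (use g g' in \<open>auto intro: polyfun.intros simp: sum.distrib algebra_simps\<close>)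
next
  case (mult f f')
  then obtain g g' where g: "\<forall>i. g i \<in> polyfun UNIV" "\<forall>y. f (u + y) = f u + (\<Sum>i\<in>UNIV. y $ i * g i y)"
    and g': "\<forall>i. g' i \<in> polyfun UNIV" "\<forall>y. f' (u + y) = f' u + (\<Sum>i\<in>UNIV. y $ i * g' i y)" by blast
  define h where "h i y = f u * g' i y + g i y * (f' u + (\<Sum>j\<in>UNIV. y $ j * g' j y))" for i y
  have "f (u + y) * f' (u + y) = f u * f' u + (\<Sum>i\<in>UNIV. y $ i * h i y)" for y
  proof -
    have "(\<Sum>i\<in>UNIV. y $ i * h i y) = (\<Sum>i\<in>UNIV. f u * (y $ i * g' i y) + (y $ i * g i y) * f' (u + y))"
      unfolding h_def by (intro sum.cong refl) (simp add: g'(2)[rule_format, of y] algebra_simps)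
    also have "\<dots> = f u * (\<Sum>i\<in>UNIV. y $ i * g' i y) + (\<Sum>i\<in>UNIV. y $ i * g i y) * f' (u + y)"
      by (simp add: sum.distrib sum_distrib_left sum_distrib_right)
    also have "\<dots> = f u * (f' (u + y) - f' u) + (f (u + y) - f u) * f' (u + y)"
      using g(2) g'(2) by simp
    finally show ?thesis by (simp add: algebra_simps)
  qed
  moreover have "\<forall>i. h i \<in> polyfun UNIV"
    unfolding h_def using g g' by (auto intro!: polyfun.intros polyfun_sum)
  ultimately show ?case by (intro exI[of _ h]) blast
qed

lemma form_polyfun: "form d F \<Longrightarrow> F \<in> polyfun UNIV"
  unfolding form_def by (auto intro!: polyfun.intros polyfun_sum polyfun_prod polyfun_power)

lemma polyfun_continuous: "f \<in> polyfun I \<Longrightarrow> continuous_on UNIV f"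
  by (induction rule: polyfun.induct) (auto intro!: continuous_intros)

section \<open>Regular functions on projective varieties\<close>

lemma pspace_generator:
  assumes "l \<in> pspace"
  shows "\<exists>u. u \<noteq> 0 \<and> u \<in> l \<and> (\<forall>v\<in>l. \<exists>c. v = c *s u) \<and> (\<forall>c. c *s u \<in> l)"
proof -
  obtain u where u: "u \<noteq> 0" "l = range (\<lambda>c. c *s u)"
    using assms unfolding pspace_def by blast
  have "1 *s u \<in> l" unfolding u(2) by blast
  then show ?thesis using u by (intro exI[of _ u]) auto
qed

lemma pspace_nonzero_multiple:
  assumes "l \<in> pspace" "v \<in> l" "w \<in> l" "w \<noteq> 0"
  shows "\<exists>c. v = c *s w"
proof -
  obtain u where u: "\<forall>v\<in>l. \<exists>c. v = c *s u" using pspace_generator[OF assms(1)] by blast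
  obtain a b where a: "v = a *s u" "w = b *s u" using u assms by metis
  have "b \<noteq> 0" using a(2) assms(4) by auto
  then have "v = (a / b) *s w" unfolding a by (simp add: vector_smult_assoc)
  then show ?thesis by blast
qed

lemma form_add: "form d F \<Longrightarrow> form d G \<Longrightarrow> form d (\<lambda>v. F v + G v)"
  unfolding form_def
proof clarify
  fix a b :: "('a \<Rightarrow> nat) \<Rightarrow> complex"
  show "\<exists>c. (\<lambda>v :: complex ^ 'a. (\<Sum>m | (\<Sum>i\<in>UNIV. m i) = d. a m * (\<Prod>i\<in>UNIV. v $ i ^ m i)) +
           (\<Sum>m | (\<Sum>i\<in>UNIV. m i) = d. b m * (\<Prod>i\<in>UNIV. v $ i ^ m i))) =
      (\<lambda>v. \<Sum>m | (\<Sum>i\<in>UNIV. m i) = d. c m * (\<Prod>i\<in>UNIV. v $ i ^ m i))"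
    by (rule exI[of _ "\<lambda>m. a m + b m"]) (auto simp: sum.distrib distrib_right)
qed

lemma form_const: "form 0 (\<lambda>v :: complex ^ 'n::finite. c)"
  unfolding form_def
proof (intro exI [of _ "\<lambda>_. c"] ext)
  have "{m :: 'n \<Rightarrow> nat. (\<Sum>i\<in>UNIV. m i) = 0} = {\<lambda>_. 0}" by auto
  then show "c = (\<Sum>m | (\<Sum>i\<in>UNIV. m i) = 0. c * (\<Prod>i\<in>UNIV. (v $ i) ^ m i))" for v :: "complex ^ 'n"
    by simp
qed

lemma form_coord: "form 1 (\<lambda>v :: complex ^ 'n::finite. v $ q)"
  unfolding form_def
proof (intro exI ext)
  fix v :: "complex ^ 'n"
  define e :: "'n \<Rightarrow> nat" where "e = (\<lambda>i. if i = q then 1 else 0)"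
  have "e \<in> {m. (\<Sum>i\<in>UNIV. m i) = 1}" by (simp add: e_def)
  then have "(\<Sum>m | (\<Sum>i\<in>UNIV. m i) = 1. (if m = e then 1 else 0) * (\<Prod>i\<in>UNIV. v $ i ^ m i)) =
      (\<Prod>i\<in>UNIV. v $ i ^ e i)"
    using finite_exponents[where 'n='n and d=1]
    by (simp add: if_distrib[of "\<lambda>t. t * _"] cong: if_cong)
  also have "\<dots> = (\<Prod>i\<in>UNIV. if i = q then v $ i else 1)" by (intro prod.cong) (auto simp: e_def)
  finally show "v $ q = (\<Sum>m | (\<Sum>i\<in>UNIV. m i) = 1. (if m = e then 1 else 0) * (\<Prod>i\<in>UNIV. v $ i ^ m i))"
    by simp
qed

text \<open>Regularity of \<open>f\<close> at the point \<open>l\<close>: near \<open>l\<close>, \<open>f\<close> is a quotient of forms of equal degree.\<close>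

definition reg_at :: "'n::finite pt set \<Rightarrow> 'n pt \<Rightarrow> ('n pt \<Rightarrow> complex) \<Rightarrow> bool" where
  "reg_at X l f \<longleftrightarrow> (\<exists>d G H. form d G \<and> form d H \<and>
     (\<forall>\<^sub>F m in nhdsin (ztop X) l. \<forall>v\<in>m. v \<noteq> 0 \<longrightarrow> H v \<noteq> 0 \<and> f m = G v / H v))"

locale closed_variety =
  fixes X :: "'n::finite pt set"
  assumes closed_X: "closedin zariski X"
begin

lemma X_pspace: "X \<subseteq> pspace"
  using closed_X closedin_subset topspace_zariski by blast

lemma X_nonzero: "l \<in> X \<Longrightarrow> \<exists>u\<in>l. u \<noteq> 0"
  using X_pspace pspace_generator[of l] by blast

lemma topspace_X [simp]: "topspace zariski \<inter> X = X"
  using X_pspace by (auto simp: topspace_zariski)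

lemma in_topspace_X [simp]: "l \<in> X \<Longrightarrow> l \<in> topspace zariski"
  using X_pspace by (auto simp: topspace_zariski)

text \<open>The filter of Zariski neighbourhoods in \<open>X\<close>.\<close>

abbreviation near :: "'n pt \<Rightarrow> 'n pt filter" where
  "near l \<equiv> nhdsin (ztop X) l"

lemma eventually_near:
  "l \<in> X \<Longrightarrow> eventually P (near l) \<longleftrightarrow> (\<exists>V. openin (ztop X) V \<and> l \<in> V \<and> (\<forall>m\<in>V. P m))"
  by (simp add: eventually_nhdsin)

lemma eventually_near_open: "openin (ztop X) V \<Longrightarrow> l \<in> V \<Longrightarrow> eventually (\<lambda>m. m \<in> V) (near l)"
  by (auto simp: eventually_nhdsin)

lemma eventually_near_X: "eventually (\<lambda>m. m \<in> X) (near l)"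
  using eventually_near_open[of X l] openin_topspace[of "ztop X"] by (cases "l \<in> X") auto

lemma eventually_near_self: "l \<in> X \<Longrightarrow> eventually P (near l) \<Longrightarrow> P l"
  by (auto simp: eventually_nhdsin)

lemma eventually_eventually_near:
  assumes "eventually P (near l)"
  shows "eventually (\<lambda>m. eventually P (near m)) (near l)"
  using assms by (auto simp: eventually_nhdsin)

lemma openin_near: "openin (ztop X) U \<longleftrightarrow> U \<subseteq> X \<and> (\<forall>l\<in>U. eventually (\<lambda>m. m \<in> U) (near l))"
proof
  assume "openin (ztop X) U"
  then show "U \<subseteq> X \<and> (\<forall>l\<in>U. eventually (\<lambda>m. m \<in> U) (near l))"
    using eventually_near_open openin_subset by fastforce
next
  assume U: "U \<subseteq> X \<and> (\<forall>l\<in>U. eventually (\<lambda>m. m \<in> U) (near l))"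
  have "\<exists>V. openin (ztop X) V \<and> l \<in> V \<and> V \<subseteq> U" if "l \<in> U" for l
    using U that eventually_near[of l "\<lambda>m. m \<in> U"] by (meson subsetD subsetI)
  then show "openin (ztop X) U"
    by (subst openin_subopen) blast
qed

lemma regular_on_iff:
  assumes "openin (ztop X) U"
  shows "regular_on X U f \<longleftrightarrow> (\<forall>l\<in>U. reg_at X l f)"
proof -
  have UX: "U \<subseteq> X" using assms openin_subset by fastforce
  have "(\<exists>V d G H. openin (ztop X) V \<and> l \<in> V \<and> V \<subseteq> U \<and>
     form d G \<and> form d H \<and> (\<forall>m\<in>V. \<forall>v\<in>m. v \<noteq> 0 \<longrightarrow> H v \<noteq> 0 \<and> f m = G v / H v)) \<longleftrightarrow> reg_at X l f"
    (is "?L \<longleftrightarrow> ?R") if "l \<in> U" for l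
  proof
    assume ?L
    then obtain V d G H where "openin (ztop X) V" "l \<in> V" "form d G" "form d H"
      "\<forall>m\<in>V. \<forall>v\<in>m. v \<noteq> 0 \<longrightarrow> H v \<noteq> 0 \<and> f m = G v / H v" by blast
    then have "\<forall>\<^sub>F m in near l. \<forall>v\<in>m. v \<noteq> 0 \<longrightarrow> H v \<noteq> 0 \<and> f m = G v / H v"
      using that UX by (subst eventually_near) auto
    then show ?R unfolding reg_at_def using \<open>form d G\<close> \<open>form d H\<close> by blast
  next
    assume ?R
    then obtain d G H where GH: "form d G" "form d H"
      "\<forall>\<^sub>F m in near l. \<forall>v\<in>m. v \<noteq> 0 \<longrightarrow> H v \<noteq> 0 \<and> f m = G v / H v"
      unfolding reg_at_def by blast
    have "l \<in> X" using that UX by blast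
    then obtain V where V: "openin (ztop X) V" "l \<in> V"  "form d G" "form d H"
      "\<forall>m\<in>V. \<forall>v\<in>m. v \<noteq> 0 \<longrightarrow> H v \<noteq> 0 \<and> f m = G v / H v"
      using GH eventually_near by blast
    have "openin (ztop X) (V \<inter> U)" using V(1) assms by blast
    moreover have "l \<in> V \<inter> U" "V \<inter> U \<subseteq> U"
      "\<forall>m\<in>V \<inter> U. \<forall>v\<in>m. v \<noteq> 0 \<longrightarrow> H v \<noteq> 0 \<and> f m = G v / H v" using V that by auto
    ultimately show ?L using V(3,4) by blast
  qed
  then show ?thesis unfolding regular_on_def by (intro ball_cong refl)
qed

lemma reg_at_spread:
  assumes "reg_at X l f"
  shows "eventually (\<lambda>m. reg_at X m f) (near l)"
proof -
  obtain d G H where *: "form d G" "form d H"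
     "\<forall>\<^sub>F m in near l. \<forall>v\<in>m. v \<noteq> 0 \<longrightarrow> H v \<noteq> 0 \<and> f m = G v / H v"
    using assms unfolding reg_at_def by blast
  show ?thesis
    using eventually_eventually_near[OF *(3)] unfolding reg_at_def by eventually_elim (use * in blast)
qed

lemma reg_at_cong:
  assumes "reg_at X l f" "eventually (\<lambda>m. f m = g m) (near l)"
  shows "reg_at X l g"
proof -
  obtain d G H where *: "form d G" "form d H"
     "\<forall>\<^sub>F m in near l. \<forall>v\<in>m. v \<noteq> 0 \<longrightarrow> H v \<noteq> 0 \<and> f m = G v / H v"
    using assms(1) unfolding reg_at_def by blast
  have "\<forall>\<^sub>F m in near l. \<forall>v\<in>m. v \<noteq> 0 \<longrightarrow> H v \<noteq> 0 \<and> g m = G v / H v"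
    using *(3) assms(2) by eventually_elim simp
  with *(1,2) show ?thesis unfolding reg_at_def by blast
qed

lemma reg_at_const: "reg_at X l (\<lambda>_. c)"
  unfolding reg_at_def
  by (rule exI[of _ 0], rule exI[of _ "\<lambda>_. c"], rule exI[of _ "\<lambda>_. 1"]) (simp add: form_const)

lemma reg_at_add:
  assumes "reg_at X l f" "reg_at X l g"
  shows "reg_at X l (\<lambda>m. f m + g m)"
proof -
  obtain d G H where f: "form d G" "form d H"
     "\<forall>\<^sub>F m in near l. \<forall>v\<in>m. v \<noteq> 0 \<longrightarrow> H v \<noteq> 0 \<and> f m = G v / H v"
    using assms(1) unfolding reg_at_def by blast
  obtain e P Q where g: "form e P" "form e Q"
     "\<forall>\<^sub>F m in near l. \<forall>v\<in>m. v \<noteq> 0 \<longrightarrow> Q v \<noteq> 0 \<and> g m = P v / Q v"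
    using assms(2) unfolding reg_at_def by blast
  have "\<forall>\<^sub>F m in near l. \<forall>v\<in>m. v \<noteq> 0 \<longrightarrow> H v * Q v \<noteq> 0 \<and>
      f m + g m = (G v * Q v + H v * P v) / (H v * Q v)"
    using f(3) g(3) by eventually_elim (simp add: field_simps)
  moreover have "form (d + e) (\<lambda>v. G v * Q v + H v * P v)" "form (d + e) (\<lambda>v. H v * Q v)"
    using f g by (auto intro!: form_add form_mult)
  ultimately show ?thesis unfolding reg_at_def by blast
qed

lemma reg_at_mult:
  assumes "reg_at X l f" "reg_at X l g"
  shows "reg_at X l (\<lambda>m. f m * g m)"
proof -
  obtain d G H where f: "form d G" "form d H"
     "\<forall>\<^sub>F m in near l. \<forall>v\<in>m. v \<noteq> 0 \<longrightarrow> H v \<noteq> 0 \<and> f m = G v / H v"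
    using assms(1) unfolding reg_at_def by blast
  obtain e P Q where g: "form e P" "form e Q"
     "\<forall>\<^sub>F m in near l. \<forall>v\<in>m. v \<noteq> 0 \<longrightarrow> Q v \<noteq> 0 \<and> g m = P v / Q v"
    using assms(2) unfolding reg_at_def by blast
  have "\<forall>\<^sub>F m in near l. \<forall>v\<in>m. v \<noteq> 0 \<longrightarrow> H v * Q v \<noteq> 0 \<and>
      f m * g m = (G v * P v) / (H v * Q v)"
    using f(3) g(3) by eventually_elim (simp add: field_simps)
  moreover have "form (d + e) (\<lambda>v. G v * P v)" "form (d + e) (\<lambda>v. H v * Q v)"
    using f g by (auto intro!: form_mult)
  ultimately show ?thesis unfolding reg_at_def by blast
qed

lemma reg_at_uminus: "reg_at X l f \<Longrightarrow> reg_at X l (\<lambda>m. - f m)"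
  using reg_at_mult[OF reg_at_const, of l f "-1"] by simp

lemma reg_at_diff: "reg_at X l f \<Longrightarrow> reg_at X l g \<Longrightarrow> reg_at X l (\<lambda>m. f m - g m)"
  using reg_at_add[OF _ reg_at_uminus, of l f g] by simp

lemma reg_at_sum: "(\<And>a. a \<in> A \<Longrightarrow> reg_at X l (f a)) \<Longrightarrow> reg_at X l (\<lambda>m. \<Sum>a\<in>A. f a m)"
  by (induction A rule: infinite_finite_induct) (auto intro: reg_at_const reg_at_add)

lemma reg_at_prod: "(\<And>a. a \<in> A \<Longrightarrow> reg_at X l (f a)) \<Longrightarrow> reg_at X l (\<lambda>m. \<Prod>a\<in>A. f a m)"
  by (induction A rule: infinite_finite_induct) (auto intro: reg_at_const reg_at_mult)

lemma reg_at_power: "reg_at X l f \<Longrightarrow> reg_at X l (\<lambda>m. f m ^ k)"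
  by (induction k) (auto intro: reg_at_const reg_at_mult)

lemma reg_at_det:
  assumes "\<And>i j. reg_at X l (\<lambda>m. A m $ i $ j)"
  shows "reg_at X l (\<lambda>m. det (A m))"
  unfolding det_def by (intro reg_at_sum reg_at_mult reg_at_const reg_at_prod assms)

lemma form_nonzero_near:
  assumes "form d G" "l \<in> X" "v \<in> l" "v \<noteq> 0" "G v \<noteq> 0"
  shows "\<forall>\<^sub>F m in near l. \<forall>v\<in>m. v \<noteq> 0 \<longrightarrow> G v \<noteq> 0"
proof -
  let ?U = "{l \<in> pspace. \<exists>F\<in>{G}. \<exists>v\<in>l. F v \<noteq> 0}"
  have "zariski_open ?U" unfolding zariski_open_def using assms(1) by (intro exI[of _ "{G}"]) auto
  then have "openin (ztop X) (X \<inter> ?U)"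
    unfolding openin_subtopology openin_zariski by (intro exI[of _ ?U]) auto
  moreover have "l \<in> X \<inter> ?U" using assms X_pspace by auto
  ultimately have "\<forall>\<^sub>F m in near l. m \<in> X \<inter> ?U" by (rule eventually_near_open)
  then show ?thesis
  proof eventually_elim
    case (elim m)
    then obtain w where w: "w \<in> m" "G w \<noteq> 0" "m \<in> pspace" by auto
    show ?case
    proof (intro ballI impI)
      fix v assume v: "v \<in> m" "v \<noteq> 0"
      obtain c where "w = c *s v" using pspace_nonzero_multiple[OF w(3,1) v] by blast
      then show "G v \<noteq> 0" using w(2) form_scale[OF assms(1), of c v] by auto
    qed
  qed
qed

lemma reg_at_inverse:
  assumes "reg_at X l f" "l \<in> X" "f l \<noteq> 0"
  shows "reg_at X l (\<lambda>m. 1 / f m)" "\<forall>\<^sub>F m in near l. f m \<noteq> 0"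
proof -
  obtain d G H where f: "form d G" "form d H"
     and ev: "\<forall>\<^sub>F m in near l. \<forall>v\<in>m. v \<noteq> 0 \<longrightarrow> H v \<noteq> 0 \<and> f m = G v / H v"
    using assms(1) unfolding reg_at_def by blast
  obtain u where u: "u \<noteq> 0" "u \<in> l" using X_nonzero assms(2) by blast
  have "G u \<noteq> 0" using eventually_near_self[OF assms(2) ev] u assms(3) by auto
  from form_nonzero_near[OF f(1) assms(2) u(2,1) this]
  have G: "\<forall>\<^sub>F m in near l. \<forall>v\<in>m. v \<noteq> 0 \<longrightarrow> G v \<noteq> 0" .
  have "\<forall>\<^sub>F m in near l. \<forall>v\<in>m. v \<noteq> 0 \<longrightarrow> G v \<noteq> 0 \<and> 1 / f m = H v / G v"
    using ev G by eventually_elim auto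
  with f show "reg_at X l (\<lambda>m. 1 / f m)" unfolding reg_at_def by blast
  show "\<forall>\<^sub>F m in near l. f m \<noteq> 0"
    using ev G eventually_near_X
  proof eventually_elim
    case (elim m)
    then obtain u where "u \<noteq> 0" "u \<in> m" using X_nonzero by blast
    then show ?case using elim by auto
  qed
qed

lemma reg_at_divide:
  assumes "reg_at X l f" "reg_at X l g" "l \<in> X" "g l \<noteq> 0"
  shows "reg_at X l (\<lambda>m. f m / g m)"
  using reg_at_mult[OF assms(1) reg_at_inverse(1)[OF assms(2-4)]] by simp

section \<open>Affine charts\<close>

text \<open>The representative of the line \<open>m\<close> with coordinate \<open>q\<close> equal to \<open>1\<close>; it is meaningful on the chart
  where that coordinate does not vanish.\<close>

definition aff :: "'n \<Rightarrow> 'n pt \<Rightarrow> complex ^ 'n" where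
  "aff q m = (SOME v. v \<in> m \<and> v $ q = 1)"

lemma aff:
  assumes "m \<in> X" "v \<in> m" "v $ q \<noteq> 0"
  shows "aff q m \<in> m" "aff q m $ q = 1" "aff q m = (1 / v $ q) *s v"
proof -
  have mp: "m \<in> pspace" using assms(1) X_pspace by blast
  obtain u where u: "u \<noteq> 0" "u \<in> m" "\<forall>v\<in>m. \<exists>c. v = c *s u" "\<forall>c. c *s u \<in> m"
    using pspace_generator[OF mp] by blast
  obtain b where b: "v = b *s u" using u(3) assms(2) by blast
  have "(1 / v $ q) *s v \<in> m \<and> ((1 / v $ q) *s v) $ q = 1"
    using assms(3) u(4) by (auto simp: b vector_smult_assoc)
  then have "aff q m \<in> m \<and> aff q m $ q = 1"
    unfolding aff_def by (rule someI[of "\<lambda>v. v \<in> m \<and> v $ q = 1"])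
  then show *: "aff q m \<in> m" "aff q m $ q = 1" by auto
  have "v \<noteq> 0" using assms(3) by auto
  then obtain c where c: "aff q m = c *s v"
    using pspace_nonzero_multiple[OF mp *(1) assms(2)] by blast
  then have "c * v $ q = 1" using *(2) by simp
  then show "aff q m = (1 / v $ q) *s v" using assms(3) by (simp add: c field_simps)
qed

lemma aff_near:
  assumes "l \<in> X" "v \<in> l" "v $ q \<noteq> 0"
  shows "\<forall>\<^sub>F m in near l. m \<in> X \<and> (\<forall>v\<in>m. v \<noteq> 0 \<longrightarrow> v $ q \<noteq> 0) \<and>
    aff q m \<in> m \<and> aff q m $ q = 1"
proof -
  have "v \<noteq> 0" using assms(3) by auto
  from form_nonzero_near[OF form_coord assms(1,2) this assms(3)] eventually_near_X
  show ?thesis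
  proof eventually_elim
    case (elim m)
    then obtain u where u: "u \<noteq> 0" "u \<in> m" using X_nonzero by blast
    with elim have "u $ q \<noteq> 0" by blast
    then show ?case using aff[of m u q] elim u by blast
  qed
qed

lemma reg_at_polyfun:
  assumes l: "l \<in> X" "v \<in> l" "v $ q \<noteq> 0" and f: "f \<in> polyfun UNIV"
  shows "reg_at X l (\<lambda>m. f (aff q m))"
  using f
proof induction
  case (coord i)
  have "\<forall>\<^sub>F m in near l. \<forall>v\<in>m. v \<noteq> 0 \<longrightarrow> v $ q \<noteq> 0 \<and> aff q m $ i = v $ i / v $ q"
    using aff_near[OF l]
  proof eventually_elim
    case (elim m)
    show ?case
    proof (intro ballI impI conjI)
      fix v assume v: "v \<in> m" "v \<noteq> 0"
      then show q: "v $ q \<noteq> 0" using elim by blast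
      have "aff q m = (1 / v $ q) *s v" using aff(3)[of m v q] elim v(1) q by blast
      then show "aff q m $ i = v $ i / v $ q" by simp
    qed
  qed
  then show ?case unfolding reg_at_def using form_coord by blast
qed (auto intro: reg_at_const reg_at_add reg_at_mult)

text \<open>In a chart, germs of regular functions are fractions of polynomial functions.\<close>

lemma reg_at_fraction:
  assumes l: "l \<in> X" "v \<in> l" "v $ q \<noteq> 0" and f: "reg_at X l f"
  shows "\<exists>P\<in>polyfun UNIV. \<exists>Q\<in>polyfun UNIV. Q (aff q l) \<noteq> 0 \<and>
    (\<forall>\<^sub>F m in near l. Q (aff q m) \<noteq> 0 \<and> f m = P (aff q m) / Q (aff q m))"
proof -
  obtain d G H where f: "form d G" "form d H"
     and ev: "\<forall>\<^sub>F m in near l. \<forall>v\<in>m. v \<noteq> 0 \<longrightarrow> H v \<noteq> 0 \<and> f m = G v / H v"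
    using f unfolding reg_at_def by blast
  have *: "\<forall>\<^sub>F m in near l. H (aff q m) \<noteq> 0 \<and> f m = G (aff q m) / H (aff q m)"
    using ev aff_near[OF l]
  proof eventually_elim
    case (elim m)
    then have "aff q m \<noteq> 0" by (metis zero_index zero_neq_one)
    with elim show ?case by blast
  qed
  then have "H (aff q l) \<noteq> 0" using eventually_near_self[OF l(1)] by blast
  then show ?thesis using * form_polyfun[OF f(1)] form_polyfun[OF f(2)] by blast
qed

end

section \<open>The cotangent space at a smooth point of a curve\<close>

lemma separating_vector:
  fixes S :: "(complex ^ 'n::finite) set"
  assumes "vec.subspace S" "v \<notin> S"
  shows "\<exists>w. (\<Sum>i\<in>UNIV. v $ i * w $ i) \<noteq> 0 \<and> (\<forall>s\<in>S. (\<Sum>i\<in>UNIV. s $ i * w $ i) = 0)"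
proof -
  obtain B where B: "B \<subseteq> S" "vec.independent B" "S \<subseteq> vec.span B"
    by (rule vec.basis_exists[of S])
  have sB: "vec.span B = S" using B(3) vec.span_minimal[OF B(1) assms(1)] by (rule subset_antisym[rotated])
  have ind: "vec.independent (insert v B)" using B(2) assms(2) sB by (intro vec.independent_insertI) simp_all
  obtain h :: "complex ^ 'n \<Rightarrow> complex ^ 1" where h: "Vector_Spaces.linear (*s) (*s) h"
    "\<forall>x\<in>insert v B. h x = (if x = v then 1 else 0)"
  proof -
    have "\<exists>h :: complex ^ 'n \<Rightarrow> complex ^ 1. Vector_Spaces.linear (*s) (*s) h \<and>
        (\<forall>x\<in>insert v B. h x = (if x = v then 1 else 0))"
      by (rule vec.linear_independent_extend[OF ind])
    then show ?thesis using that by blast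
  qed
  interpret h: Vector_Spaces.linear "(*s)" "(*s)" h by (rule h(1))
  define w where "w = (\<chi> i. h (axis i 1) $ 1)"
  have hw: "h x $ 1 = (\<Sum>i\<in>UNIV. x $ i * w $ i)" for x
  proof -
    have "h x = h (\<Sum>i\<in>UNIV. x $ i *s axis i 1)" by (simp add: basis_expansion)
    also have "\<dots> = (\<Sum>i\<in>UNIV. x $ i *s h (axis i 1))" by (simp add: h.sum h.scale)
    finally show ?thesis by (simp add: w_def)
  qed
  have "h s = 0" if "s \<in> S" for s
  proof -
    have "v \<notin> B" using assms(2) B(1) by blast
    then have "\<forall>b\<in>B. h b = 0" using h(2) by auto
    moreover have "s \<in> vec.span B" using that sB by simp
    ultimately show ?thesis by (intro h.eq_0_on_span[of B s]) auto
  qed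
  moreover have "h v $ 1 \<noteq> 0" using h(2) by simp
  ultimately show ?thesis by (intro exI[of _ w]) (simp add: hw[symmetric])
qed

lemma polyfun_has_derivative_line:
  fixes f :: "complex ^ 'n::finite \<Rightarrow> complex"
  assumes "f \<in> polyfun UNIV"
    and g: "\<And>i. g i \<in> polyfun UNIV" "\<And>y. f (u + y) = f u + (\<Sum>i\<in>UNIV. y $ i * g i y)"
  shows "((\<lambda>z. f (u + z *s w)) has_field_derivative (\<Sum>i\<in>UNIV. w $ i * g i 0)) (at 0)"
proof -
  define h where "h z = (\<Sum>i\<in>UNIV. w $ i * g i (z *s w))" for z
  have "continuous_on UNIV h" unfolding h_def
  proof (intro continuous_intros)
    fix i
    have 1: "continuous_on UNIV (\<lambda>z. z *s w)"
      unfolding vector_scalar_mult_def by (intro continuous_on_vec_lambda continuous_intros)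
    show "continuous_on UNIV (\<lambda>z. g i (z *s w))"
      using continuous_on_compose2[OF polyfun_continuous[OF g(1)[of i]] 1] by auto
  qed
  then have "isCont h 0" by (simp add: continuous_on_eq_continuous_at)
  then have "h \<midarrow>0\<rightarrow> h 0" by (simp add: isCont_def)
  moreover have "(f (u + (0 + z) *s w) - f (u + 0 *s w)) / z = h z" if "z \<noteq> 0" for z
    using that by (simp add: g(2)[of "z *s w"] h_def mult.assoc sum_distrib_left[symmetric])
  ultimately have "(\<lambda>z. (f (u + (0 + z) *s w) - f (u + 0 *s w)) / z) \<midarrow>0\<rightarrow> h 0"
    using LIM_equal[of 0 "\<lambda>z. (f (u + (0 + z) *s w) - f (u + 0 *s w)) / z" h "h 0"] by blast
  then show ?thesis by (simp add: DERIV_def h_def)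
qed

locale smooth_curve = closed_variety X for X :: "'n::finite pt set" +
  assumes tangent_dim: "l \<in> X \<Longrightarrow> vec.dim (cone_tangent X l) = 2"
begin

lemma cone_tangent_contains_generator:
  assumes "l \<in> X" "u \<in> l"
  shows "u \<in> cone_tangent X l"
  unfolding cone_tangent_def
proof (clarsimp)
  fix d F v assume F: "form d F" "\<forall>m\<in>X. \<forall>v\<in>m. F v = 0" and v: "v \<in> l" "v \<noteq> 0"
  have lp: "l \<in> pspace" using assms(1) X_pspace by blast
  have "F (v + z *s u) = 0" for z
  proof -
    obtain a where a: "u = a *s v" using pspace_nonzero_multiple[OF lp assms(2) v] by blast
    have eq: "v + z *s u = (1 + z * a) *s v" by (simp add: a vec_eq_iff algebra_simps)
    have "F v = 0" using F(2) assms(1) v by blast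
    then show ?thesis by (simp only: eq form_scale[OF F(1)] mult_zero_right)
  qed
  then show "deriv (\<lambda>z. F (v + z *s u)) 0 = 0" by simp
qed

text \<open>Coefficients of the linear forms in the affine coordinates \<open>y\<close>, centred at the point \<open>u\<close> of the chart
  \<open>q\<close>, whose restriction to \<open>X\<close> is a quadratic expression in \<open>y\<close>: the forms that vanish in the
  cotangent space of \<open>X\<close>.\<close>

definition quadratic_on :: "'n \<Rightarrow> complex ^ 'n \<Rightarrow> (complex ^ 'n) set" where
  "quadratic_on q u = {a. \<exists>h. (\<forall>i k. h i k \<in> polyfun UNIV) \<and>
     (\<forall>m\<in>X. \<forall>y. u + y \<in> m \<and> (u + y) $ q = 1 \<longrightarrow>
        (\<Sum>i\<in>UNIV. a $ i * y $ i) = (\<Sum>i\<in>UNIV. \<Sum>k\<in>UNIV. y $ i * y $ k * h i k y))}"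

lemma subspace_quadratic_on: "vec.subspace (quadratic_on q u)"
  unfolding vec.subspace_def
proof (intro conjI ballI allI)
  show "0 \<in> quadratic_on q u"
    unfolding quadratic_on_def by (auto intro!: exI[of _ "\<lambda>_ _ _. 0"] polyfun.const)
  fix a assume "a \<in> quadratic_on q u"
  then obtain h where h: "\<forall>i k. h i k \<in> polyfun UNIV"
     "\<forall>m\<in>X. \<forall>y. u + y \<in> m \<and> (u + y) $ q = 1 \<longrightarrow>
        (\<Sum>i\<in>UNIV. a $ i * y $ i) = (\<Sum>i\<in>UNIV. \<Sum>k\<in>UNIV. y $ i * y $ k * h i k y)"
    unfolding quadratic_on_def by blast
  {
    fix b assume "b \<in> quadratic_on q u"
    then obtain h' where h': "\<forall>i k. h' i k \<in> polyfun UNIV"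
       "\<forall>m\<in>X. \<forall>y. u + y \<in> m \<and> (u + y) $ q = 1 \<longrightarrow>
          (\<Sum>i\<in>UNIV. b $ i * y $ i) = (\<Sum>i\<in>UNIV. \<Sum>k\<in>UNIV. y $ i * y $ k * h' i k y)"
      unfolding quadratic_on_def by blast
    show "a + b \<in> quadratic_on q u"
      unfolding quadratic_on_def
      by (intro CollectI exI[of _ "\<lambda>i k y. h i k y + h' i k y"])
         (use h h' in \<open>auto intro: polyfun.add simp: distrib_left distrib_right sum.distrib\<close>)
  }
  show "c *s a \<in> quadratic_on q u" for c
    unfolding quadratic_on_def
  proof (intro CollectI exI conjI allI ballI impI)
    show "(\<lambda>y. c * h i k y) \<in> polyfun UNIV" for i k
      using h(1) by (intro polyfun.mult polyfun.const) auto
    fix m y assume "m \<in> X" "u + y \<in> m \<and> (u + y) $ q = 1"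
    then have "(\<Sum>i\<in>UNIV. a $ i * y $ i) = (\<Sum>i\<in>UNIV. \<Sum>k\<in>UNIV. y $ i * y $ k * h i k y)"
      using h(2) by blast
    then have "c * (\<Sum>i\<in>UNIV. a $ i * y $ i) = c * (\<Sum>i\<in>UNIV. \<Sum>k\<in>UNIV. y $ i * y $ k * h i k y)"
      by simp
    then show "(\<Sum>i\<in>UNIV. (c *s a) $ i * y $ i) = (\<Sum>i\<in>UNIV. \<Sum>k\<in>UNIV. y $ i * y $ k * (c * h i k y))"
      by (simp add: sum_distrib_left mult_ac)
  qed
qed

text \<open>The gradient at \<open>u\<close> of a form that vanishes on \<open>X\<close> lies in \<open>quadratic_on q u\<close>, by the second-order
  expansion. Hence a vector annihilated by \<open>quadratic_on q u\<close> is tangent to the cone.\<close>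

lemma cone_tangent_if_annihilated:
  assumes l: "l \<in> X" "u \<in> l" "u $ q = 1"
    and w: "\<And>a. a \<in> quadratic_on q u \<Longrightarrow> (\<Sum>i\<in>UNIV. a $ i * w $ i) = 0"
  shows "w \<in> cone_tangent X l"
  unfolding cone_tangent_def
proof (clarsimp)
  fix d F v assume F: "form d F" "\<forall>m\<in>X. \<forall>v\<in>m. F v = 0" and v: "v \<in> l" "v \<noteq> 0"
  have lp: "l \<in> pspace" using l X_pspace by blast
  have u0: "u \<noteq> 0" using l(3) by auto
  obtain c where c: "v = c *s u" using pspace_nonzero_multiple[OF lp v(1) l(2) u0] by blast
  have c0: "c \<noteq> 0" using c v(2) by auto
  obtain g where g: "\<forall>i. g i \<in> polyfun UNIV" "\<forall>y. F (u + y) = F u + (\<Sum>i\<in>UNIV. y $ i * g i y)"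
    using polyfun_expansion[OF form_polyfun[OF F(1)]] by blast
  have "\<forall>i. \<exists>h. (\<forall>k. h k \<in> polyfun UNIV) \<and> (\<forall>y. g i (0 + y) = g i 0 + (\<Sum>k\<in>UNIV. y $ k * h k y))"
    using polyfun_expansion g(1) by blast
  then obtain h where h: "\<forall>i. (\<forall>k. h i k \<in> polyfun UNIV) \<and> (\<forall>y. g i (0 + y) = g i 0 + (\<Sum>k\<in>UNIV. y $ k * h i k y))"
    by metis
  have Fu: "F u = 0" using F(2) l by blast
  have "(\<chi> i. g i 0) \<in> quadratic_on q u"
    unfolding quadratic_on_def
  proof (intro CollectI exI conjI allI ballI impI)
    show "(\<lambda>y. (-1) * h i k y) \<in> polyfun UNIV" for i k
      using h by (intro polyfun.mult polyfun.const) auto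
    fix m y assume "m \<in> X" "u + y \<in> m \<and> (u + y) $ q = 1"
    then have "0 = F (u + y)" using F(2) by simp
    also have "\<dots> = (\<Sum>i\<in>UNIV. y $ i * (g i 0 + (\<Sum>k\<in>UNIV. y $ k * h i k y)))"
    proof -
      have "g i y = g i 0 + (\<Sum>k\<in>UNIV. y $ k * h i k y)" for i
        using h[rule_format, of i] by (metis add_0)
      then show ?thesis using g(2) Fu by simp
    qed
    also have "\<dots> = (\<Sum>i\<in>UNIV. g i 0 * y $ i) + (\<Sum>i\<in>UNIV. \<Sum>k\<in>UNIV. y $ i * y $ k * h i k y)"
      by (simp add: distrib_left sum.distrib sum_distrib_left mult_ac)
    finally show "(\<Sum>i\<in>UNIV. (\<chi> i. g i 0) $ i * y $ i) =
        (\<Sum>i\<in>UNIV. \<Sum>k\<in>UNIV. y $ i * y $ k * ((-1) * h i k y))"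
      by (simp add: sum_negf eq_neg_iff_add_eq_0)
  qed
  from w[OF this] have "(\<Sum>i\<in>UNIV. w $ i * g i 0) = 0" by (simp add: mult.commute)
  then have D: "((\<lambda>z. F (u + z *s w)) has_field_derivative 0) (at 0)"
    using polyfun_has_derivative_line[OF form_polyfun[OF F(1)], of g u w] g by simp
  (* The differentials at v = c u and at u are proportional, by homogeneity. *)
  have "((\<lambda>z. F (u + (z / c) *s w)) has_field_derivative 0 * (1 / c)) (at 0)"
    by (rule DERIV_chain2[where f = "\<lambda>z. F (u + z *s w)" and g = "\<lambda>z. z / c"])
       (use D c0 in \<open>auto intro!: derivative_eq_intros\<close>)
  then have "((\<lambda>z. c ^ d * F (u + (z / c) *s w)) has_field_derivative c ^ d * 0) (at 0)"
    by (intro DERIV_cmult) simp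
  moreover have "F (v + z *s w) = c ^ d * F (u + (z / c) *s w)" for z
  proof -
    have "v + z *s w = c *s (u + (z / c) *s w)"
      using c0 by (simp add: c vec_eq_iff field_simps)
    then show ?thesis by (simp only: form_scale[OF F(1)])
  qed
  ultimately show "deriv (\<lambda>z. F (v + z *s w)) 0 = 0"
    by (intro DERIV_imp_deriv) simp
qed

text \<open>As the tangent space of the cone is a plane containing \<open>u\<close>, all coordinates are on \<open>X\<close> multiples of
  one of them up to quadratic terms.\<close>

lemma cotangent_relations:
  assumes l: "l \<in> X" "u \<in> l" "u $ q = 1"
  shows "\<exists>s c h. (\<forall>j i k. h j i k \<in> polyfun UNIV) \<and>
    (\<forall>m\<in>X. \<forall>y. u + y \<in> m \<and> (u + y) $ q = 1 \<longrightarrow>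
       (\<forall>j. y $ j = c j * y $ s + (\<Sum>i\<in>UNIV. \<Sum>k\<in>UNIV. y $ i * y $ k * h j i k y)))"
proof -
  let ?T = "cone_tangent X l"
  have u0: "u \<noteq> 0" using l(3) by auto
  have uT: "u \<in> ?T" by (rule cone_tangent_contains_generator[OF l(1,2)])
  have uind: "vec.independent {u}" using u0 by (simp add: vec.independent_insert)
  have uT': "{u} \<subseteq> ?T" using uT by simp
  obtain B where B: "{u} \<subseteq> B" "B \<subseteq> ?T" "vec.independent B" "?T \<subseteq> vec.span B"
    by (rule vec.maximal_independent_subset_extend[OF uT' uind])
  have "card B = 2" using vec.basis_card_eq_dim[OF B(2,4,3)] tangent_dim[OF l(1)] by simp
  then obtain b where b: "B = {u, b}" using B(1) by (auto simp: card_2_iff)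
  (* w0 is the tangent direction in the chart. It is never zero, but the degenerate value is covered
     by the case distinction in c. *)
  define w0 where "w0 = b - (b $ q) *s u"
  obtain s where s: "w0 \<noteq> 0 \<Longrightarrow> w0 $ s \<noteq> 0" by (auto simp: vec_eq_iff)
  define c where "c j = (if w0 = 0 then 0 else w0 $ j / w0 $ s)" for j
  (* The linear form w j - u j w q - c j (w s - u s w q) vanishes at u and at w0. *)
  define a where "a j = axis j 1 - (u $ j) *s axis q 1 - c j *s (axis s 1 - (u $ s) *s axis q 1)" for j
  have a: "(\<Sum>i\<in>UNIV. a j $ i * w $ i) = w $ j - u $ j * w $ q - c j * (w $ s - u $ s * w $ q)" for j w
    by (simp add: a_def axis_def left_diff_distrib right_diff_distrib sum_subtractf mult.assoc sum_distrib_left[symmetric]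
      if_distrib[of "\<lambda>t. t * _"] if_distrib[of "\<lambda>t. _ * t"] cong: if_cong)
  have c0: "w0 $ j - c j * w0 $ s = 0" for j
    using s by (auto simp: c_def)
  have "a j \<in> quadratic_on q u" for j
  proof (rule ccontr)
    assume "a j \<notin> quadratic_on q u"
    then obtain w where w: "(\<Sum>i\<in>UNIV. a j $ i * w $ i) \<noteq> 0"
      "\<forall>t\<in>quadratic_on q u. (\<Sum>i\<in>UNIV. t $ i * w $ i) = 0"
      using separating_vector[OF subspace_quadratic_on] by blast
    have "w \<in> ?T" using cone_tangent_if_annihilated[OF l] w(2) by blast
    then have "w \<in> vec.span {u, b}" using B(4) b by blast
    then obtain x where "w - x *s u \<in> vec.span {b}" by (auto simp: vec.span_breakdown_eq[of w])
    then obtain y where y: "w - x *s u - y *s b = 0"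
      unfolding vec.span_breakdown_eq[of "w - x *s u" b "{}"] by auto
    have "w = x *s u + y *s b" using y by (simp add: algebra_simps)
    then have wx: "w = (x + y * b $ q) *s u + y *s w0"
      by (simp add: w0_def vec_eq_iff algebra_simps)
    have q0: "w0 $ q = 0" using l(3) by (simp add: w0_def)
    have "w $ j - u $ j * w $ q - c j * (w $ s - u $ s * w $ q) = y * (w0 $ j - c j * w0 $ s)"
      using l(3) by (simp add: wx q0 algebra_simps)
    then show False using w(1) c0 by (simp add: a)
  qed
  then have "\<forall>j. \<exists>h. (\<forall>i k. h i k \<in> polyfun UNIV) \<and>
     (\<forall>m\<in>X. \<forall>y. u + y \<in> m \<and> (u + y) $ q = 1 \<longrightarrow>
        (\<Sum>i\<in>UNIV. a j $ i * y $ i) = (\<Sum>i\<in>UNIV. \<Sum>k\<in>UNIV. y $ i * y $ k * h i k y))"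
    unfolding quadratic_on_def by blast
  from choice[OF this] obtain h where h: "\<forall>j. (\<forall>i k. h j i k \<in> polyfun UNIV) \<and>
     (\<forall>m\<in>X. \<forall>y. u + y \<in> m \<and> (u + y) $ q = 1 \<longrightarrow>
        (\<Sum>i\<in>UNIV. a j $ i * y $ i) = (\<Sum>i\<in>UNIV. \<Sum>k\<in>UNIV. y $ i * y $ k * h j i k y))"
    by blast
  show ?thesis
  proof (intro exI[of _ s] exI[of _ c] exI[of _ h] conjI allI ballI impI)
    show "h j i k \<in> polyfun UNIV" for j i k using h by blast
    fix m y j assume m: "m \<in> X" and y: "u + y \<in> m \<and> (u + y) $ q = 1"
    have "y $ q = 0" using y l(3) by simp
    moreover have "(\<Sum>i\<in>UNIV. a j $ i * y $ i) = (\<Sum>i\<in>UNIV. \<Sum>k\<in>UNIV. y $ i * y $ k * h j i k y)"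
      using h m y by blast
    ultimately have "y $ j - c j * y $ s = (\<Sum>i\<in>UNIV. \<Sum>k\<in>UNIV. y $ i * y $ k * h j i k y)"
      by (simp add: a)
    then show "y $ j = c j * y $ s + (\<Sum>i\<in>UNIV. \<Sum>k\<in>UNIV. y $ i * y $ k * h j i k y)"
      by (simp add: diff_eq_eq add.commute)
  qed
qed

end

section \<open>Local parameters and orders of vanishing\<close>

lemma polyfun_shift: "f \<in> polyfun UNIV \<Longrightarrow> (\<lambda>v. f (v - u)) \<in> polyfun UNIV"
proof (induction rule: polyfun.induct)
  case (coord i)
  have "(\<lambda>v. v $ i + (- (u $ i))) \<in> polyfun UNIV" by (intro polyfun.intros) auto
  then show ?case by simp
qed (auto intro: polyfun.intros)

lemma pspace_eq:
  assumes "l \<in> pspace" "m \<in> pspace" "u \<in> l" "u \<in> m" "u \<noteq> 0"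
  shows "l = m"
proof -
  have "l \<subseteq> m" if lm: "l \<in> pspace" "m \<in> pspace" "u \<in> l" "u \<in> m" for l m :: "'a pt"
  proof
    fix v assume "v \<in> l"
    then obtain c where c: "v = c *s u"
      using pspace_nonzero_multiple[OF lm(1) _ lm(3) assms(5)] by blast
    obtain u' where u': "\<forall>v\<in>m. \<exists>c. v = c *s u'" "\<forall>c. c *s u' \<in> m"
      using pspace_generator[OF lm(2)] by blast
    then obtain d where "u = d *s u'" using lm(4) by blast
    then have "v = (c * d) *s u'" using c by (simp add: vector_smult_assoc)
    then show "v \<in> m" using u'(2) by blast
  qed
  then show ?thesis using assms by blast
qed

lemma sum_delta_minus:
  fixes b :: "'n::finite \<Rightarrow> complex"
  shows "(\<Sum>k\<in>UNIV. ((if j = k then 1 else 0) - (\<Sum>i\<in>UNIV. b i * h i k)) * b k) =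
    b j - (\<Sum>i\<in>UNIV. \<Sum>k\<in>UNIV. b i * b k * h i k)"
proof -
  have "(\<Sum>k\<in>UNIV. ((if j = k then 1 else 0) - (\<Sum>i\<in>UNIV. b i * h i k)) * b k) =
      (\<Sum>k\<in>UNIV. (if j = k then b k else 0) - (\<Sum>i\<in>UNIV. b i * b k * h i k))"
  proof (rule sum.cong[OF refl])
    fix k
    have "(\<Sum>i\<in>UNIV. b i * h i k) * b k = (\<Sum>i\<in>UNIV. b i * b k * h i k)"
      unfolding sum_distrib_right by (rule sum.cong[OF refl]) (simp only: mult_ac)
    then show "((if j = k then 1 else 0) - (\<Sum>i\<in>UNIV. b i * h i k)) * b k =
        (if j = k then b k else 0) - (\<Sum>i\<in>UNIV. b i * b k * h i k)"
      by (simp add: left_diff_distrib)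
  qed
  also have "\<dots> = b j - (\<Sum>k\<in>UNIV. \<Sum>i\<in>UNIV. b i * b k * h i k)"
    by (simp add: sum_subtractf)
  also have "\<dots> = b j - (\<Sum>i\<in>UNIV. \<Sum>k\<in>UNIV. b i * b k * h i k)"
    by (subst sum.swap) (rule refl)
  finally show ?thesis .
qed

lemma sum_fun_apply: "(\<Sum>j\<in>A. f j) x = (\<Sum>j\<in>A. f j x)"
  by (induction A rule: infinite_finite_induct) auto

context smooth_curve
begin

text \<open>A generator \<open>t\<close> of the maximal ideal of the local ring at \<open>l\<close> that vanishes near \<open>l\<close> at most at \<open>l\<close>.\<close>

definition local_parameter :: "'n pt \<Rightarrow> ('n pt \<Rightarrow> complex) \<Rightarrow> bool" where
  "local_parameter l t \<longleftrightarrow> reg_at X l t \<and> t l = 0 \<and>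
     (\<forall>\<^sub>F m in near l. t m = 0 \<longrightarrow> m = l) \<and>
     (\<forall>f. reg_at X l f \<and> f l = 0 \<longrightarrow>
        (\<exists>g. reg_at X l g \<and> (\<forall>\<^sub>F m in near l. f m = t m * g m)))"

text \<open>The relations \<open>y\<^sub>j = c\<^sub>j t + \<Sum>\<^sub>k B\<^sub>j\<^sub>k y\<^sub>k\<close> with \<open>B\<close> vanishing at \<open>l\<close> say that \<open>A y = t c\<close> for the matrix
  \<open>A = 1 - B\<close>, which is invertible near \<open>l\<close>. Cramer's rule shows that the solution \<open>r\<close> of \<open>A r = c\<close> is
  regular, and \<open>y = t r\<close>. This is the step of Nakayama's lemma.\<close>

lemma local_parameter_exists:
  assumes l: "l \<in> X"
  shows "\<exists>t. local_parameter l t"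
proof -
  obtain v where v: "v \<in> l" "v \<noteq> 0" using X_nonzero[OF l] by blast
  then obtain q where q: "v $ q \<noteq> 0" by (auto simp: vec_eq_iff)
  define u where "u = aff q l"
  have u: "u \<in> l" "u $ q = 1" using aff[OF l v(1) q] by (auto simp: u_def)
  obtain s c h where h: "\<forall>j i k. h j i k \<in> polyfun UNIV" and
    rel: "\<forall>m\<in>X. \<forall>y. u + y \<in> m \<and> (u + y) $ q = 1 \<longrightarrow>
       (\<forall>j. y $ j = c j * y $ s + (\<Sum>i\<in>UNIV. \<Sum>k\<in>UNIV. y $ i * y $ k * h j i k y))"
    using cotangent_relations[OF l u] by blast
  define y where "y m = aff q m - u" for m
  have yl: "y l = 0" by (simp add: y_def u_def)
  have regf: "reg_at X l (\<lambda>m. f (aff q m))" if "f \<in> polyfun UNIV" for f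
    by (rule reg_at_polyfun[OF l v(1) q that])
  have regy: "reg_at X l (\<lambda>m. f (y m))" if "f \<in> polyfun UNIV" for f
    unfolding y_def by (rule regf) (rule polyfun_shift[OF that])
  have regyi: "reg_at X l (\<lambda>m. y m $ i)" for i
    by (rule regy[of "\<lambda>v. v $ i"]) (simp add: polyfun.coord)
  define t where "t m = y m $ s" for m
  have regt: "reg_at X l t" unfolding t_def by (rule regyi)
  define A where "A m = (\<chi> j k. (if j = k then 1 else 0) - (\<Sum>i\<in>UNIV. y m $ i * h j i k (y m)))" for m
  have regA: "reg_at X l (\<lambda>m. A m $ j $ k)" for j k
    unfolding A_def vec_lambda_beta
    by (intro reg_at_diff reg_at_const reg_at_sum reg_at_mult regyi regy h[rule_format])
  have Al: "A l = mat 1" by (simp add: A_def yl mat_def vec_eq_iff)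
  have regdA: "reg_at X l (\<lambda>m. det (A m))" by (intro reg_at_det regA)
  have dl: "det (A l) \<noteq> 0" by (simp add: Al)
  define r where "r m = (\<chi> k. det (\<chi> i j. if j = k then (\<chi> i. c i) $ i else A m $ i $ j) / det (A m))" for m
  have regr: "reg_at X l (\<lambda>m. r m $ k)" for k
  proof -
    have "reg_at X l (\<lambda>m. (\<chi> i j. if j = k then (\<chi> i. c i) $ i else A m $ i $ j) $ i $ j)" for i j
      using regA by (cases "j = k") (auto intro: reg_at_const)
    then have "reg_at X l (\<lambda>m. det (\<chi> i j. if j = k then (\<chi> i. c i) $ i else A m $ i $ j))"
      by (rule reg_at_det)
    then show ?thesis unfolding r_def using reg_at_divide[OF _ regdA l dl] by simp
  qed
  have near: "\<forall>\<^sub>F m in near l. m \<in> X \<and> aff q m \<in> m \<and> aff q m $ q = 1 \<and> y m = t m *s r m"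
    using aff_near[OF l v(1) q] reg_at_inverse(2)[OF regdA l dl]
  proof eventually_elim
    case (elim m)
    then have m: "m \<in> X" "u + y m \<in> m \<and> (u + y m) $ q = 1" by (auto simp: y_def)
    have "A m *v y m = t m *s (\<chi> i. c i)"
    proof (rule vec_eq_iff[THEN iffD2], rule allI)
      fix j
      have "(A m *v y m) $ j = (\<Sum>k\<in>UNIV. ((if j = k then 1 else 0) - (\<Sum>i\<in>UNIV. y m $ i * h j i k (y m))) * y m $ k)"
        by (simp add: matrix_vector_mult_def A_def)
      also have "\<dots> = y m $ j - (\<Sum>i\<in>UNIV. \<Sum>k\<in>UNIV. y m $ i * y m $ k * h j i k (y m))"
        by (rule sum_delta_minus)
      also have "\<dots> = c j * y m $ s"
        using rel[rule_format, OF m(1) m(2), of j] by (simp only: diff_eq_eq)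
      finally show "(A m *v y m) $ j = (t m *s (\<chi> i. c i)) $ j" by (simp add: t_def mult.commute)
    qed
    moreover have "A m *v r m = (\<chi> i. c i)"
      unfolding cramer[OF elim(2)] by (simp add: r_def)
    then have "A m *v (t m *s r m) = t m *s (\<chi> i. c i)" by (simp add: vector_scalar_commute)
    ultimately have "y m = t m *s r m" unfolding cramer[OF elim(2)] by simp
    then show ?case using elim by blast
  qed
  have "local_parameter l t"
    unfolding local_parameter_def
  proof (intro conjI allI impI regt)
    show "t l = 0" by (simp add: t_def yl)
    show "\<forall>\<^sub>F m in near l. t m = 0 \<longrightarrow> m = l"
      using near
    proof eventually_elim
      case (elim m)
      show ?case
      proof
        assume "t m = 0"
        then have "aff q m = u" using elim by (simp add: y_def)
        then have "u \<in> m" using elim by metis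
        moreover have "u \<noteq> 0" using u(2) by auto
        ultimately show "m = l" using pspace_eq[of m l u] elim l u X_pspace by blast
      qed
    qed
    fix f assume f: "reg_at X l f \<and> f l = 0"
    obtain P Q where P: "P \<in> polyfun UNIV" and Q: "Q \<in> polyfun UNIV" "Q (aff q l) \<noteq> 0" and
      PQ: "\<forall>\<^sub>F m in near l. Q (aff q m) \<noteq> 0 \<and> f m = P (aff q m) / Q (aff q m)"
      using reg_at_fraction[OF l v(1) q] f by blast
    have "f l = P u / Q u" using eventually_near_self[OF l PQ] by (simp add: u_def)
    then have Pu: "P u = 0" using f Q by (simp add: u_def)
    obtain g where g: "\<forall>i. g i \<in> polyfun UNIV" "\<forall>y. P (u + y) = P u + (\<Sum>i\<in>UNIV. y $ i * g i y)"
      using polyfun_expansion[OF P] by blast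
    define f' where "f' m = (\<Sum>i\<in>UNIV. r m $ i * g i (y m)) / Q (aff q m)" for m
    have "reg_at X l f'" unfolding f'_def
      by (intro reg_at_divide[OF _ _ l] reg_at_sum reg_at_mult regr regy regf g(1)[rule_format] Q)
    moreover have "\<forall>\<^sub>F m in near l. f m = t m * f' m"
      using near PQ
    proof eventually_elim
      case (elim m)
      have "P (aff q m) = P (u + y m)" by (simp add: y_def)
      also have "\<dots> = (\<Sum>i\<in>UNIV. (t m *s r m) $ i * g i (y m))"
        using g(2) Pu elim by simp
      also have "\<dots> = t m * (\<Sum>i\<in>UNIV. r m $ i * g i (y m))"
        by (simp add: sum_distrib_left mult.assoc)
      finally show ?case using elim by (simp add: f'_def)
    qed
    ultimately show "\<exists>g. reg_at X l g \<and> (\<forall>\<^sub>F m in near l. f m = t m * g m)" by blast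
  qed
  then show ?thesis by blast
qed

text \<open>A germ of infinite order vanishes, by Krull's argument. If \<open>f = t\<^sup>n F\<^sub>n\<close> with \<open>F\<^sub>n = t F\<^sub>n\<^sub>+\<^sub>1\<close> for all \<open>n\<close>, then the
  Noetherian property expresses some \<open>F\<^sub>K\<close> as a combination of the earlier \<open>F\<^sub>j = t\<^sup>K\<^sup>-\<^sup>j F\<^sub>K\<close>, so
  \<open>F\<^sub>K = t e F\<^sub>K\<close> with \<open>e\<close> regular, and \<open>1 - t e\<close> is a unit.\<close>

lemma finite_order:
  assumes l: "l \<in> X" and t: "local_parameter l t" and f: "reg_at X l f"
  shows "(\<forall>\<^sub>F m in near l. f m = 0) \<or>
    (\<exists>k g. reg_at X l g \<and> g l \<noteq> 0 \<and> (\<forall>\<^sub>F m in near l. f m = t m ^ k * g m))"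
proof (rule disjCI)
  define ord where "ord f \<longleftrightarrow> (\<exists>k g. reg_at X l g \<and> g l \<noteq> 0 \<and>
     (\<forall>\<^sub>F m in near l. f m = t m ^ k * g m))" for f
  assume "\<not> (\<exists>k g. reg_at X l g \<and> g l \<noteq> 0 \<and> (\<forall>\<^sub>F m in near l. f m = t m ^ k * g m))"
  then have nf: "\<not> ord f" by (simp add: ord_def)
  have step: "\<exists>f'. (reg_at X l f' \<and> \<not> ord f') \<and> (\<forall>\<^sub>F m in near l. f m = t m * f' m)"
    if f: "reg_at X l f \<and> \<not> ord f" for f
  proof -
    have "f l = 0"
    proof (rule ccontr)
      assume "f l \<noteq> 0"
      then have "ord f" unfolding ord_def using f by (intro exI[of _ 0] exI[of _ f]) simp
      then show False using f by simp
    qed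
    then obtain f' where f': "reg_at X l f'" "\<forall>\<^sub>F m in near l. f m = t m * f' m"
      using t f unfolding local_parameter_def by blast
    have "\<not> ord f'"
    proof
      assume "ord f'"
      then obtain k g where g: "reg_at X l g" "g l \<noteq> 0" "\<forall>\<^sub>F m in near l. f' m = t m ^ k * g m"
        unfolding ord_def by blast
      have "\<forall>\<^sub>F m in near l. f m = t m ^ Suc k * g m"
        using g(3) f'(2) by eventually_elim simp
      then have "ord f" unfolding ord_def using g by blast
      then show False using f by simp
    qed
    then show ?thesis using f' by blast
  qed
  have "\<exists>F. \<forall>n. (reg_at X l (F n) \<and> \<not> ord (F n) \<and> (n = 0 \<longrightarrow> F n = f)) \<and>
      (\<forall>\<^sub>F m in near l. F n m = t m * F (Suc n) m)"
  proof (rule dependent_nat_choice)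
    show "\<exists>x. reg_at X l x \<and> \<not> ord x \<and> (0 = (0::nat) \<longrightarrow> x = f)" using f nf by blast
    fix x and n :: nat assume "reg_at X l x \<and> \<not> ord x \<and> (n = 0 \<longrightarrow> x = f)"
    then show "\<exists>y. (reg_at X l y \<and> \<not> ord y \<and> (Suc n = 0 \<longrightarrow> y = f)) \<and>
        (\<forall>\<^sub>F m in near l. x m = t m * y m)"
      using step[of x] by blast
  qed
  then obtain F where F: "\<And>n. reg_at X l (F n)" "F 0 = f"
    "\<And>n. \<forall>\<^sub>F m in near l. F n m = t m * F (Suc n) m" by blast
  obtain v where v: "v \<in> l" "v \<noteq> 0" using X_nonzero[OF l] by blast
  then obtain q where q: "v $ q \<noteq> 0" by (auto simp: vec_eq_iff)
  have "\<forall>n. \<exists>P Q. P \<in> polyfun UNIV \<and> Q \<in> polyfun UNIV \<and> Q (aff q l) \<noteq> 0 \<and>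
    (\<forall>\<^sub>F m in near l. Q (aff q m) \<noteq> 0 \<and> F n m = P (aff q m) / Q (aff q m))"
    using reg_at_fraction[OF l v(1) q F(1)] by blast
  from choice[OF this] obtain P where "\<forall>n. \<exists>Q. P n \<in> polyfun UNIV \<and> Q \<in> polyfun UNIV \<and> Q (aff q l) \<noteq> 0 \<and>
    (\<forall>\<^sub>F m in near l. Q (aff q m) \<noteq> 0 \<and> F n m = P n (aff q m) / Q (aff q m))" ..
  from choice[OF this] obtain Q where PQ': "\<forall>n. P n \<in> polyfun UNIV \<and> Q n \<in> polyfun UNIV \<and> Q n (aff q l) \<noteq> 0 \<and>
    (\<forall>\<^sub>F m in near l. Q n (aff q m) \<noteq> 0 \<and> F n m = P n (aff q m) / Q n (aff q m))" ..
  have P: "P n \<in> polyfun UNIV" and Q: "Q n \<in> polyfun UNIV" "Q n (aff q l) \<noteq> 0" and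
    PQ: "\<forall>\<^sub>F m in near l. Q n (aff q m) \<noteq> 0 \<and> F n m = P n (aff q m) / Q n (aff q m)" for n
    using PQ'[rule_format, of n] by blast+
  obtain K c where c: "\<forall>j. c j \<in> polyfun UNIV" "P K = (\<Sum>j<K. c j * P j)"
    using noetherian_sequence[OF is_subring_polyfun noetherian_polyfun[OF finite], of P, OF P] by blast
  have PK: "P K x = (\<Sum>j<K. c j x * P j x)" for x
    using fun_cong[OF c(2), of x] by (simp add: sum_fun_apply)
  define e where "e m = (\<Sum>j<K. c j (aff q m) * Q j (aff q m) * t m ^ (K - Suc j)) / Q K (aff q m)" for m
  have regt: "reg_at X l t" and tl: "t l = 0" using t by (auto simp: local_parameter_def)
  (* F K = t e F K near l. *)
  have "reg_at X l e" unfolding e_def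
    using c(1) Q by (intro reg_at_divide[OF _ _ l] reg_at_sum reg_at_mult reg_at_power regt
        reg_at_polyfun[OF l v(1) q]) auto
  then have "reg_at X l (\<lambda>m. 1 - t m * e m)" by (intro reg_at_diff reg_at_const reg_at_mult regt)
  from reg_at_inverse(2)[OF this l] have unit: "\<forall>\<^sub>F m in near l. 1 - t m * e m \<noteq> 0"
    by (simp add: tl)
  have all1: "\<forall>\<^sub>F m in near l. \<forall>j\<in>{..K}. Q j (aff q m) \<noteq> 0 \<and> F j m = P j (aff q m) / Q j (aff q m)"
    using PQ by (intro eventually_ball_finite) auto
  have all2: "\<forall>\<^sub>F m in near l. \<forall>j\<in>{..<K}. F j m = t m * F (Suc j) m"
    using F(3) by (intro eventually_ball_finite) auto
  show "\<forall>\<^sub>F m in near l. f m = 0"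
    using all1 all2 unit
  proof eventually_elim
    case (elim m)
    have pow: "F (K - i) m = t m ^ i * F K m" if "i \<le> K" for i
      using that
    proof (induction i)
      case (Suc i)
      have "F (K - Suc i) m = t m * F (Suc (K - Suc i)) m" using elim(2) Suc.prems by simp
      also have "Suc (K - Suc i) = K - i" using Suc.prems by simp
      finally show ?case using Suc by simp
    qed simp
    have FP: "P j (aff q m) = Q j (aff q m) * F j m" if "j \<le> K" for j
      using elim(1) that by simp
    have "Q K (aff q m) * F K m = (\<Sum>j<K. c j (aff q m) * P j (aff q m))"
      using FP[of K] PK by simp
    also have "\<dots> = (\<Sum>j<K. (c j (aff q m) * Q j (aff q m) * t m ^ (K - Suc j)) * (t m * F K m))"
    proof (rule sum.cong[OF refl])
      fix j assume "j \<in> {..<K}"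
      then have j: "j < K" by simp
      have "F j m = t m ^ (K - j) * F K m" using pow[of "K - j"] j by simp
      also have "K - j = Suc (K - Suc j)" using j by simp
      finally show "c j (aff q m) * P j (aff q m) =
          (c j (aff q m) * Q j (aff q m) * t m ^ (K - Suc j)) * (t m * F K m)"
        using FP[of j] j by simp
    qed
    also have "\<dots> = (\<Sum>j<K. c j (aff q m) * Q j (aff q m) * t m ^ (K - Suc j)) * (t m * F K m)"
      by (rule sum_distrib_right[symmetric])
    also have "\<dots> = Q K (aff q m) * (e m * (t m * F K m))"
    proof -
      have "Q K (aff q m) \<noteq> 0" using elim(1) by blast
      then have "(\<Sum>j<K. c j (aff q m) * Q j (aff q m) * t m ^ (K - Suc j)) = Q K (aff q m) * e m"
        by (simp add: e_def)
      then show ?thesis by (simp only: mult.assoc)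
    qed
    finally have "Q K (aff q m) * F K m = Q K (aff q m) * (e m * (t m * F K m))" .
    moreover have "Q K (aff q m) \<noteq> 0" using elim(1) by blast
    ultimately have "F K m = e m * (t m * F K m)" by (rule mult_left_cancel[THEN iffD1, rotated])
    then have "(1 - t m * e m) * F K m = 0" by (simp add: algebra_simps)
    then have "F K m = 0" using elim(3) by simp
    then show "f m = 0" using pow[of K] F(2) by simp
  qed
qed

text \<open>In a finite family of germs, one of least order divides all the others.\<close>

lemma common_divisor:
  assumes l: "l \<in> X" and S: "finite S" and f: "\<And>i. i \<in> S \<Longrightarrow> reg_at X l (f i)"
    and i0: "i0 \<in> S" "\<not> (\<forall>\<^sub>F m in near l. f i0 m = 0)"
  shows "\<exists>a\<in>S. \<exists>c. (\<forall>i\<in>S. reg_at X l (c i)) \<and>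
     (\<forall>\<^sub>F m in near l. \<forall>i\<in>S. f i m = c i m * f a m) \<and>
     (\<forall>\<^sub>F m in near l. m \<noteq> l \<longrightarrow> f a m \<noteq> 0)"
proof -
  obtain t where t: "local_parameter l t" using local_parameter_exists[OF l] by blast
  have regt: "reg_at X l t" and t0: "\<forall>\<^sub>F m in near l. t m = 0 \<longrightarrow> m = l"
    using t by (auto simp: local_parameter_def)
  define S' where "S' = {i\<in>S. \<not> (\<forall>\<^sub>F m in near l. f i m = 0)}"
  have "\<forall>i\<in>S'. \<exists>k g. reg_at X l g \<and> g l \<noteq> 0 \<and> (\<forall>\<^sub>F m in near l. f i m = t m ^ k * g m)"
  proof
    fix i assume "i \<in> S'"
    then have i: "i \<in> S" "\<not> (\<forall>\<^sub>F m in near l. f i m = 0)" by (simp_all add: S'_def)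
    show "\<exists>k g. reg_at X l g \<and> g l \<noteq> 0 \<and> (\<forall>\<^sub>F m in near l. f i m = t m ^ k * g m)"
      using finite_order[OF l t f[OF i(1)]] i(2) by (elim disjE) simp_all
  qed
  from bchoice[OF this] obtain k where "\<forall>i\<in>S'. \<exists>g. reg_at X l g \<and> g l \<noteq> 0 \<and>
    (\<forall>\<^sub>F m in near l. f i m = t m ^ k i * g m)" ..
  from bchoice[OF this] obtain g where g': "\<forall>i\<in>S'. reg_at X l (g i) \<and> g i l \<noteq> 0 \<and>
    (\<forall>\<^sub>F m in near l. f i m = t m ^ k i * g i m)" ..
  have g: "reg_at X l (g i)" "g i l \<noteq> 0" "\<forall>\<^sub>F m in near l. f i m = t m ^ k i * g i m" if "i \<in> S'" for i
    using g'[rule_format, OF that] by blast+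
  have S'0: "i0 \<in> S'" using i0 by (simp add: S'_def)
  define a where "a = (ARG_MIN k i. i \<in> S')"
  have a: "a \<in> S'" unfolding a_def by (rule arg_min_natI[of "\<lambda>i. i \<in> S'", OF S'0])
  have amin: "k a \<le> k i" if "i \<in> S'" for i
    unfolding a_def by (rule arg_min_nat_le[of "\<lambda>i. i \<in> S'", OF that])
  define c where "c i m = (if i \<in> S' then t m ^ (k i - k a) * g i m / g a m else 0)" for i m
  have ga: "\<forall>\<^sub>F m in near l. g a m \<noteq> 0"
    by (rule reg_at_inverse(2)[OF g(1)[OF a] l g(2)[OF a]])
  have "reg_at X l (c i)" for i
  proof (cases "i \<in> S'")
    case True
    have "reg_at X l (\<lambda>m. t m ^ (k i - k a) * g i m / g a m)"
      by (intro reg_at_divide[OF _ _ l] reg_at_mult reg_at_power regt g(1,2) True a)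
    then show ?thesis using True by (simp add: c_def[abs_def])
  next
    case False
    then show ?thesis using reg_at_const[of l 0] by (simp add: c_def[abs_def])
  qed
  moreover have "\<forall>\<^sub>F m in near l. \<forall>i\<in>S. f i m = c i m * f a m"
  proof (rule eventually_ball_finite[OF S], rule ballI)
    fix i assume i: "i \<in> S"
    show "\<forall>\<^sub>F m in near l. f i m = c i m * f a m"
    proof (cases "i \<in> S'")
      case True
      show ?thesis using g(3)[OF True] g(3)[OF a] ga
      proof eventually_elim
        case (elim m)
        have "t m ^ k i = t m ^ (k i - k a) * t m ^ k a"
          using amin[OF True] by (simp flip: power_add)
        then show ?case using elim True by (simp add: c_def)
      qed
    next
      case False
      then have "\<forall>\<^sub>F m in near l. f i m = 0" using i by (simp add: S'_def)
      then show ?thesis by eventually_elim (simp add: c_def False)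
    qed
  qed
  moreover have "\<forall>\<^sub>F m in near l. m \<noteq> l \<longrightarrow> f a m \<noteq> 0"
    using g(3)[OF a] ga t0 by eventually_elim auto
  moreover have "a \<in> S" using a by (simp add: S'_def)
  ultimately show ?thesis by blast
qed

lemma nonzero_off_point:
  assumes l: "l \<in> X" and f: "reg_at X l f" and nz: "\<not> (\<forall>\<^sub>F m in near l. f m = 0)"
  shows "\<forall>\<^sub>F m in near l. m \<noteq> l \<longrightarrow> f m \<noteq> 0"
proof -
  obtain t where t: "local_parameter l t" using local_parameter_exists[OF l] by blast
  then have t0: "\<forall>\<^sub>F m in near l. t m = 0 \<longrightarrow> m = l"
    by (simp add: local_parameter_def)
  have "\<exists>k g. reg_at X l g \<and> g l \<noteq> 0 \<and> (\<forall>\<^sub>F m in near l. f m = t m ^ k * g m)"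
    by (rule disjE[OF finite_order[OF l t f] notE[OF nz]])
  then obtain k g where g: "reg_at X l g" "g l \<noteq> 0" "\<forall>\<^sub>F m in near l. f m = t m ^ k * g m"
    by blast
  show ?thesis
    using g(3) t0 reg_at_inverse(2)[OF g(1) l g(2)] by eventually_elim auto
qed

end

section \<open>Sections on a connected smooth curve\<close>

lemma vec1_eq_iff: "(x :: complex ^ 1) = y \<longleftrightarrow> x $ 1 = y $ 1"
  by (simp add: vec_eq_iff)

lemma matrix_vector_1: "((M :: complex ^ 1 ^ 1) *v x) $ 1 = M $ 1 $ 1 * x $ 1"
  by (simp add: matrix_vector_mult_def)

lemma H0_D:
  assumes "s \<in> H0 X E"
  shows "i \<in> indices E \<Longrightarrow> regular_on X (patch E i) (\<lambda>x. s i x $ a)"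
    and "\<lbrakk>i \<in> indices E; j \<in> indices E; x \<in> patch E i; x \<in> patch E j\<rbrakk> \<Longrightarrow> s i x = trans E i j x *v s j x"
    and "\<not> (i \<in> indices E \<and> x \<in> patch E i) \<Longrightarrow> s i x = 0"
  using assms unfolding H0_def by blast+

lemma vector_bundle_D:
  assumes "vector_bundle X E"
  shows "i \<in> indices E \<Longrightarrow> openin (ztop X) (patch E i)"
    and "(\<Union>i\<in>indices E. patch E i) = X"
    and "\<lbrakk>i \<in> indices E; j \<in> indices E\<rbrakk> \<Longrightarrow> regular_on X (patch E i \<inter> patch E j) (\<lambda>x. trans E i j x $ a $ b)"
    and "\<lbrakk>i \<in> indices E; x \<in> patch E i\<rbrakk> \<Longrightarrow> trans E i i x = mat 1"
    and "\<lbrakk>i \<in> indices E; j \<in> indices E; k \<in> indices E; x \<in> patch E i; x \<in> patch E j; x \<in> patch E k\<rbrakk> \<Longrightarrow>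
        trans E i j x ** trans E j k x = trans E i k x"
  using assms unfolding vector_bundle_def by blast+

context smooth_curve
begin

lemma section_reg_at:
  assumes "vector_bundle X E" "s \<in> H0 X E" "i \<in> indices E" "l \<in> patch E i"
  shows "reg_at X l (\<lambda>x. s i x $ a)"
  using H0_D(1)[OF assms(2,3), of a] regular_on_iff[OF vector_bundle_D(1)[OF assms(1,3)]] assms(4) by blast

text \<open>The points near which a section vanishes identically form an open set. So do the other points,
  since a germ that is not zero has no zeros near the point except possibly the point itself.\<close>

lemma nonzero_section_not_locally_zero:
  fixes L :: "('n, 'i, 1) vbundle"
  assumes conn: "connected_space (ztop X)" and L: "line_bundle X L" and w: "w \<in> H0 X L" "w \<noteq> 0"
    and l: "i \<in> indices L" "l \<in> patch L i"
  shows "\<not> (\<forall>\<^sub>F m in near l. w i m $ 1 = 0)"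
proof -
  define Z where "Z = {l \<in> X. \<forall>\<^sub>F m in near l. \<forall>i. w i m = 0}"
  have patchX: "patch L i \<subseteq> X" if "i \<in> indices L" for i
    using vector_bundle_D(2)[OF L] that by blast
  have inZ: "l \<in> Z" if i: "i \<in> indices L" "l \<in> patch L i" and z: "\<forall>\<^sub>F m in near l. w i m $ 1 = 0" for i l
  proof -
    have "\<forall>\<^sub>F m in near l. \<forall>j. w j m = 0"
      using z eventually_near_open[OF vector_bundle_D(1)[OF L i(1)] i(2)]
    proof eventually_elim
      case (elim m)
      then have 0: "w i m = 0" by (simp add: vec1_eq_iff)
      show ?case
      proof
        fix j
        show "w j m = 0"
        proof (cases "j \<in> indices L \<and> m \<in> patch L j")
          case True
          then show ?thesis using H0_D(2)[OF w(1), of j i m] i elim 0 by simp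
        next
          case False
          then show ?thesis by (rule H0_D(3)[OF w(1)])
        qed
      qed
    qed
    then show ?thesis using i patchX by (auto simp: Z_def)
  qed
  have "openin (ztop X) Z"
    unfolding openin_near
  proof (intro conjI ballI)
    show "Z \<subseteq> X" by (auto simp: Z_def)
    fix l assume "l \<in> Z"
    then have "\<forall>\<^sub>F m in near l. \<forall>i. w i m = 0" by (simp add: Z_def)
    from eventually_eventually_near[OF this] eventually_near_X
    show "\<forall>\<^sub>F m in near l. m \<in> Z" by eventually_elim (simp add: Z_def)
  qed
  moreover have "openin (ztop X) (X - Z)"
    unfolding openin_near
  proof (intro conjI ballI)
    show "X - Z \<subseteq> X" by auto
    fix l assume l: "l \<in> X - Z"
    then obtain i where i: "i \<in> indices L" "l \<in> patch L i" using vector_bundle_D(2)[OF L] by blast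
    have "\<forall>\<^sub>F m in near l. m \<noteq> l \<longrightarrow> w i m $ 1 \<noteq> 0"
    proof (rule nonzero_off_point)
      show "l \<in> X" using l by blast
      show "reg_at X l (\<lambda>m. w i m $ 1)" by (rule section_reg_at[OF L w(1) i])
      show "\<not> (\<forall>\<^sub>F m in near l. w i m $ 1 = 0)" using inZ[OF i] l by blast
    qed
    then show "\<forall>\<^sub>F m in near l. m \<in> X - Z"
      using eventually_near_X
    proof eventually_elim
      case (elim m)
      show ?case
      proof (cases "m = l")
        case True
        then show ?thesis using l by simp
      next
        case False
        have "m \<notin> Z"
        proof
          assume "m \<in> Z"
          then have "\<forall>i. w i m = 0" using eventually_near_self[of m] by (auto simp: Z_def)
          then show False using elim False by simp
        qed
        then show ?thesis using elim by simp
      qed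
    qed
  qed
  then have "closedin (ztop X) Z" by (auto simp: closedin_def Z_def)
  ultimately have "Z = {} \<or> Z = topspace (ztop X)"
    using conn unfolding connected_space_clopen_in by blast
  then have Zor: "Z = {} \<or> Z = X" by simp
  moreover have "Z \<noteq> X"
  proof
    assume ZX: "Z = X"
    have "w j m = 0" for j m
    proof (cases "j \<in> indices L \<and> m \<in> patch L j")
      case True
      then have "m \<in> Z" using patchX ZX by blast
      then show ?thesis using eventually_near_self[of m] by (auto simp: Z_def)
    next
      case False
      then show ?thesis by (rule H0_D(3)[OF w(1)])
    qed
    then have "w = 0" by (simp add: fun_eq_iff)
    then show False using w(2) by blast
  qed
  ultimately have "Z = {}" by blast
  then show ?thesis using inZ[OF l] by blast
qed

section \<open>The bundle of rank two defined by a skew matrix of rank two\<close>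

text \<open>On the neighbourhood \<open>V\<close> of \<open>l\<close>, in the trivialisation \<open>\<iota>\<close> of \<open>L\<close>, the entry \<open>A a b\<close> divides the row of
  index \<open>a\<close>, with quotients \<open>c\<close>; all entries vanish where it does, and that is at most at \<open>l\<close>.\<close>

definition decomposes_near ::
  "('n, 'i, 1) vbundle \<Rightarrow> 'k set \<Rightarrow> ('k \<Rightarrow> 'k \<Rightarrow> ('n, 'i, 1) sect) \<Rightarrow> 'n pt \<Rightarrow>
     'i \<times> 'k \<times> 'k \<times> ('k \<Rightarrow> 'n pt \<Rightarrow> complex) \<times> 'n pt set \<Rightarrow> bool" where
  "decomposes_near L I A l = (\<lambda>(\<iota>, a, b, c, V).
     \<iota> \<in> indices L \<and> a \<in> I \<and> b \<in> I \<and> openin (ztop X) V \<and> l \<in> V \<and> V \<subseteq> patch L \<iota> \<and>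
     (\<forall>j\<in>I. \<forall>x\<in>V. reg_at X x (c j)) \<and>
     (\<forall>j\<in>I. \<forall>x\<in>V. A a j \<iota> x $ 1 = c j x * A a b \<iota> x $ 1) \<and>
     (\<forall>j\<in>I. \<forall>k\<in>I. \<forall>x\<in>V. A a b \<iota> x $ 1 = 0 \<longrightarrow> A j k \<iota> x $ 1 = 0) \<and>
     (\<forall>x\<in>V. x \<noteq> l \<longrightarrow> A a b \<iota> x $ 1 \<noteq> 0))"

lemma decomposes_near_exists:
  fixes L :: "('n, 'i, 1) vbundle"
  assumes conn: "connected_space (ztop X)" and L: "line_bundle X L" and I: "finite I"
    and A: "\<And>j k. j \<in> I \<Longrightarrow> k \<in> I \<Longrightarrow> A j k \<in> H0 X L"
    and nz: "j0 \<in> I" "k0 \<in> I" "A j0 k0 \<noteq> 0" and l: "l \<in> X"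
  shows "\<exists>t. decomposes_near L I A l t"
proof -
  obtain \<iota> where \<iota>: "\<iota> \<in> indices L" "l \<in> patch L \<iota>" using l vector_bundle_D(2)[OF L] by blast
  define f where "f q x = A (fst q) (snd q) \<iota> x $ 1" for q x
  have "\<exists>q\<in>I \<times> I. \<exists>c. (\<forall>i\<in>I \<times> I. reg_at X l (c i)) \<and>
     (\<forall>\<^sub>F m in near l. \<forall>i\<in>I \<times> I. f i m = c i m * f q m) \<and>
     (\<forall>\<^sub>F m in near l. m \<noteq> l \<longrightarrow> f q m \<noteq> 0)"
  proof (rule common_divisor[OF l])
    show "finite (I \<times> I)" using I by simp
    show "reg_at X l (f q)" if "q \<in> I \<times> I" for q
      unfolding f_def using that by (intro section_reg_at[OF L A \<iota>]) auto
    show "(j0, k0) \<in> I \<times> I" using nz by simp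
    show "\<not> (\<forall>\<^sub>F m in near l. f (j0, k0) m = 0)"
      using nonzero_section_not_locally_zero[OF conn L A[OF nz(1,2)] nz(3) \<iota>] by (simp add: f_def)
  qed
  then obtain a b c where ab: "a \<in> I" "b \<in> I" and c: "\<forall>i\<in>I \<times> I. reg_at X l (c i)"
    and ev1: "\<forall>\<^sub>F m in near l. \<forall>i\<in>I \<times> I. f i m = c i m * f (a, b) m"
    and ev2: "\<forall>\<^sub>F m in near l. m \<noteq> l \<longrightarrow> f (a, b) m \<noteq> 0"
    by auto
  have ev3: "\<forall>\<^sub>F m in near l. \<forall>i\<in>I \<times> I. reg_at X m (c i)"
    using c I reg_at_spread by (intro eventually_ball_finite) auto
  have ev4: "\<forall>\<^sub>F m in near l. m \<in> patch L \<iota>"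
    by (rule eventually_near_open[OF vector_bundle_D(1)[OF L \<iota>(1)] \<iota>(2)])
  have "\<forall>\<^sub>F m in near l. (\<forall>i\<in>I \<times> I. f i m = c i m * f (a, b) m) \<and> (m \<noteq> l \<longrightarrow> f (a, b) m \<noteq> 0) \<and>
      (\<forall>i\<in>I \<times> I. reg_at X m (c i)) \<and> m \<in> patch L \<iota>"
    using ev1 ev2 ev3 ev4 by eventually_elim blast
  then obtain V where V: "openin (ztop X) V" "l \<in> V"
    and Vall: "\<forall>m\<in>V. (\<forall>i\<in>I \<times> I. f i m = c i m * f (a, b) m) \<and> (m \<noteq> l \<longrightarrow> f (a, b) m \<noteq> 0) \<and>
      (\<forall>i\<in>I \<times> I. reg_at X m (c i)) \<and> m \<in> patch L \<iota>"
    unfolding eventually_near[OF l] by (elim exE conjE)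
  have Vf: "f i m = c i m * f (a, b) m" if "m \<in> V" "i \<in> I \<times> I" for m i
    using bspec[OF Vall that(1)] that(2) by (elim conjE) (rule bspec)
  have Vc: "reg_at X m (c i)" if "m \<in> V" "i \<in> I \<times> I" for m i
    using bspec[OF Vall that(1)] that(2) by blast
  have Vnz: "m \<noteq> l \<longrightarrow> f (a, b) m \<noteq> 0" and Vp: "m \<in> patch L \<iota>" if "m \<in> V" for m
    using bspec[OF Vall that] by blast+
  have "decomposes_near L I A l (\<iota>, a, b, \<lambda>j. c (a, j), V)"
    unfolding decomposes_near_def prod.case
  proof (intro conjI ballI impI \<iota>(1) ab V)
    show "V \<subseteq> patch L \<iota>" using Vp by blast
    fix j x assume j: "j \<in> I" and x: "x \<in> V"
    show "reg_at X x (c (a, j))" using Vc[OF x] ab j by blast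
    show "A a j \<iota> x $ 1 = c (a, j) x * A a b \<iota> x $ 1" using Vf[OF x, of "(a, j)"] ab j by (simp add: f_def)
    fix k assume k: "k \<in> I" "A a b \<iota> x $ 1 = 0"
    then show "A j k \<iota> x $ 1 = 0" using Vf[OF x, of "(j, k)"] j by (simp add: f_def)
  next
    fix x assume "x \<in> V" "x \<noteq> l"
    then show "A a b \<iota> x $ 1 \<noteq> 0" using Vnz[of x] by (simp add: f_def)
  qed
  then show ?thesis by blast
qed

text \<open>The hypotheses say that the skew matrix \<open>A\<close> of sections of \<open>L\<close> has rank two. Near a point \<open>l\<close>, with
  \<open>A a b\<close> dividing the other entries, \<open>A j k\<close> is the determinant of the columns \<open>j\<close> and \<open>k\<close> of the matrix
  \<open>M l\<close> with rows \<open>A a j / A a b\<close> and \<open>A b j\<close>. The patches of \<open>E\<close> are indexed by points in such a way that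
  \<open>A\<close> has no zero on the intersection of two different patches; there both matrices have rank two and
  proportional minors, so that \<open>M l = T l m M m\<close> for a unique matrix \<open>T l m\<close>. These are the transition
  matrices, and the columns of the \<open>M l\<close> are the sections.\<close>

lemma bundle_of_skew_matrix:
  fixes L :: "('n, 'i, 1) vbundle" and A :: "'k \<Rightarrow> 'k \<Rightarrow> ('n, 'i, 1) sect"
  assumes conn: "connected_space (ztop X)" and L: "line_bundle X L" and I: "finite I"
    and A: "\<And>j k. j \<in> I \<Longrightarrow> k \<in> I \<Longrightarrow> A j k \<in> H0 X L"
    and nz: "j0 \<in> I" "k0 \<in> I" "A j0 k0 \<noteq> 0"
    and skew: "\<And>j k i x. j \<in> I \<Longrightarrow> k \<in> I \<Longrightarrow> A k j i x $ 1 = - (A j k i x $ 1)"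
    and pluecker: "\<And>a b j k i x. a \<in> I \<Longrightarrow> b \<in> I \<Longrightarrow> j \<in> I \<Longrightarrow> k \<in> I \<Longrightarrow>
       A a b i x $ 1 * A j k i x $ 1 = A a j i x $ 1 * A b k i x $ 1 - A a k i x $ 1 * A b j i x $ 1"
  shows "\<exists>(E :: ('n, 'n pt, 2) vbundle) \<phi> s. vector_bundle X E \<and> bundle_iso X (det_bundle E) L \<phi> \<and>
     (\<forall>j\<in>I. s j \<in> H0 X E) \<and> (\<forall>j\<in>I. \<forall>k\<in>I. det_map E L \<phi> (s j) (s k) = A j k)"
proof -
  have "\<forall>l\<in>X. \<exists>t. decomposes_near L I A l t"
    using decomposes_near_exists[where A = A, OF conn L I A nz] by blast
  from bchoice[OF this] obtain d where d: "\<forall>l\<in>X. decomposes_near L I A l (d l)" ..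
  define \<iota> where "\<iota> l = fst (d l)" for l
  define a where "a l = fst (snd (d l))" for l
  define b where "b l = fst (snd (snd (d l)))" for l
  define c where "c l = fst (snd (snd (snd (d l))))" for l
  define V where "V l = snd (snd (snd (snd (d l))))" for l
  have dl: "d l = (\<iota> l, a l, b l, c l, V l)" for l by (simp add: \<iota>_def a_def b_def c_def V_def)
  have D: "decomposes_near L I A l (\<iota> l, a l, b l, c l, V l)" if "l \<in> X" for l
    using bspec[OF d that] unfolding dl .
  note D' = D[unfolded decomposes_near_def prod.case]
  have \<iota>: "\<iota> l \<in> indices L" and ab: "a l \<in> I" "b l \<in> I" and V: "openin (ztop X) (V l)" "l \<in> V l" "V l \<subseteq> patch L (\<iota> l)"
    if "l \<in> X" for l
    using D'[OF that] by blast+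
  define F where "F l j k x = A j k (\<iota> l) x $ 1" for l j k x
  have regc: "reg_at X x (c l j)" if "l \<in> X" "x \<in> V l" "j \<in> I" for l x j
    using D'[OF that(1)] that by blast
  have cF: "F l (a l) j x = c l j x * F l (a l) (b l) x" if "l \<in> X" "x \<in> V l" "j \<in> I" for l x j
    using D'[OF that(1)] that unfolding F_def by blast
  have F0: "F l j k x = 0" if "l \<in> X" "x \<in> V l" "j \<in> I" "k \<in> I" "F l (a l) (b l) x = 0" for l x j k
    using D'[OF that(1)] that unfolding F_def by blast
  have Fnz: "F l (a l) (b l) x \<noteq> 0" if "l \<in> X" "x \<in> V l" "x \<noteq> l" for l x
    using D'[OF that(1)] that unfolding F_def by blast
  have VX: "V l \<subseteq> X" if "l \<in> X" for l using V(1)[OF that] openin_subset by fastforce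
  have regF: "reg_at X x (F l j k)" if "l \<in> X" "x \<in> V l" "j \<in> I" "k \<in> I" for l x j k
    unfolding F_def using V(3)[OF that(1)] that by (intro section_reg_at[OF L A \<iota>]) auto
  have Fskew: "F l k j x = - F l j k x" if "j \<in> I" "k \<in> I" for l j k x
    unfolding F_def by (rule skew[OF that])
  have Fpl: "F l a b x * F l j k x = F l a j x * F l b k x - F l a k x * F l b j x"
    if "a \<in> I" "b \<in> I" "j \<in> I" "k \<in> I" for l a b j k x
    unfolding F_def by (rule pluecker[OF that])
  have Fself: "F l j j x = 0" if "j \<in> I" for l j x
    using Fskew[OF that that, of l x] by simp
  define g where "g l m x = trans L (\<iota> l) (\<iota> m) x $ 1 $ 1" for l m x
  have Fg: "F l j k x = g l m x * F m j k x" if "l \<in> X" "m \<in> X" "x \<in> V l" "x \<in> V m" "j \<in> I" "k \<in> I" for l m j k x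
  proof -
    have "A j k (\<iota> l) x = trans L (\<iota> l) (\<iota> m) x *v A j k (\<iota> m) x"
      by (rule H0_D(2)[OF A[OF that(5,6)]]) (use that \<iota> V(3) in auto)
    then show ?thesis by (simp add: F_def g_def matrix_vector_1)
  qed
  define M :: "'n pt \<Rightarrow> 'n pt \<Rightarrow> 'k \<Rightarrow> complex ^ 2" where "M l x j = vector [c l j x, F l (b l) j x]" for l x j
  have M1: "M l x j $ 1 = c l j x" and M2: "M l x j $ 2 = F l (b l) j x" for l x j
    by (simp_all add: M_def)
  have Mdet: "M l x j $ 1 * M l x k $ 2 - M l x k $ 1 * M l x j $ 2 = F l j k x"
    if l: "l \<in> X" "x \<in> V l" and jk: "j \<in> I" "k \<in> I" for l x j k
  (* The only possible zero of A on V l is l, where both sides vanish. *)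
  proof (cases "F l (a l) (b l) x = 0")
    case True
    then show ?thesis unfolding M2 using F0[OF l _ _ True] ab[OF l(1)] jk by simp
  next
    case False
    have "F l (a l) (b l) x * (c l j x * F l (b l) k x - c l k x * F l (b l) j x) =
        (c l j x * F l (a l) (b l) x) * F l (b l) k x - (c l k x * F l (a l) (b l) x) * F l (b l) j x"
      by (simp add: algebra_simps)
    also have "\<dots> = F l (a l) (b l) x * F l j k x"
      using cF[OF l jk(1)] cF[OF l jk(2)] Fpl[OF ab[OF l(1)] jk] by simp
    finally show ?thesis unfolding M1 M2 using False by simp
  qed
  have Ma: "M l x (a l) = vector [0, - F l (a l) (b l) x]" and Mb: "M l x (b l) = vector [1, 0]"
    if l: "l \<in> X" "x \<in> V l" and nz: "F l (a l) (b l) x \<noteq> 0" for l x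
  proof -
    have "c l (a l) x = 0" using cF[OF l ab(1)[OF l(1)]] Fself[OF ab(1)[OF l(1)]] nz by simp
    then show "M l x (a l) = vector [0, - F l (a l) (b l) x]"
      unfolding M_def using Fskew[OF ab[OF l(1)]] by simp
    have "c l (b l) x = 1" using cF[OF l ab(2)[OF l(1)]] nz by simp
    then show "M l x (b l) = vector [1, 0]"
      unfolding M_def using Fself[OF ab(2)[OF l(1)]] by simp
  qed
  (* Away from the zeros of A, the columns b m and a m of M m are (1, 0) and (0, - A a b); this determines T l m from
     M l = T l m M m. At zeros of A the quotient would be meaningless, whence the case l = m. *)
  define T :: "'n pt \<Rightarrow> 'n pt \<Rightarrow> 'n pt \<Rightarrow> complex ^ 2 ^ 2" where
    "T l m x = (if l = m then mat 1 else
       (\<chi> r q. if q = 1 then M l x (b m) $ r else - M l x (a m) $ r / F m (a m) (b m) x))" for l m x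
  have overlap_nz: "F m (a m) (b m) x \<noteq> 0" if "l \<in> X" "m \<in> X" "l \<noteq> m" "x \<in> V l" "x \<in> V m" for l m x
  proof (cases "x = m")
    case False
    then show ?thesis using Fnz that by blast
  next
    case True
    then have "F l (a l) (b l) x \<noteq> 0" using Fnz that by blast
    then have "F m (a l) (b l) x \<noteq> 0" using Fg[of l m x "a l" "b l"] that ab by auto
    then show ?thesis using F0[of m x "a l" "b l"] that ab by blast
  qed
  have TM: "T l m x *v M m x j = M l x j" if lm: "l \<in> X" "m \<in> X" "x \<in> V l" "x \<in> V m" and j: "j \<in> I" for l m x j
  proof (cases "l = m")
    case True
    then show ?thesis by (simp add: T_def)
  next
    case False
    let ?f = "F m (a m) (b m) x" and ?a = "a m" and ?b = "b m"
    have f: "?f \<noteq> 0" by (rule overlap_nz[OF lm(1,2) False lm(3,4)])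
    have aI: "?a \<in> I" "?b \<in> I" using ab lm by auto
    have gnz: "g l m x \<noteq> 0"
    proof
      assume "g l m x = 0"
      then have "F l j k x = 0" if "j \<in> I" "k \<in> I" for j k using Fg[OF lm that] by simp
      moreover have "F l (a l) (b l) x \<noteq> 0" using overlap_nz[of m l x] lm False by blast
      ultimately show False using ab lm by blast
    qed
    have row: "M l x ?b $ r * c m j x + (- M l x ?a $ r / ?f) * F m ?b j x = M l x j $ r" for r
    proof -
      have dt: "M l x ?a $ 1 * M l x j $ 2 - M l x j $ 1 * M l x ?a $ 2 = g l m x * F m ?a j x"
        "M l x ?b $ 1 * M l x j $ 2 - M l x j $ 1 * M l x ?b $ 2 = g l m x * F m ?b j x"
        "M l x ?a $ 1 * M l x ?b $ 2 - M l x ?b $ 1 * M l x ?a $ 2 = g l m x * ?f"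
        using Mdet[OF lm(1,3)] Fg[OF lm] aI j by simp_all
      have "g l m x * (M l x ?b $ r * F m ?a j x - M l x ?a $ r * F m ?b j x) =
          M l x ?b $ r * (g l m x * F m ?a j x) - M l x ?a $ r * (g l m x * F m ?b j x)"
        by (simp add: algebra_simps)
      also have "\<dots> = M l x j $ r * (g l m x * ?f)"
        (* Three vectors of the plane satisfy det(u,v) w - det(u,w) v + det(v,w) u = 0. *)
        unfolding dt[symmetric] using exhaust_2[of r] by (auto simp: algebra_simps)
      finally have "M l x ?b $ r * F m ?a j x - M l x ?a $ r * F m ?b j x = M l x j $ r * ?f"
        using gnz by (metis mult.left_commute mult_left_cancel)
      then have "M l x ?b $ r * (c m j x * ?f) - M l x ?a $ r * F m ?b j x = M l x j $ r * ?f"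
        using cF[OF lm(2,4) j] by simp
      then show ?thesis using f by (simp add: field_simps)
    qed
    have "(T l m x *v M m x j) $ r = M l x j $ r" for r
      using row[of r] False by (simp add: T_def matrix_vector_mult_def sum_2 M1 M2)
    then show ?thesis by (simp add: vec_eq_iff)
  qed
  have uniq: "P = Q" if m: "m \<in> X" "x \<in> V m" "F m (a m) (b m) x \<noteq> 0"
    and PQ: "\<And>j. j \<in> I \<Longrightarrow> P *v M m x j = Q *v M m x j" for P Q :: "complex ^ 2 ^ 2" and m x
  proof -
    have "P $ r $ 1 = Q $ r $ 1" for r
      using arg_cong[OF PQ[OF ab(2)[OF m(1)]], of "\<lambda>v. v $ r"]
      by (simp add: Mb[OF m] matrix_vector_mult_def sum_2)
    moreover have "P $ r $ 2 = Q $ r $ 2" for r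
      using arg_cong[OF PQ[OF ab(1)[OF m(1)]], of "\<lambda>v. v $ r"] m(3)
      by (simp add: Ma[OF m] matrix_vector_mult_def sum_2)
    ultimately show ?thesis by (simp add: vec_eq_iff forall_2)
  qed
  have cocycle: "T l m x ** T m k x = T l k x"
    if lmk: "l \<in> X" "m \<in> X" "k \<in> X" "x \<in> V l" "x \<in> V m" "x \<in> V k" for l m k x
  proof (cases "l = m \<or> m = k")
    case True
    have "T m m x = mat 1" for m by (simp add: T_def)
    then show ?thesis using True by auto
  next
    case False
    show ?thesis
    proof (rule uniq[OF lmk(3,6)])
      show "F k (a k) (b k) x \<noteq> 0" using overlap_nz[of m k x] lmk False by blast
      show "(T l m x ** T m k x) *v M k x j = T l k x *v M k x j" if "j \<in> I" for j
        using TM[OF lmk(2,3,5,6) that] TM[OF lmk(1,2,4,5) that] TM[OF lmk(1,3,4,6) that]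
        by (simp flip: matrix_vector_mul_assoc)
    qed
  qed
  have detT: "mat (det (T l m x)) = trans L (\<iota> l) (\<iota> m) x"
    if lm: "l \<in> X" "m \<in> X" "x \<in> V l" "x \<in> V m" for l m x
  proof (cases "l = m")
    case True
    then show ?thesis using vector_bundle_D(4)[OF L \<iota>[OF lm(1)]] V(3)[OF lm(1)] lm by (auto simp: T_def)
  next
    case False
    let ?f = "F m (a m) (b m) x"
    have f: "?f \<noteq> 0" by (rule overlap_nz[OF lm(1,2) False lm(3,4)])
    have "M l x (a m) $ 1 * M l x (b m) $ 2 - M l x (b m) $ 1 * M l x (a m) $ 2 = g l m x * ?f"
      using Mdet[OF lm(1,3)] Fg[OF lm] ab lm by simp
    then have "det (T l m x) = g l m x"
      using f False by (simp add: T_def det_2 field_simps)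
    then show ?thesis by (simp add: mat_def vec_eq_iff g_def)
  qed
  have regM: "reg_at X x (\<lambda>x. M l x j $ r)" if "l \<in> X" "x \<in> V l" "j \<in> I" for l x j r
    using exhaust_2[of r] regc[OF that] regF[OF that(1,2) ab(2)[OF that(1)] that(3)] by (auto simp: M1 M2)
  define E :: "('n, 'n pt, 2) vbundle" where "E = \<lparr>indices = X, patch = V, trans = T\<rparr>"
  have Esel [simp]: "indices E = X" "patch E = V" "trans E = T" by (simp_all add: E_def)
  have E: "vector_bundle X E"
    unfolding vector_bundle_def Esel
  proof (intro conjI ballI allI)
    show "openin (ztop X) (V l)" if "l \<in> X" for l by (rule V(1)[OF that])
    show "\<Union> (V ` X) = X" using V(2) VX by blast
    show "T l l x = mat 1" for l x by (simp add: T_def)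
    show "T l m x ** T m k x = T l k x" if "l \<in> X" "m \<in> X" "k \<in> X" "x \<in> V l \<inter> V m \<inter> V k" for l m k x
      using cocycle that by blast
    fix l m r q assume lm: "l \<in> X" "m \<in> X"
    show "regular_on X (V l \<inter> V m) (\<lambda>x. T l m x $ r $ q)"
      unfolding regular_on_iff[OF openin_Int[OF V(1)[OF lm(1)] V(1)[OF lm(2)]]]
    proof
      fix x assume x: "x \<in> V l \<inter> V m"
      show "reg_at X x (\<lambda>x. T l m x $ r $ q)"
      proof (cases "l = m")
        case True
        then show ?thesis using reg_at_const by (simp add: T_def)
      next
        case False
        have 1: "reg_at X x (\<lambda>x. M l x (b m) $ r)" using regM x lm ab by blast
        have f: "F m (a m) (b m) x \<noteq> 0" using overlap_nz[of l m x] lm x False by blast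
        have 2: "reg_at X x (\<lambda>x. - M l x (a m) $ r / F m (a m) (b m) x)"
          by (rule reg_at_divide[OF reg_at_uminus[OF regM] regF _ f]) (use x lm ab VX in auto)
        show ?thesis using False 1 2 by (cases "q = 1") (simp_all add: T_def)
      qed
    qed
  qed
  (* Since det (T l m) is the transition function of L between the chosen trivialisations, those of L
     serve as the isomorphism. *)
  define \<phi> where "\<phi> i m = trans L i (\<iota> m)" for i m
  have inv: "invertible (trans L i j x)" if "i \<in> indices L" "j \<in> indices L" "x \<in> patch L i" "x \<in> patch L j" for i j x
    unfolding invertible_def
    using vector_bundle_D(5)[OF L that(1,2,1,3,4,3)] vector_bundle_D(5)[OF L that(2,1,2,4,3,4)]
      vector_bundle_D(4)[OF L that(1,3)] vector_bundle_D(4)[OF L that(2,4)] by metis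
  have iso: "bundle_iso X (det_bundle E) L \<phi>"
    unfolding bundle_iso_def
  proof (intro conjI ballI allI)
    fix i m assume i: "i \<in> indices L" and m: "m \<in> indices (det_bundle E)"
    then have m: "m \<in> X" by (simp add: det_bundle_def)
    have sub: "patch L i \<inter> V m \<subseteq> patch L i \<inter> patch L (\<iota> m)" using V(3)[OF m] by blast
    have pd: "patch (det_bundle E) m = V m" by (simp add: det_bundle_def)
    show "regular_on X (patch L i \<inter> patch (det_bundle E) m) (\<lambda>x. \<phi> i m x $ r $ q)" for r q
    proof -
      have o1: "openin (ztop X) (patch L i \<inter> patch L (\<iota> m))" and o2: "openin (ztop X) (patch L i \<inter> V m)"
        using vector_bundle_D(1)[OF L] i \<iota>[OF m] V(1)[OF m] by auto
      show ?thesis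
        unfolding \<phi>_def pd regular_on_iff[OF o2]
        using vector_bundle_D(3)[OF L i \<iota>[OF m], of r q] sub unfolding regular_on_iff[OF o1] by blast
    qed
    show "invertible (\<phi> i m x)" if "x \<in> patch L i \<inter> patch (det_bundle E) m" for x
      unfolding \<phi>_def using that sub pd i \<iota>[OF m] by (intro inv) auto
  next
    fix i i' m m' x
    assume i: "i \<in> indices L" "i' \<in> indices L" and "m \<in> indices (det_bundle E)" "m' \<in> indices (det_bundle E)"
      and "x \<in> patch L i \<inter> patch L i' \<inter> patch (det_bundle E) m \<inter> patch (det_bundle E) m'"
    then have m: "m \<in> X" "m' \<in> X" and x: "x \<in> patch L i" "x \<in> patch L i'" "x \<in> V m" "x \<in> V m'"
      by (auto simp: det_bundle_def)
    have xp: "x \<in> patch L (\<iota> m)" "x \<in> patch L (\<iota> m')" using V(3) m x by auto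
    have "\<phi> i m x ** trans (det_bundle E) m m' x = trans L i (\<iota> m) x ** trans L (\<iota> m) (\<iota> m') x"
      using detT[OF m x(3,4)] by (simp add: \<phi>_def det_bundle_def)
    also have "\<dots> = trans L i (\<iota> m') x"
      by (rule vector_bundle_D(5)[OF L i(1) \<iota>[OF m(1)] \<iota>[OF m(2)] x(1) xp])
    also have "\<dots> = trans L i i' x ** \<phi> i' m' x"
      unfolding \<phi>_def by (rule vector_bundle_D(5)[OF L i \<iota>[OF m(2)] x(1,2) xp(2), symmetric])
    finally show "\<phi> i m x ** trans (det_bundle E) m m' x = trans L i i' x ** \<phi> i' m' x" .
  qed
  define s where "s j l x = (if l \<in> X \<and> x \<in> V l then M l x j else 0)" for j l x
  have sH: "s j \<in> H0 X E" if j: "j \<in> I" for j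
    unfolding H0_def Esel
  proof (intro CollectI conjI ballI allI impI)
    fix l q assume l: "l \<in> X"
    show "regular_on X (V l) (\<lambda>x. s j l x $ q)"
      unfolding regular_on_iff[OF V(1)[OF l]]
    proof
      fix x assume x: "x \<in> V l"
      show "reg_at X x (\<lambda>x. s j l x $ q)"
      proof (rule reg_at_cong[OF regM[OF l x j]])
        show "\<forall>\<^sub>F m in near x. M l m j $ q = s j l m $ q"
          using eventually_near_open[OF V(1)[OF l] x] by eventually_elim (simp add: s_def l)
      qed
    qed
  next
    fix l m x assume "l \<in> X" "m \<in> X" "x \<in> V l \<inter> V m"
    then show "s j l x = T l m x *v s j m x" using TM[of l m x j] j by (simp add: s_def)
  next
    fix l x assume "\<not> (l \<in> X \<and> x \<in> V l)"
    then show "s j l x = 0" by (auto simp: s_def)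
  qed
  have "det_map E L \<phi> (s j) (s k) = A j k" if jk: "j \<in> I" "k \<in> I" for j k
  proof (intro ext)
    fix i x
    show "det_map E L \<phi> (s j) (s k) i x = A j k i x"
    proof (cases "i \<in> indices L \<and> x \<in> patch L i")
      case False
      then show ?thesis using H0_D(3)[OF A[OF jk] False] by (auto simp: det_map_def apply_iso_def)
    next
      case True
      define m where "m = (SOME m. m \<in> X \<and> x \<in> V m)"
      have "x \<in> X" using True vector_bundle_D(2)[OF L] by blast
      then have "x \<in> X \<and> x \<in> V x" using V(2) by blast
      then have m: "m \<in> X \<and> x \<in> V m" unfolding m_def by (rule someI[of "\<lambda>m. m \<in> X \<and> x \<in> V m"])
      have "det (vector [s j m x, s k m x] :: complex ^ 2 ^ 2) = F m j k x"
        using Mdet[of m x j k] m jk by (simp add: s_def det_2 mult.commute)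
      then have "(\<chi> q. det (vector [s j m x, s k m x] :: complex ^ 2 ^ 2)) = A j k (\<iota> m) x"
        by (simp add: vec1_eq_iff F_def)
      then have "det_map E L \<phi> (s j) (s k) i x = \<phi> i m x *v A j k (\<iota> m) x"
        using True by (simp add: det_map_def apply_iso_def det_bundle_def Let_def flip: m_def)
      also have "\<dots> = A j k i x"
        unfolding \<phi>_def
        by (rule H0_D(2)[OF A[OF jk], symmetric]) (use True m \<iota> V(3) in auto)
      finally show ?thesis .
    qed
  qed
  then show ?thesis using E iso sH by blast
qed

end

section \<open>Alternating maps on formal combinations\<close>

abbreviation (input) single :: "'k \<Rightarrow> complex \<Rightarrow> 'k \<Rightarrow>\<^sub>0 complex" where
  "single \<equiv> Poly_Mapping.single"

abbreviation (input) keys :: "('k \<Rightarrow>\<^sub>0 complex) \<Rightarrow> 'k set" where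
  "keys \<equiv> Poly_Mapping.keys"

abbreviation (input) lookup :: "('k \<Rightarrow>\<^sub>0 complex) \<Rightarrow> 'k \<Rightarrow> complex" where
  "lookup \<equiv> Poly_Mapping.lookup"

text \<open>The list without its entry at position \<open>i\<close>, counted from \<open>0\<close>.\<close>

definition remove_nth :: "nat \<Rightarrow> 'v list \<Rightarrow> 'v list" where
  "remove_nth i vs = take i vs @ drop (Suc i) vs"

text \<open>Lists of length \<open>p\<close> with entries in \<open>V\<close>.\<close>

definition tuples :: "nat \<Rightarrow> 'v set \<Rightarrow> 'v list set" where
  "tuples p V = {vs. length vs = p \<and> set vs \<subseteq> V}"

lemma symbols_iff: "(vs, s) \<in> symbols p V S \<longleftrightarrow> vs \<in> tuples p V \<and> s \<in> S"
  by (simp add: symbols_def tuples_def)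

lemma length_remove_nth: "i < length vs \<Longrightarrow> length (remove_nth i vs) = length vs - 1"
  by (simp add: remove_nth_def)

lemma nth_remove_nth:
  "i < length vs \<Longrightarrow> k < length vs - 1 \<Longrightarrow> remove_nth i vs ! k = (if k < i then vs ! k else vs ! Suc k)"
  by (auto simp: remove_nth_def nth_append)

lemma remove_nth_tuples: "vs \<in> tuples p V \<Longrightarrow> i < p \<Longrightarrow> remove_nth i vs \<in> tuples (p - 1) V"
  by (auto simp: tuples_def length_remove_nth) (auto simp: remove_nth_def dest: in_set_takeD in_set_dropD)

lemma tuples_update: "vs \<in> tuples p V \<Longrightarrow> a \<in> V \<Longrightarrow> vs[i := a] \<in> tuples p V"
  by (auto simp: tuples_def dest: set_update_subset_insert[THEN subsetD])

lemma tuples_nth: "vs \<in> tuples p V \<Longrightarrow> i < p \<Longrightarrow> vs ! i \<in> V"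
  by (auto simp: tuples_def)

lemma remove_nth_update_same: "i < length vs \<Longrightarrow> remove_nth i (vs[i := a]) = remove_nth i vs"
  by (simp add: remove_nth_def)

lemma remove_nth_update_other:
  assumes "i < length vs" "m < length vs" "m \<noteq> i"
  shows "remove_nth m (vs[i := a]) = (remove_nth m vs)[(if i < m then i else i - 1) := a]"
  using assms
  by (intro nth_equalityI) (auto simp: length_remove_nth nth_remove_nth nth_list_update)

lemma remove_nth_adjacent:
  assumes "Suc i < length vs" "vs ! i = vs ! Suc i"
  shows "remove_nth (Suc i) vs = remove_nth i vs"
  using assms by (intro nth_equalityI) (auto simp: length_remove_nth nth_remove_nth less_Suc_eq)

text \<open>The target of linear and multilinear maps. A locale of its own keeps the following notions out of
  the existing interpretations of vector spaces.\<close>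

locale complex_space = vector_space sc for sc :: "complex \<Rightarrow> 'b::ab_group_add \<Rightarrow> 'b"
begin

text \<open>\<open>F\<close> is multilinear and alternating on \<open>V\<^sup>p\<close> modulo the subspace \<open>N\<close>. Only equal adjacent arguments are
  considered; the general case follows.\<close>

definition multi_alt :: "(complex \<Rightarrow> 'v \<Rightarrow> 'v) \<Rightarrow> 'b set \<Rightarrow> nat \<Rightarrow> 'v::ab_group_add set \<Rightarrow> ('v list \<Rightarrow> 'b) \<Rightarrow> bool" where
  "multi_alt scV N p V F \<longleftrightarrow>
     (\<forall>vs\<in>tuples p V. \<forall>i<p. \<forall>a\<in>V. \<forall>b\<in>V. F (vs[i := a + b]) - F (vs[i := a]) - F (vs[i := b]) \<in> N) \<and>
     (\<forall>vs\<in>tuples p V. \<forall>i<p. \<forall>a\<in>V. \<forall>c. F (vs[i := scV c a]) - sc c (F (vs[i := a])) \<in> N) \<and>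
     (\<forall>vs\<in>tuples p V. \<forall>i. Suc i < p \<longrightarrow> vs ! i = vs ! Suc i \<longrightarrow> F vs \<in> N)"

lemma multi_altD:
  fixes scV :: "complex \<Rightarrow> 'v::ab_group_add \<Rightarrow> 'v" and c :: complex
  assumes "multi_alt scV N p V F" "vs \<in> tuples p V"
  shows "\<lbrakk>i < p; a \<in> V; b \<in> V\<rbrakk> \<Longrightarrow> F (vs[i := a + b]) - F (vs[i := a]) - F (vs[i := b]) \<in> N"
    and "\<lbrakk>i < p; a \<in> V\<rbrakk> \<Longrightarrow> F (vs[i := scV c a]) - sc c (F (vs[i := a])) \<in> N"
    and "\<lbrakk>Suc i < p; vs ! i = vs ! Suc i\<rbrakk> \<Longrightarrow> F vs \<in> N"
  using assms unfolding multi_alt_def by blast+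

lemma multi_alt_mono: "multi_alt scV N p V F \<Longrightarrow> N \<subseteq> N' \<Longrightarrow> multi_alt scV N' p V F"
  unfolding multi_alt_def by blast

lemma multi_alt_swap:
  assumes N: "subspace N" and F: "multi_alt scV N p V F" and V: "\<And>a b. a \<in> V \<Longrightarrow> b \<in> V \<Longrightarrow> a + b \<in> V"
    and vs: "vs \<in> tuples p V" and i: "Suc i < p"
  shows "F (vs[i := vs ! Suc i, Suc i := vs ! i]) + F vs \<in> N"
proof -
  define a b where "a = vs ! i" and "b = vs ! Suc i"
  have ab: "a \<in> V" "b \<in> V" using vs i by (auto simp: a_def b_def tuples_nth)
  have len: "length vs = p" using vs by (simp add: tuples_def)
  define f where "f x y = F (vs[i := x, Suc i := y])" for x y
  have t: "vs[i := x, Suc i := y] \<in> tuples p V" if "x \<in> V" "y \<in> V" for x y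
    using vs that by (intro tuples_update)
  have add1: "f (x + x') y - f x y - f x' y \<in> N" if "x \<in> V" "x' \<in> V" "y \<in> V" for x x' y
  proof -
    have sw: "(vs[i := x, Suc i := y])[i := z] = vs[i := z, Suc i := y]" for z
      using i len by (intro nth_equalityI) (auto simp: nth_list_update)
    show ?thesis
      using multi_altD(1)[OF F t[OF that(1,3)], of i x x'] i that unfolding f_def sw by simp
  qed
  have add2: "f x (y + y') - f x y - f x y' \<in> N" if "x \<in> V" "y \<in> V" "y' \<in> V" for x y y'
    using multi_altD(1)[OF F t[OF that(1,2)], of "Suc i" y y'] i that by (simp add: f_def)
  have diag: "f x x \<in> N" if "x \<in> V" for x
    using multi_altD(3)[OF F t[OF that that], of i] i len by (simp add: f_def)
  have n: "f (a + b) (a + b) \<in> N" "f a a \<in> N" "f b b \<in> N" using diag ab V by auto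
  have n2: "f (a + b) (a + b) - f a (a + b) - f b (a + b) \<in> N" using add1 ab V by auto
  have n3: "f a (a + b) - f a a - f a b \<in> N" "f b (a + b) - f b a - f b b \<in> N" using add2 ab by auto
  have "f b a + f a b = f (a + b) (a + b) - (f (a + b) (a + b) - f a (a + b) - f b (a + b))
      - (f a (a + b) - f a a - f a b) - (f b (a + b) - f b a - f b b) - f a a - f b b"
    by simp
  then have "f b a + f a b \<in> N" using n n2 n3 N by (metis subspace_diff)
  moreover have "vs[i := a, Suc i := b] = vs" by (simp add: a_def b_def)
  ultimately show ?thesis by (simp add: f_def a_def b_def)
qed

lemma multi_alt_equal:
  assumes N: "subspace N" and F: "multi_alt scV N p V F" and V: "\<And>a b. a \<in> V \<Longrightarrow> b \<in> V \<Longrightarrow> a + b \<in> V"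
    and "vs \<in> tuples p V" "i < j" "j < p" "vs ! i = vs ! j"
  shows "F vs \<in> N"
  using assms(4-7)
proof (induction j arbitrary: vs)
  case (Suc j)
  have len: "length vs = p" using Suc.prems by (simp add: tuples_def)
  show ?case
  proof (cases "i = j")
    case True
    then show ?thesis using multi_altD(3)[OF F Suc.prems(1)] Suc.prems by simp
  next
    case False
    define vs' where "vs' = vs[j := vs ! Suc j, Suc j := vs ! j]"
    have vs': "vs' \<in> tuples p V"
      unfolding vs'_def using Suc.prems by (intro tuples_update tuples_nth) auto
    have "vs' ! i = vs' ! j" unfolding vs'_def using Suc.prems False len by simp
    then have "F vs' \<in> N" using Suc.IH[OF vs'] Suc.prems False by simp
    moreover have "F vs' + F vs \<in> N"
      unfolding vs'_def by (rule multi_alt_swap[OF N F V Suc.prems(1) Suc.prems(3)])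
    ultimately have "(F vs' + F vs) - F vs' \<in> N" using N by (metis subspace_diff)
    then show ?thesis by simp
  qed
qed simp

text \<open>An alternating sum over the ways to split off one argument is again multilinear and alternating.
  Both the Koszul differential and the Laplace expansion of determinants are instances.\<close>

lemma multi_alt_contraction:
  fixes scV :: "complex \<Rightarrow> 'v::ab_group_add \<Rightarrow> 'v"
  assumes N: "subspace N"
    and V: "\<And>a b. a \<in> V \<Longrightarrow> b \<in> V \<Longrightarrow> a + b \<in> V" "\<And>(c::complex) a. a \<in> V \<Longrightarrow> scV c a \<in> V"
    and G: "\<And>v. v \<in> V \<Longrightarrow> multi_alt scV N (p - 1) V (G v)"
    and add: "\<And>a b ws. \<lbrakk>ws \<in> tuples (p - 1) V; a \<in> V; b \<in> V\<rbrakk> \<Longrightarrow> G (a + b) ws - G a ws - G b ws \<in> N"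
    and scale: "\<And>a (c::complex) ws. \<lbrakk>ws \<in> tuples (p - 1) V; a \<in> V\<rbrakk> \<Longrightarrow> G (scV c a) ws - sc c (G a ws) \<in> N"
  shows "multi_alt scV N p V (\<lambda>vs. \<Sum>i<p. sc ((-1) ^ i) (G (vs ! i) (remove_nth i vs)))"
  unfolding multi_alt_def
proof (intro conjI ballI allI impI)
  fix vs i a assume vs: "vs \<in> tuples p V" and i: "i < p" and a: "a \<in> V"
  have len: "length vs = p" using vs by (simp add: tuples_def)
  have rm: "remove_nth m vs \<in> tuples (p - 1) V" if "m < p" for m
    using remove_nth_tuples[OF vs that] .
  have nm: "vs ! m \<in> V" if "m < p" for m using tuples_nth[OF vs that] .
  have upd: "remove_nth i (vs[i := x]) = remove_nth i vs" for x
    using i len by (simp add: remove_nth_update_same)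
  define pos where "pos m = (if i < m then i else i - 1)" for m
  have pos: "pos m < p - 1" if "m < p" "m \<noteq> i" for m using that i by (auto simp: pos_def)
  have upd': "remove_nth m (vs[i := x]) = (remove_nth m vs)[pos m := x]" if "m < p" "m \<noteq> i" for x m
    using that i len by (simp add: remove_nth_update_other pos_def)
  {
    fix b assume b: "b \<in> V"
    have *: "sc ((-1) ^ m) (G (vs[i := a + b] ! m) (remove_nth m (vs[i := a + b]))) -
          sc ((-1) ^ m) (G (vs[i := a] ! m) (remove_nth m (vs[i := a]))) -
          sc ((-1) ^ m) (G (vs[i := b] ! m) (remove_nth m (vs[i := b]))) \<in> N" if m: "m < p" for m
    proof (cases "m = i")
      case True
      have "sc ((-1) ^ i) (G (a + b) (remove_nth i vs) - G a (remove_nth i vs) - G b (remove_nth i vs)) \<in> N"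
        by (intro subspace_scale[OF N] add rm i a b)
      then show ?thesis using True len i by (simp add: upd scale_right_diff_distrib)
    next
      case False
      have "sc ((-1) ^ m) (G (vs ! m) ((remove_nth m vs)[pos m := a + b]) -
          G (vs ! m) ((remove_nth m vs)[pos m := a]) - G (vs ! m) ((remove_nth m vs)[pos m := b])) \<in> N"
        by (intro subspace_scale[OF N] multi_altD(1)[OF G] nm rm pos m False a b)
      then show ?thesis using False by (simp add: upd'[OF m False] scale_right_diff_distrib)
    qed
    have "(\<Sum>m<p. sc ((-1) ^ m) (G (vs[i := a + b] ! m) (remove_nth m (vs[i := a + b]))) -
          sc ((-1) ^ m) (G (vs[i := a] ! m) (remove_nth m (vs[i := a]))) -
          sc ((-1) ^ m) (G (vs[i := b] ! m) (remove_nth m (vs[i := b])))) \<in> N"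
      using * by (intro subspace_sum[OF N]) auto
    then show "(\<Sum>m<p. sc ((-1) ^ m) (G (vs[i := a + b] ! m) (remove_nth m (vs[i := a + b])))) -
          (\<Sum>m<p. sc ((-1) ^ m) (G (vs[i := a] ! m) (remove_nth m (vs[i := a])))) -
          (\<Sum>m<p. sc ((-1) ^ m) (G (vs[i := b] ! m) (remove_nth m (vs[i := b])))) \<in> N"
      by (simp add: sum_subtractf)
  }
  fix c
  have *: "sc ((-1) ^ m) (G (vs[i := scV c a] ! m) (remove_nth m (vs[i := scV c a]))) -
        sc c (sc ((-1) ^ m) (G (vs[i := a] ! m) (remove_nth m (vs[i := a])))) \<in> N" if m: "m < p" for m
  proof (cases "m = i")
    case True
    have "sc ((-1) ^ i) (G (scV c a) (remove_nth i vs) - sc c (G a (remove_nth i vs))) \<in> N"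
      by (intro subspace_scale[OF N] scale rm i a)
    then show ?thesis using True len i by (simp add: upd scale_right_diff_distrib mult.commute)
  next
    case False
    have "sc ((-1) ^ m) (G (vs ! m) ((remove_nth m vs)[pos m := scV c a]) -
        sc c (G (vs ! m) ((remove_nth m vs)[pos m := a]))) \<in> N"
      by (intro subspace_scale[OF N] multi_altD(2)[OF G] nm rm pos m False a)
    then show ?thesis using False by (simp add: upd'[OF m False] scale_right_diff_distrib mult.commute)
  qed
  have "(\<Sum>m<p. sc ((-1) ^ m) (G (vs[i := scV c a] ! m) (remove_nth m (vs[i := scV c a]))) -
        sc c (sc ((-1) ^ m) (G (vs[i := a] ! m) (remove_nth m (vs[i := a]))))) \<in> N"
    using * by (intro subspace_sum[OF N]) auto
  then show "(\<Sum>m<p. sc ((-1) ^ m) (G (vs[i := scV c a] ! m) (remove_nth m (vs[i := scV c a])))) -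
        sc c (\<Sum>m<p. sc ((-1) ^ m) (G (vs[i := a] ! m) (remove_nth m (vs[i := a])))) \<in> N"
    by (simp add: sum_subtractf scale_sum_right)
next
  fix vs i assume vs: "vs \<in> tuples p V" and i: "Suc i < p" and eq: "vs ! i = vs ! Suc i"
  have len: "length vs = p" using vs by (simp add: tuples_def)
  have rm: "remove_nth m vs \<in> tuples (p - 1) V" if "m < p" for m
    using remove_nth_tuples[OF vs that] .
  let ?g = "\<lambda>m. sc ((-1) ^ m) (G (vs ! m) (remove_nth m vs))"
  have sub: "{i, Suc i} \<subseteq> {..<p}" using i by auto
  have "(\<Sum>m<p. ?g m) = (\<Sum>m\<in>{..<p} - {i, Suc i}. ?g m) + (\<Sum>m\<in>{i, Suc i}. ?g m)"
    by (rule sum.subset_diff[OF sub]) simp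
  also have "(\<Sum>m\<in>{i, Suc i}. ?g m) = 0"
    using remove_nth_adjacent[of i vs] i len eq by simp
  finally have "(\<Sum>m<p. ?g m) = (\<Sum>m\<in>{..<p} - {i, Suc i}. ?g m)" by simp
  moreover have "?g m \<in> N" if m: "m < p" "m \<noteq> i" "m \<noteq> Suc i" for m
  proof (rule subspace_scale[OF N])
    have "vs ! m \<in> V" using tuples_nth[OF vs m(1)] .
    note Gm = G[OF this]
    show "G (vs ! m) (remove_nth m vs) \<in> N"
    proof (cases "m < i")
      case True
      show ?thesis
        by (rule multi_altD(3)[OF Gm rm[OF m(1)], of "i - 1"])
           (use True m i len eq in \<open>auto simp: nth_remove_nth\<close>)
    next
      case False
      show ?thesis
        by (rule multi_altD(3)[OF Gm rm[OF m(1)], of i])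
           (use False m i len eq in \<open>auto simp: nth_remove_nth\<close>)
    qed
  qed
  then have "(\<Sum>m\<in>{..<p} - {i, Suc i}. ?g m) \<in> N" by (intro subspace_sum[OF N]) auto
  ultimately show "(\<Sum>m<p. ?g m) \<in> N" by simp
qed

text \<open>The linear extension to formal combinations of a map given on symbols.\<close>

definition lin_ext :: "('k \<Rightarrow> 'b) \<Rightarrow> ('k \<Rightarrow>\<^sub>0 complex) \<Rightarrow> 'b" where
  "lin_ext g x = (\<Sum>k\<in>keys x. sc (lookup x k) (g k))"

lemma lin_ext_superset:
  assumes "finite K" "keys x \<subseteq> K"
  shows "lin_ext g x = (\<Sum>k\<in>K. sc (lookup x k) (g k))"
  unfolding lin_ext_def using assms by (intro sum.mono_neutral_left) (auto simp: in_keys_iff)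

lemma lin_ext_add: "lin_ext g (x + y) = lin_ext g x + lin_ext g y"
proof -
  let ?K = "keys x \<union> keys y"
  have "lin_ext g (x + y) = (\<Sum>k\<in>?K. sc (lookup (x + y) k) (g k))"
    using keys_add[of x y] by (intro lin_ext_superset) auto
  also have "\<dots> = (\<Sum>k\<in>?K. sc (lookup x k) (g k)) + (\<Sum>k\<in>?K. sc (lookup y k) (g k))"
    by (simp add: lookup_add scale_left_distrib sum.distrib)
  also have "\<dots> = lin_ext g x + lin_ext g y"
    using lin_ext_superset[of ?K x g] lin_ext_superset[of ?K y g] by simp
  finally show ?thesis .
qed

lemma lin_ext_single: "lin_ext g (single k c) = sc c (g k)"
  by (simp add: lin_ext_def)

lemma lin_ext_0: "lin_ext g 0 = 0"
  by (simp add: lin_ext_def)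

lemma lin_ext_uminus: "lin_ext g (- x) = - lin_ext g x"
  using lin_ext_add[of g "- x" x] by (simp add: lin_ext_0 eq_neg_iff_add_eq_0)

lemma lin_ext_diff: "lin_ext g (x - y) = lin_ext g x - lin_ext g y"
  using lin_ext_add[of g x "- y"] by (simp add: lin_ext_uminus)

lemma lin_ext_sum: "lin_ext g (sum f A) = (\<Sum>a\<in>A. lin_ext g (f a))"
  by (induction A rule: infinite_finite_induct) (auto simp: lin_ext_0 lin_ext_add)

lemma lin_ext_comb_scale: "lin_ext g (comb_scale c x) = sc c (lin_ext g x)"
proof -
  have "keys (comb_scale c x) \<subseteq> keys x"
    by (auto simp: in_keys_iff lookup_comb_scale)
  then have "lin_ext g (comb_scale c x) = (\<Sum>k\<in>keys x. sc (lookup (comb_scale c x) k) (g k))"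
    by (intro lin_ext_superset) auto
  then show ?thesis by (simp add: lin_ext_def lookup_comb_scale scale_sum_right)
qed

text \<open>Maps that are multilinear and alternating in \<open>V\<close> and linear in \<open>S\<close> descend to \<open>\<Lambda>\<^sup>p V \<otimes> S\<close>.\<close>

lemma lin_ext_relations:
  fixes scV :: "complex \<Rightarrow> 'v::ab_group_add \<Rightarrow> 'v" and scS :: "complex \<Rightarrow> 's::ab_group_add \<Rightarrow> 's"
  assumes N: "subspace N"
    and V: "\<And>a b. a \<in> V \<Longrightarrow> b \<in> V \<Longrightarrow> a + b \<in> V"
    and g: "\<And>s. s \<in> S \<Longrightarrow> multi_alt scV N p V (\<lambda>vs. g (vs, s))"
    and add: "\<And>vs s s'. \<lbrakk>vs \<in> tuples p V; s \<in> S; s' \<in> S\<rbrakk> \<Longrightarrow> g (vs, s + s') - g (vs, s) - g (vs, s') \<in> N"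
    and scale: "\<And>vs s c. \<lbrakk>vs \<in> tuples p V; s \<in> S\<rbrakk> \<Longrightarrow> g (vs, scS c s) - sc c (g (vs, s)) \<in> N"
    and x: "x \<in> relations scV scS p V S"
  shows "lin_ext g x \<in> N"
proof -
  have 1: "lin_ext g r \<in> N" if "r \<in> relators scV scS p V S" for r
    using that
  proof cases
    case (add_V vs s i a b)
    then show ?thesis using multi_altD(1)[OF g, of s vs i a b]
      by (simp add: symbols_iff lin_ext_diff lin_ext_single)
  next
    case (scale_V vs s i a c)
    then show ?thesis using multi_altD(2)[OF g, of s vs i a c]
      by (simp add: symbols_iff lin_ext_diff lin_ext_single)
  next
    case (alternating vs s i j)
    then show ?thesis using multi_alt_equal[OF N g V, of s vs i j]
      by (simp add: symbols_iff lin_ext_single)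
  next
    case (add_S vs s s')
    then show ?thesis using add by (simp add: symbols_iff lin_ext_diff lin_ext_single)
  next
    case (scale_S vs s c)
    then show ?thesis using scale by (simp add: symbols_iff lin_ext_diff lin_ext_single)
  qed
  have "comb.subspace {y. lin_ext g y \<in> N}"
    unfolding comb.subspace_def
    using subspace_0[OF N] subspace_add[OF N] subspace_scale[OF N]
    by (auto simp: lin_ext_0 lin_ext_add lin_ext_comb_scale)
  then have "relations scV scS p V S \<subseteq> {y. lin_ext g y \<in> N}"
    unfolding relations_def using 1 by (intro comb.span_minimal) auto
  then show ?thesis using x by blast
qed

end

section \<open>Relations and the Koszul differential\<close>

global_interpretation comb_target: complex_space "comb_scale :: complex \<Rightarrow> ('k \<Rightarrow>\<^sub>0 complex) \<Rightarrow> ('k \<Rightarrow>\<^sub>0 complex)"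
  by unfold_locales

global_interpretation sect_target: complex_space
  "sect_scale :: complex \<Rightarrow> ('i \<Rightarrow> 'p \<Rightarrow> complex ^ 'r::finite) \<Rightarrow> ('i \<Rightarrow> 'p \<Rightarrow> complex ^ 'r)"
  by unfold_locales

global_interpretation complex_target: complex_space "(*) :: complex \<Rightarrow> complex \<Rightarrow> complex"
  by unfold_locales (auto simp: algebra_simps)

lemma comb_scale_single [simp]: "comb_scale c (single k a) = single k (c * a)"
  by (rule poly_mapping_eqI) (simp add: lookup_comb_scale lookup_single when_def)

lemma subspace_relations: "comb.subspace (relations scV scS p V S)"
  unfolding relations_def by (rule comb.subspace_span)

lemma relators_relations: "x \<in> relators scV scS p V S \<Longrightarrow> x \<in> relations scV scS p V S"
  unfolding relations_def by (rule comb.span_base)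

lemma scaled_relators_relations:
  "x \<in> relators scV scS p V S \<Longrightarrow> comb_scale c x \<in> relations scV scS p V S"
  by (intro comb.subspace_scale[OF subspace_relations] relators_relations)

lemma single_add_relation:
  assumes "vs \<in> tuples p V" "s \<in> S" "s' \<in> S"
  shows "single (vs, s + s') c - single (vs, s) c - single (vs, s') c
     \<in> relations scV scS p V S"
  using scaled_relators_relations[OF relators.add_S[of vs s p V S s' scV scS], of c] assms
  by (simp add: symbols_iff comb.scale_right_diff_distrib)

lemma single_scale_relation:
  assumes "vs \<in> tuples p V" "s \<in> S"
  shows "single (vs, scS b s) c - single (vs, s) (c * b)
     \<in> relations scV scS p V S"
  using scaled_relators_relations[OF relators.scale_S[of vs s p V S scS b scV], of c] assms
  by (simp add: symbols_iff comb.scale_right_diff_distrib)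

lemma multi_alt_single:
  assumes "s \<in> S"
  shows "comb_target.multi_alt scV (relations scV scS p V S) p V (\<lambda>vs. single (vs, s) c)"
  unfolding comb_target.multi_alt_def
proof (intro conjI ballI allI impI)
  fix vs i a b assume "vs \<in> tuples p V" "i < p" "a \<in> V" "b \<in> V"
  then show "single (vs[i := a + b], s) c - single (vs[i := a], s) c -
      single (vs[i := b], s) c \<in> relations scV scS p V S"
    using scaled_relators_relations[OF relators.add_V[of vs s p V S i a b scV scS], of c] assms
    by (simp add: symbols_iff comb.scale_right_diff_distrib)
next
  fix vs i a d assume "vs \<in> tuples p V" "i < p" "a \<in> V"
  then show "single (vs[i := scV d a], s) c -
      comb_scale d (single (vs[i := a], s) c) \<in> relations scV scS p V S"
    using scaled_relators_relations[OF relators.scale_V[of vs s p V S i a scV d scS], of c] assms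
    by (simp add: symbols_iff comb.scale_right_diff_distrib mult.commute)
next
  fix vs i assume "vs \<in> tuples p V" "Suc i < p" "vs ! i = vs ! Suc i"
  then show "single (vs, s) c \<in> relations scV scS p V S"
    using scaled_relators_relations[OF relators.alternating[of vs s p V S i "Suc i" scV scS], of c] assms
    by (simp add: symbols_iff)
qed

text \<open>The Koszul differential of one symbol of length \<open>p\<close>.\<close>

definition koszul_term :: "nat \<Rightarrow> ('v \<Rightarrow> 's \<Rightarrow> 't) \<Rightarrow> 'v list \<times> 's \<Rightarrow> ('v, 't) comb" where
  "koszul_term p \<mu> = (\<lambda>(vs, s). \<Sum>i<p. comb_scale ((-1) ^ i)
     (single (remove_nth i vs, \<mu> (vs ! i) s) (-1)))"

lemma koszul_diff_lin_ext:
  assumes "x \<in> formal p V S"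
  shows "koszul_diff \<mu> x = comb_target.lin_ext (koszul_term p \<mu>) x"
  unfolding koszul_diff_def comb_target.lin_ext_def
proof (rule sum.cong[OF refl])
  fix k assume k: "k \<in> keys x"
  obtain vs s where vs: "k = (vs, s)" by (cases k)
  have "length vs = p" using assms k by (auto simp: formal_def symbols_def vs)
  then show "(case k of (vs, s) \<Rightarrow> \<Sum>i<length vs. single (take i vs @ drop (Suc i) vs, \<mu> (vs ! i) s)
      ((- 1) ^ Suc i * lookup x (vs, s))) = comb_scale (lookup x k) (koszul_term p \<mu> k)"
    by (simp add: vs koszul_term_def comb.scale_sum_right remove_nth_def mult_ac)
qed

lemma koszul_diff_relations:
  fixes scV :: "complex \<Rightarrow> 'v::ab_group_add \<Rightarrow> 'v" and scS :: "complex \<Rightarrow> 's::ab_group_add \<Rightarrow> 's"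
    and scT :: "complex \<Rightarrow> 't::ab_group_add \<Rightarrow> 't"
  assumes V: "\<And>a b. a \<in> V \<Longrightarrow> b \<in> V \<Longrightarrow> a + b \<in> V" "\<And>c a. a \<in> V \<Longrightarrow> scV c a \<in> V"
    and \<mu>: "\<And>v s. v \<in> V \<Longrightarrow> s \<in> S \<Longrightarrow> \<mu> v s \<in> T"
    and addV: "\<And>v v' s. \<mu> (v + v') s = \<mu> v s + \<mu> v' s" and scaleV: "\<And>c v s. \<mu> (scV c v) s = scT c (\<mu> v s)"
    and addS: "\<And>v s s'. \<mu> v (s + s') = \<mu> v s + \<mu> v s'" and scaleS: "\<And>c v s. \<mu> v (scS c s) = scT c (\<mu> v s)"
    and x: "x \<in> relations scV scS p V S" "x \<in> formal p V S"
  shows "koszul_diff \<mu> x \<in> relations scV scT (p - 1) V T"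
  unfolding koszul_diff_lin_ext[OF x(2)]
proof (rule comb_target.lin_ext_relations[OF subspace_relations V(1) _ _ _ x(1)])
  let ?N = "relations scV scT (p - 1) V T"
  fix s assume s: "s \<in> S"
  show "comb_target.multi_alt scV ?N p V (\<lambda>vs. koszul_term p \<mu> (vs, s))"
    unfolding koszul_term_def prod.case
  proof (rule comb_target.multi_alt_contraction[OF subspace_relations V])
    show "comb_target.multi_alt scV ?N (p - 1) V (\<lambda>ws. single (ws, \<mu> v s) (-1))" if "v \<in> V" for v
      by (rule multi_alt_single[OF \<mu>[OF that s]])
    fix a ws assume a: "ws \<in> tuples (p - 1) V" "a \<in> V"
    show "single (ws, \<mu> (a + b) s) (- 1) - single (ws, \<mu> a s) (- 1) -
         single (ws, \<mu> b s) (- 1) \<in> ?N" if "b \<in> V" for b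
      unfolding addV by (rule single_add_relation) (use a that s \<mu> in auto)
    show "single (ws, \<mu> (scV c a) s) (- 1) - comb_scale c (single (ws, \<mu> a s) (- 1)) \<in> ?N" for c
      using single_scale_relation[OF a(1) \<mu>[OF a(2) s], of scT c "-1" scV] by (simp add: scaleV)
  qed
next
  let ?N = "relations scV scT (p - 1) V T"
  fix vs s assume vs: "vs \<in> tuples p V" and s: "s \<in> S"
  have rm: "remove_nth i vs \<in> tuples (p - 1) V" "vs ! i \<in> V" if "i < p" for i
    by (rule remove_nth_tuples[OF vs that], rule tuples_nth[OF vs that])
  {
    fix s' assume s': "s' \<in> S"
    have "(\<Sum>i<p. comb_scale ((-1) ^ i) (single (remove_nth i vs, \<mu> (vs ! i) (s + s')) (-1) -
        single (remove_nth i vs, \<mu> (vs ! i) s) (-1) - single (remove_nth i vs, \<mu> (vs ! i) s') (-1)))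
        \<in> ?N" unfolding addS
      by (intro comb.subspace_sum[OF subspace_relations] comb.subspace_scale[OF subspace_relations]
          single_add_relation rm \<mu> s s') auto
    then show "koszul_term p \<mu> (vs, s + s') - koszul_term p \<mu> (vs, s) - koszul_term p \<mu> (vs, s') \<in> ?N"
      by (simp add: koszul_term_def comb.scale_right_diff_distrib sum_subtractf del: comb_scale_single)
  }
  fix c
  have "(\<Sum>i<p. comb_scale ((-1) ^ i) (single (remove_nth i vs, scT c (\<mu> (vs ! i) s)) (-1) -
      single (remove_nth i vs, \<mu> (vs ! i) s) ((-1) * c))) \<in> ?N"
    by (intro comb.subspace_sum[OF subspace_relations] comb.subspace_scale[OF subspace_relations]
        single_scale_relation rm \<mu> s) auto
  then show "koszul_term p \<mu> (vs, scS c s) - comb_scale c (koszul_term p \<mu> (vs, s)) \<in> ?N"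
    by (simp add: koszul_term_def scaleS comb.scale_right_diff_distrib sum_subtractf comb.scale_sum_right mult_ac)
qed

section \<open>Determinants as functionals on exterior powers\<close>

text \<open>The determinant of the matrix of values of the functionals \<open>fs\<close> at the vectors \<open>vs\<close>, by expansion along
  the first functional; the two lists are meant to have equal length.\<close>

fun contract :: "('v \<Rightarrow> complex) list \<Rightarrow> 'v list \<Rightarrow> complex" where
  "contract [] vs = 1"
| "contract (f # fs) vs = (\<Sum>i<Suc (length fs). (-1) ^ i * (f (vs ! i) * contract fs (remove_nth i vs)))"

lemma multi_alt_contract:
  fixes scV :: "complex \<Rightarrow> 'v::ab_group_add \<Rightarrow> 'v"
  assumes V: "\<And>a b. a \<in> V \<Longrightarrow> b \<in> V \<Longrightarrow> a + b \<in> V" "\<And>c a. a \<in> V \<Longrightarrow> scV c a \<in> V"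
    and fs: "\<And>f a b. f \<in> set fs \<Longrightarrow> f (a + b) = f a + f b" "\<And>f c a. f \<in> set fs \<Longrightarrow> f (scV c a) = c * f a"
  shows "complex_target.multi_alt scV {0} (length fs) V (contract fs)"
  using fs
proof (induction fs)
  case Nil
  then show ?case by (simp add: complex_target.multi_alt_def)
next
  case (Cons f fs)
  have IH: "complex_target.multi_alt scV {0} (length fs) V (contract fs)"
    by (rule Cons.IH) (use Cons.prems in auto)
  have "complex_target.multi_alt scV {0} (length (f # fs)) V
     (\<lambda>vs. \<Sum>i<length (f # fs). (-1) ^ i * (f (vs ! i) * contract fs (remove_nth i vs)))"
  proof (rule complex_target.multi_alt_contraction[OF vector_space_over_itself.subspace_single_0 V])
    show "complex_target.multi_alt scV {0} (length (f # fs) - 1) V (\<lambda>ws. f v * contract fs ws)" for v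
      unfolding complex_target.multi_alt_def singleton_iff
    proof (intro conjI ballI allI impI)
      fix vs i a b assume "vs \<in> tuples (length (f # fs) - 1) V" "i < length (f # fs) - 1" "a \<in> V" "b \<in> V"
      then have "contract fs (vs[i := a + b]) = contract fs (vs[i := a]) + contract fs (vs[i := b])"
        using complex_target.multi_altD(1)[OF IH, of vs i a b] by (simp add: diff_eq_eq add.commute)
      then show "f v * contract fs (vs[i := a + b]) - f v * contract fs (vs[i := a]) - f v * contract fs (vs[i := b]) = 0"
        by (simp add: distrib_left)
    next
      fix vs i a c assume "vs \<in> tuples (length (f # fs) - 1) V" "i < length (f # fs) - 1" "a \<in> V"
      then have "contract fs (vs[i := scV c a]) = c * contract fs (vs[i := a])"
        using complex_target.multi_altD(2)[OF IH, of vs i a c] by simp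
      then show "f v * contract fs (vs[i := scV c a]) - c * (f v * contract fs (vs[i := a])) = 0"
        by simp
    next
      fix vs i assume "vs \<in> tuples (length (f # fs) - 1) V" "Suc i < length (f # fs) - 1" "vs ! i = vs ! Suc i"
      then show "f v * contract fs vs = 0"
        using complex_target.multi_altD(3)[OF IH, of vs i] by simp
    qed
  qed (simp_all add: Cons.prems algebra_simps)
  moreover have "contract (f # fs) = (\<lambda>vs. \<Sum>i<length (f # fs). (-1) ^ i * (f (vs ! i) * contract fs (remove_nth i vs)))"
    by auto
  ultimately show ?case by simp
qed

lemma contract_zero:
  assumes "length vs = length fs" "v \<in> set vs" "\<And>f. f \<in> set fs \<Longrightarrow> f v = 0"
  shows "contract fs vs = 0"
  using assms
proof (induction fs arbitrary: vs)
  case (Cons f fs)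
  have "f (vs ! i) * contract fs (remove_nth i vs) = 0" if i: "i < Suc (length fs)" for i
  proof (cases "vs ! i = v")
    case True
    then show ?thesis using Cons.prems(3) by simp
  next
    case False
    obtain j where j: "j < length vs" "vs ! j = v" using Cons.prems(2) by (auto simp: in_set_conv_nth)
    have "v \<in> set (remove_nth i vs)"
    proof (cases "j < i")
      case True
      have "j < length vs - 1" using True i Cons.prems(1) by simp
      then have "remove_nth i vs ! j = v" "j < length (remove_nth i vs)"
        using True i j Cons.prems(1) by (auto simp: nth_remove_nth length_remove_nth)
      then show ?thesis by (metis nth_mem)
    next
      case nl: False
      have "j \<noteq> i" using False j by auto
      then have "remove_nth i vs ! (j - 1) = v" "j - 1 < length (remove_nth i vs)"
        using nl i j Cons.prems(1) by (auto simp: nth_remove_nth length_remove_nth)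
      then show ?thesis by (metis nth_mem)
    qed
    then have "contract fs (remove_nth i vs) = 0"
      using i Cons.prems by (intro Cons.IH) (auto simp: length_remove_nth)
    then show ?thesis by simp
  qed
  then show ?case unfolding contract.simps
    by (intro sum.neutral ballI) (simp only: lessThan_iff mult_zero_right)
qed simp

lemma contract_dual:
  assumes "distinct ks" "\<And>k k'. k \<in> set ks \<Longrightarrow> k' \<in> set ks \<Longrightarrow> f k (w k') = (if k = k' then 1 else 0)"
  shows "contract (map f ks) (map w ks) = 1"
  using assms
proof (induction ks)
  case (Cons k ks)
  have IH: "contract (map f ks) (map w ks) = 1" by (rule Cons.IH) (use Cons.prems in auto)
  have z: "f k (map w ks ! i) = 0" if "i < length ks" for i
  proof -
    have "ks ! i \<in> set ks" using that by simp
    moreover from this have "ks ! i \<noteq> k" using Cons.prems(1) by auto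
    ultimately show ?thesis using Cons.prems(2)[of k "ks ! i"] that by auto
  qed
  have "contract (map f (k # ks)) (map w (k # ks)) =
      (\<Sum>i<Suc (length ks). if i = 0 then 1 else 0)"
    unfolding list.map contract.simps length_map
  proof (rule sum.cong[OF refl])
    fix i assume i: "i \<in> {..<Suc (length ks)}"
    show "(-1) ^ i * (f k ((w k # map w ks) ! i) * contract (map f ks) (remove_nth i (w k # map w ks))) =
        (if i = 0 then 1 else 0)"
      using z i IH Cons.prems(2)[of k k] by (cases i) (auto simp: remove_nth_def)
  qed
  then show ?case by simp
qed simp

section \<open>Normal forms of tensors\<close>

text \<open>A property preserved by adjacent transpositions passes to rearrangements of a list.\<close>

lemma transpositions_suffice:
  assumes swap: "\<And>xs a b ys. Q (xs @ b # a # ys) \<Longrightarrow> Q (xs @ a # b # ys)"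
    and "mset xs = mset ys" "Q ys"
  shows "Q xs"
proof -
  have move: "Q (pre @ a # ys1 @ ys2)" if "Q (pre @ ys1 @ a # ys2)" for pre a ys1 ys2
    using that
  proof (induction ys1 arbitrary: pre)
    case (Cons y ys1)
    have "Q ((pre @ [y]) @ a # ys1 @ ys2)" by (rule Cons.IH) (use Cons.prems in simp)
    then show ?case using swap[of pre y a "ys1 @ ys2"] by simp
  qed simp
  have "Q (pre @ xs)" if "mset xs = mset ys" "Q (pre @ ys)" for pre
    using that
  proof (induction xs arbitrary: pre ys)
    case (Cons x xs)
    have "x \<in> set ys" using Cons.prems(1) by (metis list.set_intros(1) mset_eq_setD)
    then obtain ys1 ys2 where ys: "ys = ys1 @ x # ys2" by (meson split_list)
    have "Q ((pre @ [x]) @ xs)"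
    proof (rule Cons.IH)
      show "mset xs = mset (ys1 @ ys2)" using Cons.prems(1) ys by simp
      show "Q ((pre @ [x]) @ ys1 @ ys2)" using move[of pre ys1 x ys2] Cons.prems(2) ys by simp
    qed
    then show ?case by simp
  qed simp
  from this[of "[]"] assms show ?thesis by simp
qed

lemma remove_nth_distinct:
  assumes "distinct xs" "m < length xs"
  shows "remove_nth m xs = filter (\<lambda>k. k \<noteq> xs ! m) xs"
proof -
  have xs: "xs = take m xs @ xs ! m # drop (Suc m) xs" by (rule id_take_nth_drop[OF assms(2)])
  then have "distinct (take m xs @ xs ! m # drop (Suc m) xs)" using assms(1) by simp
  then have "xs ! m \<notin> set (take m xs)" "xs ! m \<notin> set (drop (Suc m) xs)" by auto
  then have "filter (\<lambda>k. k \<noteq> xs ! m) (take m xs) = take m xs"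
    "filter (\<lambda>k. k \<noteq> xs ! m) (drop (Suc m) xs) = drop (Suc m) xs"
    by (intro filter_True; force)+
  then have "filter (\<lambda>k. k \<noteq> xs ! m) (take m xs @ xs ! m # drop (Suc m) xs) = remove_nth m xs"
    unfolding remove_nth_def by simp
  then show ?thesis by (simp only: xs[symmetric])
qed

text \<open>The list of the indices \<open>2, \<dots>, p + 3\<close> without \<open>i\<close> and \<open>j\<close>, in increasing order.\<close>

definition omit2 :: "nat \<Rightarrow> nat \<Rightarrow> nat \<Rightarrow> nat list" where
  "omit2 p i j = filter (\<lambda>k. k \<noteq> i \<and> k \<noteq> j) [2..<p + 4]"

text \<open>The pairs of indices over which \<open>\<gamma>(W, t)\<close> is summed.\<close>

definition pairs :: "nat \<Rightarrow> (nat \<times> nat) set" where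
  "pairs p = {(i, j). 2 \<le> i \<and> i < j \<and> j \<le> p + 3}"

lemma finite_pairs: "finite (pairs p)"
  by (rule finite_subset[of _ "{..p + 3} \<times> {..p + 3}"]) (auto simp: pairs_def)

lemma set_omit2: "set (omit2 p i j) = {2..p + 3} - {i, j}"
  by (auto simp: omit2_def)

lemma distinct_omit2: "distinct (omit2 p i j)"
  by (simp add: omit2_def)

lemma sorted_omit2: "sorted (omit2 p i j)"
  by (simp add: omit2_def sorted_wrt_filter)

lemma upt_split: "i \<le> j \<Longrightarrow> j \<le> k \<Longrightarrow> [i..<k] = [i..<j] @ [j..<k]"
  using upt_add_eq_append[of i j "k - j"] by simp

lemma length_omit2: "(i, j) \<in> pairs p \<Longrightarrow> length (omit2 p i j) = p"
  using distinct_card[OF distinct_omit2, of p i j] by (simp add: set_omit2 pairs_def card_Diff_subset)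

lemma omit2_append:
  assumes "(i, j) \<in> pairs p"
  shows "omit2 p i j = [2..<i] @ [Suc i..<j] @ [Suc j..<p + 4]"
proof -
  have "[2..<p + 4] = [2..<i] @ [i..<p + 4]"
    using assms upt_split[of 2 i "p + 4"] by (simp add: pairs_def)
  also have "[i..<p + 4] = i # [Suc i..<p + 4]" using assms by (intro upt_conv_Cons) (auto simp: pairs_def)
  also have "[Suc i..<p + 4] = [Suc i..<j] @ [j..<p + 4]"
    using assms upt_split[of "Suc i" j "p + 4"] by (simp add: pairs_def)
  also have "[j..<p + 4] = j # [Suc j..<p + 4]" using assms by (intro upt_conv_Cons) (auto simp: pairs_def)
  finally show ?thesis
    unfolding omit2_def using assms by (auto simp: pairs_def filter_id_conv)
qed

lemma nth_omit2:
  assumes "(i, j) \<in> pairs p" "m < p"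
  shows "omit2 p i j ! m = (if m < i - 2 then m + 2 else if m < j - 3 then m + 3 else m + 4)"
  using assms unfolding omit2_append[OF assms(1)] by (auto simp: nth_append pairs_def)

text \<open>The tensor with coefficients \<open>A i j\<close> in the basis of \<open>\<Lambda>\<^sup>p W\<close> given by a basis \<open>w 2, \<dots>, w (p + 3)\<close> of \<open>W\<close>. The
  signs are those of \<open>\<gamma>(W, t)\<close>.\<close>

definition normal_tensor :: "nat \<Rightarrow> (nat \<Rightarrow> 'v) \<Rightarrow> (nat \<Rightarrow> nat \<Rightarrow> 's) \<Rightarrow> ('v, 's) comb" where
  "normal_tensor p w A = (\<Sum>(i, j)\<in>pairs p. single (map w (omit2 p i j), A i j) ((-1) ^ (i + j)))"

lemma comb_sum_singles: "(\<Sum>k\<in>keys x. single k (lookup x k)) = x"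
proof (rule poly_mapping_eqI)
  fix k
  show "lookup (\<Sum>k\<in>keys x. single k (lookup x k)) k =
      lookup x k"
    by (simp add: lookup_sum lookup_single when_def in_keys_iff)
qed

text \<open>The elements \<open>y\<close> that have a normal form are a subspace \<open>Y\<close> that contains the relations. Hence it is
  enough to treat symbols whose vectors belong to the basis, and transpositions bring these into
  increasing order.\<close>

lemma tensor_normal_form:
  fixes V S :: "('i \<Rightarrow> 'q \<Rightarrow> complex ^ 'r::finite) set" and w :: "nat \<Rightarrow> ('i \<Rightarrow> 'q \<Rightarrow> complex ^ 'r)"
  assumes V: "sect.subspace V" and S: "sect.subspace S"
    and w: "w ` {2..p + 3} \<subseteq> V"
    and x: "x \<in> formal p (sect.span (w ` {2..p + 3})) S"
  shows "\<exists>A. (\<forall>i j. A i j \<in> S) \<and> x - normal_tensor p w A \<in> relations sect_scale sect_scale p V S"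
proof -
  define I where "I = {2..p + 3}"
  define N where "N = relations sect_scale sect_scale p V S"
  have N: "comb.subspace N" unfolding N_def by (rule subspace_relations)
  define Y where "Y = {y. \<exists>A. (\<forall>i j. A i j \<in> S) \<and> y - normal_tensor p w A \<in> N}"
  have tup: "map w (omit2 p i j) \<in> tuples p V" if "(i, j) \<in> pairs p" for i j
    using w that by (auto simp: tuples_def length_omit2 set_omit2)
  have S0: "0 \<in> S" and Sadd: "\<And>a b. a \<in> S \<Longrightarrow> b \<in> S \<Longrightarrow> a + b \<in> S"
    and Sscale: "\<And>c a. a \<in> S \<Longrightarrow> sect_scale c a \<in> S"
    using S by (auto simp: sect.subspace_def)
  have Vadd: "\<And>a b. a \<in> V \<Longrightarrow> b \<in> V \<Longrightarrow> a + b \<in> V"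
    using V by (auto simp: sect.subspace_def)
  have N0: "single (vs, 0) c \<in> N" if "vs \<in> tuples p V" for vs c
    using single_scale_relation[OF that S0, where scS = sect_scale and b = 0 and c = c and scV = sect_scale] by (simp add: N_def)
  have NY: "N \<subseteq> Y"
  proof
    fix y assume y: "y \<in> N"
    have "normal_tensor p w (\<lambda>_ _. 0) \<in> N"
      unfolding normal_tensor_def by (rule comb.subspace_sum[OF N]) (use N0 tup in auto)
    then have "y - normal_tensor p w (\<lambda>_ _. 0) \<in> N" by (rule comb.subspace_diff[OF N y])
    then show "y \<in> Y" unfolding Y_def mem_Collect_eq using S0 by (intro exI[of _ "\<lambda>_ _. 0"]) simp
  qed
  have Y: "comb.subspace Y"
    unfolding comb.subspace_def
  proof (intro conjI ballI allI)
    show "0 \<in> Y" using NY comb.subspace_0[OF N] by blast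
    fix y assume "y \<in> Y"
    then obtain A where A: "\<And>i j. A i j \<in> S" "y - normal_tensor p w A \<in> N" unfolding Y_def by blast
    {
      fix y' assume "y' \<in> Y"
      then obtain A' where A': "\<And>i j. A' i j \<in> S" "y' - normal_tensor p w A' \<in> N" unfolding Y_def by blast
      define B where "B = (\<lambda>i j. A i j + A' i j)"
      have "(\<Sum>(i, j)\<in>pairs p. single (map w (omit2 p i j), A i j + A' i j) ((-1) ^ (i + j)) -
          single (map w (omit2 p i j), A i j) ((-1) ^ (i + j)) -
          single (map w (omit2 p i j), A' i j) ((-1) ^ (i + j))) \<in> N"
      proof (rule comb.subspace_sum[OF N], clarify)
        fix i j assume "(i, j) \<in> pairs p"
        from single_add_relation[OF tup[OF this] A(1) A'(1), where scV = sect_scale and scS = sect_scale]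
        show "single (map w (omit2 p i j), A i j + A' i j) ((-1) ^ (i + j)) -
          single (map w (omit2 p i j), A i j) ((-1) ^ (i + j)) -
          single (map w (omit2 p i j), A' i j) ((-1) ^ (i + j)) \<in> N"
          unfolding N_def .
      qed
      then have n: "normal_tensor p w B - normal_tensor p w A - normal_tensor p w A' \<in> N"
        by (simp add: normal_tensor_def B_def case_prod_beta sum_subtractf)
      have "(y - normal_tensor p w A) + (y' - normal_tensor p w A') -
          (normal_tensor p w B - normal_tensor p w A - normal_tensor p w A') \<in> N"
        by (intro comb.subspace_diff[OF N] comb.subspace_add[OF N] A A' n)
      then have "y + y' - normal_tensor p w B \<in> N" by (simp add: algebra_simps)
      moreover have "\<forall>i j. B i j \<in> S" using A A' Sadd by (simp add: B_def)
      ultimately show "y + y' \<in> Y" unfolding Y_def by blast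
    }
    fix c
    define B where "B = (\<lambda>i j. sect_scale c (A i j))"
    have "(\<Sum>(i, j)\<in>pairs p. single (map w (omit2 p i j), sect_scale c (A i j)) ((-1) ^ (i + j)) -
        comb_scale c (single (map w (omit2 p i j), A i j) ((-1) ^ (i + j)))) \<in> N"
    proof (rule comb.subspace_sum[OF N], clarify)
      fix i j assume "(i, j) \<in> pairs p"
      from single_scale_relation[OF tup[OF this] A(1), where scS = sect_scale and b = c and c = "(-1) ^ (i + j)" and scV = sect_scale]
      show "single (map w (omit2 p i j), sect_scale c (A i j)) ((-1) ^ (i + j)) -
        comb_scale c (single (map w (omit2 p i j), A i j) ((-1) ^ (i + j))) \<in> N"
        unfolding N_def by (simp add: mult.commute)
    qed
    then have n: "normal_tensor p w B - comb_scale c (normal_tensor p w A) \<in> N"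
      by (simp add: normal_tensor_def B_def case_prod_beta sum_subtractf comb.scale_sum_right)
    have "comb_scale c (y - normal_tensor p w A) -
        (normal_tensor p w B - comb_scale c (normal_tensor p w A)) \<in> N"
      by (intro comb.subspace_diff[OF N] comb.subspace_scale[OF N] A n)
    then have "comb_scale c y - normal_tensor p w B \<in> N" by (simp add: comb.scale_right_diff_distrib)
    moreover have "\<forall>i j. B i j \<in> S" using A Sscale by (simp add: B_def)
    ultimately show "comb_scale c y \<in> Y" unfolding Y_def by blast
  qed
  have base: "single (map w ks, s) 1 \<in> Y" if ks: "ks \<in> tuples p I" and s: "s \<in> S" for ks s
  proof -
    have multi: "comb_target.multi_alt sect_scale N p V (\<lambda>vs. single (vs, s) 1)"
      unfolding N_def by (rule multi_alt_single[OF s])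
    have wt: "map w ks' \<in> tuples p V" if "ks' \<in> tuples p I" for ks'
      using that w by (auto simp: tuples_def I_def)
    show ?thesis
    proof (cases "distinct ks")
      case False
      then obtain i j where ij: "i < j" "j < length ks" "ks ! i = ks ! j"
        by (auto simp: distinct_conv_nth) (metis nat_neq_iff)
      have "single (map w ks, s) 1 \<in> N"
        by (rule comb_target.multi_alt_equal[OF N multi Vadd wt[OF ks] ij(1)])
           (use ij ks in \<open>auto simp: tuples_def\<close>)
      then show ?thesis using NY by blast
    next
      case True
      define Q where "Q ks \<longleftrightarrow> (ks \<in> tuples p I \<longrightarrow> single (map w ks, s) 1 \<in> Y)" for ks
      have "Q ks"
      proof (rule transpositions_suffice[of Q])
        fix xs a b ys assume Qba: "Q (xs @ b # a # ys)"
        show "Q (xs @ a # b # ys)"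
          unfolding Q_def
        proof
          assume t: "xs @ a # b # ys \<in> tuples p I"
          then have t': "xs @ b # a # ys \<in> tuples p I" by (auto simp: tuples_def)
          let ?vs = "map w (xs @ b # a # ys)" and ?i = "length xs"
          have "?vs[?i := ?vs ! Suc ?i, Suc ?i := ?vs ! ?i] = map w (xs @ a # b # ys)"
            by (simp add: nth_append list_update_append)
          moreover have "Suc ?i < p" using t by (auto simp: tuples_def)
          ultimately have n: "single (map w (xs @ a # b # ys), s) 1 +
              single (map w (xs @ b # a # ys), s) 1 \<in> N"
            using comb_target.multi_alt_swap[OF N multi Vadd wt[OF t'], of ?i] by simp
          have "single (map w (xs @ b # a # ys), s) 1 \<in> Y"
            using Qba t' unfolding Q_def by blast
          from comb.subspace_diff[OF Y subsetD[OF NY n] this]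
          show "single (map w (xs @ a # b # ys), s) 1 \<in> Y" by simp
        qed
      next
        show "mset ks = mset (sort ks)" by simp
        show "Q (sort ks)"
          unfolding Q_def
        proof
          have len: "length ks = p" "set ks \<subseteq> I" using ks by (auto simp: tuples_def)
          have "card (I - set ks) = 2"
            using len distinct_card[OF True] by (subst card_Diff_subset) (auto simp: I_def)
          then obtain i j where ij0: "I - set ks = {i, j}" "i \<noteq> j" by (auto simp: card_2_iff)
          then obtain i j where ij: "I - set ks = {i, j}" "i < j"
            by (metis insert_commute nat_neq_iff)
          have P: "(i, j) \<in> pairs p" using ij by (auto simp: pairs_def I_def)
          have "set ks = I - {i, j}" using ij(1) len(2) by blast
          then have "sort ks = omit2 p i j"
            by (intro sorted_distinct_set_unique) (auto simp: True set_omit2 I_def distinct_omit2 sorted_omit2)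
          (* The sign of the pair (i, j) in the normal form is compensated here. *)
          define A where "A = (\<lambda>i' j'. if (i', j') = (i, j) then sect_scale ((-1) ^ (i + j)) s else 0)"
          have AS: "\<forall>i j. A i j \<in> S" using s S0 Sscale by (simp add: A_def)
          have r1: "(\<Sum>(i', j')\<in>pairs p - {(i, j)}. single (map w (omit2 p i' j'), A i' j') ((-1) ^ (i' + j'))) \<in> N"
          proof (rule comb.subspace_sum[OF N])
            fix q assume q: "q \<in> pairs p - {(i, j)}"
            obtain i' j' where ij': "q = (i', j')" by (cases q)
            then show "(case q of (i', j') \<Rightarrow>
                single (map w (omit2 p i' j'), A i' j') ((-1) ^ (i' + j'))) \<in> N"
              using q N0[OF tup] by (auto simp: A_def)
          qed
          have r2: "normal_tensor p w A =
              single (map w (omit2 p i j), sect_scale ((-1) ^ (i + j)) s) ((-1) ^ (i + j)) +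
              (\<Sum>(i', j')\<in>pairs p - {(i, j)}. single (map w (omit2 p i' j'), A i' j') ((-1) ^ (i' + j')))"
            unfolding normal_tensor_def by (subst sum.remove[OF finite_pairs P]) (simp add: A_def)
          have r3: "single (map w (omit2 p i j), sect_scale ((-1) ^ (i + j)) s) ((-1) ^ (i + j)) -
              single (map w (omit2 p i j), s) 1 \<in> N"
            using single_scale_relation[OF tup[OF P] s, where scS = sect_scale and b = "(-1) ^ (i + j)" and c = "(-1) ^ (i + j)" and scV = sect_scale]
            by (simp add: N_def flip: power_add mult_2)
          have "normal_tensor p w A - single (map w (omit2 p i j), s) 1 \<in> N"
            using comb.subspace_add[OF N r3 r1] unfolding r2 by (simp only: diff_add_eq)
          then have "- (normal_tensor p w A - single (map w (omit2 p i j), s) 1) \<in> N"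
            by (rule comb.subspace_neg[OF N])
          then have "single (map w (omit2 p i j), s) 1 - normal_tensor p w A \<in> N" by simp
          then show "single (map w (sort ks), s) 1 \<in> Y"
            unfolding Y_def \<open>sort ks = omit2 p i j\<close> using AS by blast
        qed
      qed
      then show ?thesis using ks unfolding Q_def by blast
    qed
  qed
  have WV: "sect.span (w ` I) \<subseteq> V" using w V by (intro sect.span_minimal) (auto simp: I_def)
  have slots: "single (us @ map w ks, s) 1 \<in> Y"
    if "us \<in> tuples k (sect.span (w ` I))" "ks \<in> tuples (p - k) I" "k \<le> p" "s \<in> S" for us ks k s
    using that
  proof (induction k arbitrary: us ks)
    case 0
    then show ?case using base by (simp add: tuples_def)
  next
    case (Suc k)
    obtain us' u where us: "us = us' @ [u]" "us' \<in> tuples k (sect.span (w ` I))" "u \<in> sect.span (w ` I)"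
      using Suc.prems(1) by (cases us rule: rev_cases) (auto simp: tuples_def)
    have multi: "comb_target.multi_alt sect_scale Y p V (\<lambda>vs. single (vs, s) 1)"
      using comb_target.multi_alt_mono[OF multi_alt_single[OF Suc.prems(4)]] NY unfolding N_def by blast
    have "w ` set ks \<subseteq> w ` I"
      using Suc.prems(2) by (intro image_mono) (simp add: tuples_def)
    then have "w ` set ks \<subseteq> V" using w unfolding I_def by (rule subset_trans)
    then have tp: "us' @ v # map w ks \<in> tuples p V" if "v \<in> V" for v
      using us(2) Suc.prems WV that by (auto simp: tuples_def)
    have lu: "length us' = k" using us(2) by (simp add: tuples_def)
    have upd: "(us' @ v # map w ks)[k := v'] = us' @ v' # map w ks" for v v'
      using lu by (simp add: list_update_append)
    define Z where "Z = {v \<in> V. single (us' @ v # map w ks, s) 1 \<in> Y}"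
    have V0: "0 \<in> V" using V by (simp add: sect.subspace_def)
    have add: "single (us' @ (a + b) # map w ks, s) 1 - single (us' @ a # map w ks, s) 1 -
        single (us' @ b # map w ks, s) 1 \<in> Y" if "a \<in> V" "b \<in> V" for a b
      using comb_target.multi_altD(1)[OF multi tp[OF V0], of k a b] that Suc.prems(3) unfolding upd by simp
    have scale: "single (us' @ sect_scale c a # map w ks, s) 1 -
        comb_scale c (single (us' @ a # map w ks, s) 1) \<in> Y" if "a \<in> V" for a c
      using comb_target.multi_altD(2)[OF multi tp[OF V0], of k a c] that Suc.prems(3) unfolding upd by simp
    have "sect.subspace Z"
      unfolding sect.subspace_def
    proof (intro conjI ballI allI)
      show "0 \<in> Z"
        using scale[OF V0, of 0] V0 by (simp add: Z_def)
      fix a assume a: "a \<in> Z"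
      show "a + b \<in> Z" if b: "b \<in> Z" for b
      proof -
        have ab: "a \<in> V" "b \<in> V" using a b by (auto simp: Z_def)
        have "(single (us' @ (a + b) # map w ks, s) 1 - single (us' @ a # map w ks, s) 1 -
            single (us' @ b # map w ks, s) 1) + single (us' @ a # map w ks, s) 1 +
            single (us' @ b # map w ks, s) 1 \<in> Y"
          by (intro comb.subspace_add[OF Y] add ab) (use a b in \<open>auto simp: Z_def\<close>)
        then show ?thesis using Vadd[OF ab] by (simp add: Z_def)
      qed
      fix c
      have aV: "a \<in> V" and aY: "single (us' @ a # map w ks, s) 1 \<in> Y" using a by (auto simp: Z_def)
      have "(single (us' @ sect_scale c a # map w ks, s) 1 -
          comb_scale c (single (us' @ a # map w ks, s) 1)) +
          comb_scale c (single (us' @ a # map w ks, s) 1) \<in> Y"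
        by (intro comb.subspace_add[OF Y] scale aV comb.subspace_scale[OF Y] aY)
      then show "sect_scale c a \<in> Z" using V aV by (simp add: Z_def sect.subspace_def)
    qed
    moreover have "w ` I \<subseteq> Z"
    proof
      fix v assume "v \<in> w ` I"
      then obtain i where i: "i \<in> I" "v = w i" by blast
      have "single (us' @ map w (i # ks), s) 1 \<in> Y"
        by (rule Suc.IH[OF us(2)]) (use i Suc.prems in \<open>auto simp: tuples_def\<close>)
      then show "v \<in> Z" using i w by (auto simp: Z_def I_def)
    qed
    ultimately have "sect.span (w ` I) \<subseteq> Z" by (intro sect.span_minimal)
    then show ?case using us(3) unfolding us(1) by (auto simp: Z_def)
  qed
  have "x \<in> Y"
  proof -
    have "single k (lookup x k) \<in> Y" if k: "k \<in> keys x" for k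
    proof -
      obtain vs s where vs: "k = (vs, s)" by (cases k)
      have "vs \<in> tuples p (sect.span (w ` I))" "s \<in> S"
        using x k vs by (auto simp: formal_def symbols_def tuples_def I_def)
      then have "single (vs, s) 1 \<in> Y"
        using slots[of vs p "[]" s] by (simp add: tuples_def)
      from comb.subspace_scale[OF Y this, of "lookup x k"] show ?thesis by (simp add: vs)
    qed
    then have "(\<Sum>k\<in>keys x. single k (lookup x k)) \<in> Y"
      by (intro comb.subspace_sum[OF Y])
    then show ?thesis by (simp add: comb_sum_singles)
  qed
  then show ?thesis unfolding Y_def N_def by blast
qed

section \<open>The relations satisfied by a Koszul cycle\<close>

lemma dual_functionals:
  fixes w :: "nat \<Rightarrow> ('i \<Rightarrow> 'q \<Rightarrow> complex ^ 'r::finite)"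
  assumes "inj_on w I" "sect.independent (w ` I)"
  shows "\<exists>f :: nat \<Rightarrow> ('i \<Rightarrow> 'q \<Rightarrow> complex ^ 'r) \<Rightarrow> complex.
    (\<forall>k a b. f k (a + b) = f k a + f k b) \<and> (\<forall>k c a. f k (sect_scale c a) = c * f k a) \<and>
    (\<forall>k\<in>I. \<forall>k'\<in>I. f k (w k') = (if k = k' then 1 else 0))"
proof -
  interpret L: vector_space_pair
    "sect_scale :: complex \<Rightarrow> ('i \<Rightarrow> 'q \<Rightarrow> complex ^ 'r) \<Rightarrow> ('i \<Rightarrow> 'q \<Rightarrow> complex ^ 'r)"
    "(*) :: complex \<Rightarrow> complex \<Rightarrow> complex" ..
  have "\<forall>k. \<exists>g. Vector_Spaces.linear sect_scale (*) g \<and> (\<forall>x\<in>w ` I. g x = (if x = w k then 1 else 0 :: complex))"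
    by (intro allI L.linear_independent_extend[OF assms(2)])
  from choice[OF this] obtain f where
    f: "\<forall>k. Vector_Spaces.linear sect_scale (*) (f k) \<and> (\<forall>x\<in>w ` I. f k x = (if x = w k then 1 else 0 :: complex))" ..
  show ?thesis
  proof (intro exI[of _ f] conjI allI ballI)
    fix k
    interpret fk: Vector_Spaces.linear sect_scale "(*)" "f k" using f by blast
    show "f k (a + b) = f k a + f k b" for a b by (rule fk.add)
    show "f k (sect_scale c a) = c * f k a" for c a by (rule fk.scale)
    fix k' assume "k \<in> I" "k' \<in> I"
    then show "f k (w k') = (if k = k' then 1 else 0)"
      using f assms(1) by (auto simp: inj_on_def)
  qed
qed

lemma subspace_formal: "comb.subspace (formal p V S)"
  unfolding comb.subspace_def formal_def
proof (safe)
  fix x y :: "('a, 'b) comb" and k assume "keys x \<subseteq> symbols p V S" "keys y \<subseteq> symbols p V S"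
    "k \<in> keys (x + y)"
  then show "k \<in> symbols p V S" using keys_add[of x y] by blast
next
  fix x :: "('a, 'b) comb" and c k
  assume "keys x \<subseteq> symbols p V S" "k \<in> keys (comb_scale c x)"
  then show "k \<in> symbols p V S" by (auto simp: in_keys_iff lookup_comb_scale)
qed simp

lemma normal_tensor_formal:
  assumes "w ` {2..p + 3} \<subseteq> V" "\<And>i j. (i, j) \<in> pairs p \<Longrightarrow> A i j \<in> S"
  shows "normal_tensor p w A \<in> formal p V S"
proof -
  have "single (map w (omit2 p i j), A i j) c \<in> formal p V S" if "(i, j) \<in> pairs p" for i j c
  proof -
    have "(map w (omit2 p i j), A i j) \<in> symbols p V S"
      using assms that by (auto simp: symbols_def length_omit2 set_omit2)
    then show ?thesis by (auto simp: formal_def)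
  qed
  then show ?thesis unfolding normal_tensor_def by (intro comb.subspace_sum[OF subspace_formal]) auto
qed

text \<open>The functional \<open>\<Phi>\<close> on \<open>\<Lambda>\<^sup>p\<^sup>-\<^sup>1 V \<otimes> T\<close> that is dual to the basis vector of \<open>\<Lambda>\<^sup>p\<^sup>-\<^sup>1 W\<close>
  omitting \<open>a\<close>, \<open>b\<close> and \<open>c\<close> picks three terms
  of the differential: those obtained by removing \<open>w c\<close>, \<open>w b\<close> or \<open>w a\<close> from the basis vectors omitting
  \<open>(a, b)\<close>, \<open>(a, c)\<close> or \<open>(b, c)\<close>.\<close>

lemma pluecker_from_cycle:
  fixes w :: "nat \<Rightarrow> ('i \<Rightarrow> 'q \<Rightarrow> complex ^ 'r::finite)"
    and \<mu> :: "('i \<Rightarrow> 'q \<Rightarrow> complex ^ 'r) \<Rightarrow> 's \<Rightarrow> ('i2 \<Rightarrow> 'q2 \<Rightarrow> complex ^ 'r2::finite)"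
  assumes V: "sect.subspace V" and w: "w ` {2..p + 3} \<subseteq> V"
    and ind: "inj_on w {2..p + 3}" "sect.independent (w ` {2..p + 3})"
    and A: "\<And>i j. (i, j) \<in> pairs p \<Longrightarrow> A i j \<in> S"
    and cyc: "koszul_diff \<mu> (normal_tensor p w A) \<in> relations sect_scale sect_scale (p - 1) V T"
    and p: "p \<ge> 1" and abc: "2 \<le> a" "a < b" "b < c" "c \<le> p + 3"
  shows "\<mu> (w a) (A b c) - \<mu> (w b) (A a c) + \<mu> (w c) (A a b) = 0"
proof -
  define I where "I = {2..p + 3}"
  obtain f :: "nat \<Rightarrow> ('i \<Rightarrow> 'q \<Rightarrow> complex ^ 'r) \<Rightarrow> complex" where
    fadd: "\<And>k a b. f k (a + b) = f k a + f k b" and fscale: "\<And>k c a. f k (sect_scale c a) = c * f k a" and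
    fw: "\<And>k k'. k \<in> I \<Longrightarrow> k' \<in> I \<Longrightarrow> f k (w k') = (if k = k' then 1 else 0)"
    using dual_functionals[OF ind] unfolding I_def by blast
  define ks where "ks = filter (\<lambda>k. k \<noteq> a \<and> k \<noteq> b \<and> k \<noteq> c) [2..<p + 4]"
  have dks: "distinct ks" by (simp add: ks_def)
  have sks: "set ks = I - {a, b, c}" by (auto simp: ks_def I_def)
  have lks: "length ks = p - 1"
  proof -
    have "card (I - {a, b, c}) = card I - card {a, b, c}"
      using abc by (intro card_Diff_subset) (auto simp: I_def)
    also have "card {a, b, c} = 3" using abc by simp
    finally show ?thesis using distinct_card[OF dks] p by (simp add: sks I_def)
  qed
  define fs where "fs = map f ks"
  define \<Phi> where "\<Phi> = sect_target.lin_ext (\<lambda>(vs, s :: 'i2 \<Rightarrow> 'q2 \<Rightarrow> complex ^ 'r2). sect_scale (contract fs vs) s)"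
  have Vadd: "\<And>a b. a \<in> V \<Longrightarrow> b \<in> V \<Longrightarrow> a + b \<in> V" and Vscale: "\<And>c a. a \<in> V \<Longrightarrow> sect_scale c a \<in> V"
    using V by (auto simp: sect.subspace_def)
  have con: "complex_target.multi_alt sect_scale {0} (p - 1) V (contract fs)"
  proof -
    have "complex_target.multi_alt sect_scale {0} (length fs) V (contract fs)"
      by (rule multi_alt_contract[OF Vadd Vscale]) (auto simp: fs_def fadd fscale)
    then show ?thesis by (simp add: fs_def lks)
  qed
  have \<Phi>0: "\<Phi> x \<in> {0}" if "x \<in> relations sect_scale sect_scale (p - 1) V T" for x
    unfolding \<Phi>_def
  proof (rule sect_target.lin_ext_relations[OF sect.subspace_single_0 Vadd _ _ _ that])
    fix s :: "'i2 \<Rightarrow> 'q2 \<Rightarrow> complex ^ 'r2"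
    show "sect_target.multi_alt sect_scale {0} (p - 1) V (\<lambda>vs. case (vs, s) of (vs, s) \<Rightarrow> sect_scale (contract fs vs) s)"
      unfolding sect_target.multi_alt_def singleton_iff prod.case
    proof (intro conjI ballI allI impI)
      fix vs i a b assume "vs \<in> tuples (p - 1) V" "i < p - 1" "a \<in> V" "b \<in> V"
      then have "contract fs (vs[i := a + b]) = contract fs (vs[i := a]) + contract fs (vs[i := b])"
        using complex_target.multi_altD(1)[OF con, of vs i a b] by (simp add: diff_eq_eq add.commute)
      then show "sect_scale (contract fs (vs[i := a + b])) s - sect_scale (contract fs (vs[i := a])) s -
          sect_scale (contract fs (vs[i := b])) s = 0"
        by (simp add: sect.scale_left_distrib)
    next
      fix vs i a c assume "vs \<in> tuples (p - 1) V" "i < p - 1" "a \<in> V"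
      then have "contract fs (vs[i := sect_scale c a]) = c * contract fs (vs[i := a])"
        using complex_target.multi_altD(2)[OF con, of vs i a c] by simp
      then show "sect_scale (contract fs (vs[i := sect_scale c a])) s -
          sect_scale c (sect_scale (contract fs (vs[i := a])) s) = 0"
        by simp
    next
      fix vs i assume "vs \<in> tuples (p - 1) V" "Suc i < p - 1" "vs ! i = vs ! Suc i"
      then show "sect_scale (contract fs vs) s = 0"
        using complex_target.multi_altD(3)[OF con, of vs i] by simp
    qed
  qed (simp_all add: sect.scale_right_distrib mult.commute)
  define D where "D i j m = sect_scale ((-1) ^ (i + j) * (- ((-1) ^ m)) * contract fs (remove_nth m (map w (omit2 p i j))))
     (\<mu> (w (omit2 p i j ! m)) (A i j))" for i j m
  have fm: "normal_tensor p w A \<in> formal p V S" by (rule normal_tensor_formal[OF w]) (rule A)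
  have "koszul_diff \<mu> (normal_tensor p w A) = comb_target.lin_ext (koszul_term p \<mu>) (normal_tensor p w A)"
    by (rule koszul_diff_lin_ext[OF fm])
  also have "\<dots> = (\<Sum>(i, j)\<in>pairs p. comb_scale ((-1) ^ (i + j))
      (koszul_term p \<mu> (map w (omit2 p i j), A i j)))"
    unfolding normal_tensor_def
    by (simp add: comb_target.lin_ext_sum comb_target.lin_ext_single case_prod_beta)
  finally have kd: "koszul_diff \<mu> (normal_tensor p w A) = (\<Sum>(i, j)\<in>pairs p. comb_scale ((-1) ^ (i + j))
      (koszul_term p \<mu> (map w (omit2 p i j), A i j)))" .
  have "\<Phi> (koszul_diff \<mu> (normal_tensor p w A)) = (\<Sum>(i, j)\<in>pairs p. sect_scale ((-1) ^ (i + j))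
      (\<Sum>m<p. \<Phi> (single (remove_nth m (map w (omit2 p i j)), \<mu> (map w (omit2 p i j) ! m) (A i j)) (- ((-1) ^ m)))))"
    unfolding \<Phi>_def kd koszul_term_def prod.case
    by (simp add: sect_target.lin_ext_sum sect_target.lin_ext_comb_scale case_prod_beta)
  also have "\<dots> = (\<Sum>(i, j)\<in>pairs p. \<Sum>m<p. D i j m)"
  proof (rule sum.cong[OF refl], clarify)
    fix i j assume P: "(i, j) \<in> pairs p"
    show "sect_scale ((-1) ^ (i + j))
      (\<Sum>m<p. \<Phi> (single (remove_nth m (map w (omit2 p i j)), \<mu> (map w (omit2 p i j) ! m) (A i j)) (- ((-1) ^ m))))
       = (\<Sum>m<p. D i j m)"
      unfolding sect.scale_sum_right \<Phi>_def D_def sect_target.lin_ext_single prod.case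
      by (rule sum.cong[OF refl]) (simp add: length_omit2[OF P] mult.assoc)
  qed
  also have "\<dots> = (\<Sum>((i, j), m)\<in>pairs p \<times> {..<p}. D i j m)"
    by (simp add: sum.cartesian_product case_prod_beta)
  also have "\<dots> = (\<Sum>((i, j), m)\<in>{((a, b), c - 4), ((a, c), b - 3), ((b, c), a - 2)}. D i j m)"
  proof (rule sum.mono_neutral_right)
    show "finite (pairs p \<times> {..<p})" by (simp add: finite_pairs)
    show "{((a, b), c - 4), ((a, c), b - 3), ((b, c), a - 2)} \<subseteq> pairs p \<times> {..<p}"
      using abc by (auto simp: pairs_def)
    show "\<forall>q\<in>pairs p \<times> {..<p} - {((a, b), c - 4), ((a, c), b - 3), ((b, c), a - 2)}. (\<lambda>((i, j), m). D i j m) q = 0"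
    proof
      fix q assume q: "q \<in> pairs p \<times> {..<p} - {((a, b), c - 4), ((a, c), b - 3), ((b, c), a - 2)}"
      obtain i j m where ijm: "q = ((i, j), m)" by (metis surj_pair)
      have P: "(i, j) \<in> pairs p" and m: "m < p" and
        nq: "\<not> (i = a \<and> j = b \<and> m = c - 4)" "\<not> (i = a \<and> j = c \<and> m = b - 3)" "\<not> (i = b \<and> j = c \<and> m = a - 2)"
        using q by (auto simp: ijm)
      have ij: "2 \<le> i" "i < j" "j \<le> p + 3" using P by (auto simp: pairs_def)
      define k where "k = omit2 p i j ! m"
      have k: "k = (if m < i - 2 then m + 2 else if m < j - 3 then m + 3 else m + 4)"
        unfolding k_def by (rule nth_omit2[OF P m])
      have rm: "remove_nth m (map w (omit2 p i j)) = map w (remove_nth m (omit2 p i j))"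
        by (simp add: remove_nth_def take_map drop_map)
      have rset: "set (remove_nth m (omit2 p i j)) = I - {i, j, k}"
        using remove_nth_distinct[OF distinct_omit2, of m p i j] length_omit2[OF P] m
        by (auto simp: set_omit2 k_def I_def)
      have kI: "k \<in> I - {i, j}" using nth_mem[of m "omit2 p i j"] length_omit2[OF P] m
        by (simp add: set_omit2 k_def I_def)
      have n: "\<not> {i, j, k} \<subseteq> {a, b, c}"
      proof
        assume sub: "{i, j, k} \<subseteq> {a, b, c}"
        have kij: "k \<noteq> i" "k \<noteq> j" using kI by auto
        have "i = a \<and> j = b \<or> i = a \<and> j = c \<or> i = b \<and> j = c" using sub ij(2) abc by auto
        then consider "i = a" "j = b" "k = c" | "i = a" "j = c" "k = b" | "i = b" "j = c" "k = a"
          using sub kij by blast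
        then show False
        proof cases
          case 1
          then have "m = c - 4" using k abc by (simp split: if_splits)
          then show False using nq(1) 1 by blast
        next
          case 2
          then have "m = b - 3" using k abc by (simp split: if_splits)
          then show False using nq(2) 2 by blast
        next
          case 3
          then have "m = a - 2" using k abc by (simp split: if_splits)
          then show False using nq(3) 3 by blast
        qed
      qed
      have "\<not> {a, b, c} \<subseteq> {i, j, k}"
      proof -
        have "card {i, j, k} = 3" using ij kI by auto
        moreover have "card {a, b, c} = 3" using abc by simp
        ultimately show ?thesis using n card_subset_eq[of "{i, j, k}" "{a, b, c}"] by fastforce
      qed
      then obtain k' where k': "k' \<in> {a, b, c}" "k' \<notin> {i, j, k}" by blast
      have k'I: "k' \<in> I" using k'(1) abc by (auto simp: I_def)
      have "contract fs (map w (remove_nth m (omit2 p i j))) = 0"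
      proof (rule contract_zero)
        show "length (map w (remove_nth m (omit2 p i j))) = length fs"
          using m by (simp add: length_remove_nth length_omit2[OF P] fs_def lks)
        show "w k' \<in> set (map w (remove_nth m (omit2 p i j)))"
          using k' k'I rset by auto
        fix g assume "g \<in> set fs"
        then obtain k0 where k0: "k0 \<in> I - {a, b, c}" "g = f k0" unfolding fs_def using sks by auto
        then have "k0 \<noteq> k'" using k' by blast
        then show "g (w k') = 0" using fw[of k0 k'] k0 k'I by simp
      qed
      then show "(\<lambda>((i, j), m). D i j m) q = 0"
        by (simp add: ijm D_def rm)
    qed
  qed
  also have "\<dots> = D a b (c - 4) + (D a c (b - 3) + D b c (a - 2))"
    using abc by simp
  finally have sum0: "D a b (c - 4) + (D a c (b - 3) + D b c (a - 2)) = 0"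
    using \<Phi>0[OF cyc] by simp
  (* If the removed index k completes (i, j) to {a, b, c}, the functional takes the value 1. *)
  have val: "D i j m = sect_scale ((-1) ^ (i + j) * (- ((-1) ^ m))) (\<mu> (w k) (A i j))"
    if P: "(i, j) \<in> pairs p" and m: "m < p" and k: "omit2 p i j ! m = k" and set: "{i, j, k} = {a, b, c}" for i j m k
  proof -
    have "remove_nth m (omit2 p i j) = filter (\<lambda>l. l \<noteq> k) (omit2 p i j)"
      using remove_nth_distinct[OF distinct_omit2, of m p i j] length_omit2[OF P] m k by simp
    also have "\<dots> = filter (\<lambda>l. l \<notin> {i, j, k}) [2..<p + 4]"
      unfolding omit2_def filter_filter by (rule filter_cong) auto
    also have "\<dots> = ks" unfolding set ks_def by (rule filter_cong) auto
    finally have rm: "remove_nth m (omit2 p i j) = ks" .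
    have "remove_nth m (map w (omit2 p i j)) = map w (remove_nth m (omit2 p i j))"
      by (simp add: remove_nth_def take_map drop_map)
    then have "remove_nth m (map w (omit2 p i j)) = map w ks" unfolding rm .
    moreover have "contract fs (map w ks) = 1"
      unfolding fs_def by (rule contract_dual[OF dks]) (use fw sks in auto)
    ultimately show ?thesis by (simp add: D_def k)
  qed
  define e :: complex where "e = (-1) ^ (a + b + c)"
  have e0: "e \<noteq> 0" by (simp add: e_def)
  have s1: "(-1) ^ (a + b) * (- ((-1) ^ (c - 4))) = - e"
  proof -
    have "a + b + c = (a + b) + (c - 4) + 4" using abc by simp
    then have "e = (-1) ^ (a + b) * (-1) ^ (c - 4) * (-1) ^ 4" unfolding e_def by (metis power_add)
    then show ?thesis by simp
  qed
  have s2: "(-1) ^ (a + c) * (- ((-1) ^ (b - 3))) = e"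
  proof -
    have "a + b + c = (a + c) + (b - 3) + 3" using abc by simp
    then have "e = (-1) ^ (a + c) * (-1) ^ (b - 3) * (-1) ^ 3" unfolding e_def by (metis power_add)
    then show ?thesis by simp
  qed
  have s3: "(-1) ^ (b + c) * (- ((-1) ^ (a - 2))) = - e"
  proof -
    have "a + b + c = (b + c) + (a - 2) + 2" using abc by simp
    then have "e = (-1) ^ (b + c) * (-1) ^ (a - 2) * (-1) ^ 2" unfolding e_def by (metis power_add)
    then show ?thesis by simp
  qed
  have Pab: "(a, b) \<in> pairs p" "(a, c) \<in> pairs p" "(b, c) \<in> pairs p" using abc by (auto simp: pairs_def)
  have m: "c - 4 < p" "b - 3 < p" "a - 2 < p" using abc by auto
  have n1: "omit2 p a b ! (c - 4) = c" unfolding nth_omit2[OF Pab(1) m(1)] using abc by auto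
  have n2: "omit2 p a c ! (b - 3) = b" unfolding nth_omit2[OF Pab(2) m(2)] using abc by auto
  have n3: "omit2 p b c ! (a - 2) = a" unfolding nth_omit2[OF Pab(3) m(3)] using abc by auto
  have D1: "D a b (c - 4) = sect_scale (- e) (\<mu> (w c) (A a b))"
    using val[OF Pab(1) m(1) n1] unfolding s1 by simp
  have D2: "D a c (b - 3) = sect_scale e (\<mu> (w b) (A a c))"
    using val[OF Pab(2) m(2) n2] unfolding s2 by blast
  have D3: "D b c (a - 2) = sect_scale (- e) (\<mu> (w a) (A b c))"
    using val[OF Pab(3) m(3) n3] unfolding s3 by blast
  have "sect_scale (- e) (\<mu> (w a) (A b c) - \<mu> (w b) (A a c) + \<mu> (w c) (A a b)) = 0"
    using sum0 unfolding D1 D2 D3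
    by (simp add: sect.scale_right_distrib sect.scale_right_diff_distrib algebra_simps)
  then show ?thesis using e0 by (simp add: sect.scale_eq_0_iff)
qed

section \<open>Spaces of sections and Koszul classes\<close>

lemma (in closed_variety) H0_subspace:
  assumes E: "vector_bundle X E"
  shows "sect.subspace (H0 X E)"
  unfolding sect.subspace_def
proof (intro conjI ballI allI)
  have reg: "regular_on X (patch E i) f \<longleftrightarrow> (\<forall>l\<in>patch E i. reg_at X l f)" if "i \<in> indices E" for i f
    by (rule regular_on_iff[OF vector_bundle_D(1)[OF E that]])
  show "0 \<in> H0 X E"
    unfolding H0_def using reg by (auto intro: reg_at_const)
  fix s assume s: "s \<in> H0 X E"
  show "s + s' \<in> H0 X E" if s': "s' \<in> H0 X E" for s'
    unfolding H0_def
  proof (intro CollectI conjI ballI allI impI)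
    show "regular_on X (patch E i) (\<lambda>x. (s + s') i x $ a)" if "i \<in> indices E" for i a
      using H0_D(1)[OF s that, of a] H0_D(1)[OF s' that, of a]
      by (auto simp: reg[OF that] intro: reg_at_add)
    show "(s + s') i x = trans E i j x *v (s + s') j x"
      if "i \<in> indices E" "j \<in> indices E" "x \<in> patch E i \<inter> patch E j" for i j x
      using H0_D(2)[OF s that(1,2), of x] H0_D(2)[OF s' that(1,2), of x] that(3)
      by (simp add: matrix_vector_right_distrib)
    show "(s + s') i x = 0" if "\<not> (i \<in> indices E \<and> x \<in> patch E i)" for i x
      using H0_D(3)[OF s that] H0_D(3)[OF s' that] by simp
  qed
  show "sect_scale c s \<in> H0 X E" for c
    unfolding H0_def
  proof (intro CollectI conjI ballI allI impI)
    show "regular_on X (patch E i) (\<lambda>x. sect_scale c s i x $ a)" if "i \<in> indices E" for i a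
      using H0_D(1)[OF s that, of a] by (auto simp: reg[OF that] sect_scale_def intro: reg_at_mult reg_at_const)
    show "sect_scale c s i x = trans E i j x *v sect_scale c s j x"
      if "i \<in> indices E" "j \<in> indices E" "x \<in> patch E i \<inter> patch E j" for i j x
      using H0_D(2)[OF s that(1,2), of x] that(3) by (simp add: sect_scale_def vector_scalar_commute)
    show "sect_scale c s i x = 0" if "\<not> (i \<in> indices E \<and> x \<in> patch E i)" for i x
      using H0_D(3)[OF s that] by (simp add: sect_scale_def)
  qed
qed

lemma (in closed_variety) sect_mult_H0:
  assumes L: "line_bundle X L" and v: "v \<in> H0 X L" and s: "s \<in> H0 X L"
  shows "sect_mult v s \<in> H0 X (tensor_square L)"
  unfolding H0_def
proof (intro CollectI conjI ballI allI impI)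
  have reg: "regular_on X (patch L i) f \<longleftrightarrow> (\<forall>l\<in>patch L i. reg_at X l f)" if "i \<in> indices L" for i f
    by (rule regular_on_iff[OF vector_bundle_D(1)[OF L that]])
  have sel: "indices (tensor_square L) = indices L" "patch (tensor_square L) = patch L"
    "trans (tensor_square L) = (\<lambda>i j x. trans L i j x ** trans L i j x)" by (simp_all add: tensor_square_def)
  show "regular_on X (patch (tensor_square L) i) (\<lambda>x. sect_mult v s i x $ a)" if "i \<in> indices (tensor_square L)" for i a
  proof -
    have i: "i \<in> indices L" using that sel by simp
    show ?thesis using H0_D(1)[OF v i, of a] H0_D(1)[OF s i, of a]
      by (auto simp: sel reg[OF i] sect_mult_def intro: reg_at_mult)
  qed
  show "sect_mult v s i x = trans (tensor_square L) i j x *v sect_mult v s j x"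
    if "i \<in> indices (tensor_square L)" "j \<in> indices (tensor_square L)"
      "x \<in> patch (tensor_square L) i \<inter> patch (tensor_square L) j" for i j x
  proof -
    have ij: "i \<in> indices L" "j \<in> indices L" "x \<in> patch L i" "x \<in> patch L j" using that sel by auto
    have "v i x $ 1 = trans L i j x $ 1 $ 1 * v j x $ 1" "s i x $ 1 = trans L i j x $ 1 $ 1 * s j x $ 1"
      using H0_D(2)[OF v ij] H0_D(2)[OF s ij] by (simp_all add: matrix_vector_1)
    then show ?thesis
      by (simp add: vec1_eq_iff matrix_vector_1 sel sect_mult_def matrix_matrix_mult_def)
  qed
  show "sect_mult v s i x = 0" if "\<not> (i \<in> indices (tensor_square L) \<and> x \<in> patch (tensor_square L) i)" for i x
    using H0_D(3)[OF v, of i x] that by (simp add: sel sect_mult_def vec_eq_iff)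
qed

lemma sect_mult_bilinear:
  "sect_mult (v + v') s = sect_mult v s + sect_mult v' s"
  "sect_mult (sect_scale c v) s = sect_scale c (sect_mult v s)"
  "sect_mult v (s + s') = sect_mult v s + sect_mult v s'"
  "sect_mult v (sect_scale c s) = sect_scale c (sect_mult v s)"
  by (auto simp: sect_mult_def sect_scale_def fun_eq_iff vec_eq_iff algebra_simps)

text \<open>The choice of \<open>j\<close> is the one made in \<open>apply_iso\<close>.\<close>

lemma det_map_component:
  "det_map E L \<phi> t u i x $ 1 = (if i \<in> indices L \<and> x \<in> patch L i
     then (let j = SOME j. j \<in> indices E \<and> x \<in> patch E j
       in \<phi> i j x $ 1 $ 1 * (t j x $ 1 * u j x $ 2 - t j x $ 2 * u j x $ 1)) else 0)"
  by (simp add: det_map_def apply_iso_def det_bundle_def Let_def matrix_vector_1 det_2)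

lemma det_map_add: "det_map E L \<phi> t (u + u') = det_map E L \<phi> t u + det_map E L \<phi> t u'"
proof (intro ext)
  fix i x
  have "det_map E L \<phi> t (u + u') i x $ 1 = det_map E L \<phi> t u i x $ 1 + det_map E L \<phi> t u' i x $ 1"
    unfolding det_map_component Let_def
    by (cases "i \<in> indices L \<and> x \<in> patch L i") (auto simp: algebra_simps)
  then show "det_map E L \<phi> t (u + u') i x = (det_map E L \<phi> t u + det_map E L \<phi> t u') i x"
    by (simp add: vec1_eq_iff)
qed

lemma det_map_scale: "det_map E L \<phi> t (sect_scale c u) = sect_scale c (det_map E L \<phi> t u)"
proof (intro ext)
  fix i x
  have "det_map E L \<phi> t (sect_scale c u) i x $ 1 = c * det_map E L \<phi> t u i x $ 1"
    unfolding det_map_component Let_def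
    by (cases "i \<in> indices L \<and> x \<in> patch L i") (auto simp: sect_scale_def algebra_simps)
  then show "det_map E L \<phi> t (sect_scale c u) i x = sect_scale c (det_map E L \<phi> t u) i x"
    by (simp add: vec1_eq_iff sect_scale_def)
qed

lemma det_map_linear: "Vector_Spaces.linear sect_scale sect_scale (det_map E L \<phi> t)"
  by unfold_locales (fact det_map_add, fact det_map_scale)

lemma independent_of_image:
  fixes D :: "('i \<Rightarrow> 'p \<Rightarrow> complex ^ 'r::finite) \<Rightarrow> ('j \<Rightarrow> 'q \<Rightarrow> complex ^ 's::finite)"
  assumes D: "Vector_Spaces.linear sect_scale sect_scale D" and S: "finite S" "inj_on D S"
    and ind: "sect.independent (D ` S)"
  shows "sect.independent S"
proof
  interpret D: Vector_Spaces.linear sect_scale sect_scale D by (rule D)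
  assume "sect.dependent S"
  then obtain u v where u: "v \<in> S" "u v \<noteq> 0" "(\<Sum>v\<in>S. sect_scale (u v) v) = 0"
    unfolding sect.dependent_finite[OF S(1)] by blast
  have "0 = D (\<Sum>v\<in>S. sect_scale (u v) v)" by (simp add: u(3) D.zero)
  also have "\<dots> = (\<Sum>v\<in>S. sect_scale (u v) (D v))" by (simp add: D.sum D.scale)
  also have "\<dots> = (\<Sum>y\<in>D ` S. sect_scale (u (the_inv_into S D y)) y)"
    by (subst sum.reindex[OF S(2)]) (simp add: the_inv_into_f_f[OF S(2)])
  finally have 1: "(\<Sum>y\<in>D ` S. sect_scale (u (the_inv_into S D y)) y) = 0" by (rule sym)
  have 2: "u (the_inv_into S D (D v)) \<noteq> 0" using u(1,2) by (simp add: the_inv_into_f_f[OF S(2)])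
  have "sect.dependent (D ` S)"
    unfolding sect.dependent_finite[OF finite_imageI[OF S(1)]]
    by (intro exI[of _ "\<lambda>y. u (the_inv_into S D y)"] conjI bexI[of _ "D v"] 1 2 imageI u(1))
  then show False using ind by (rule notE[rotated])
qed

lemma koszul_class_cong:
  assumes x: "x \<in> formal p (H0 X L) (H0 X L)" and y: "y \<in> formal p (H0 X L) (H0 X L)"
    and xy: "x - y \<in> relations sect_scale sect_scale p (H0 X L) (H0 X L)"
  shows "koszul_class X L p x = koszul_class X L p y"
proof -
  let ?R = "relations sect_scale sect_scale p (H0 X L) (H0 X L)"
  have *: "koszul_class X L p x \<subseteq> koszul_class X L p y"
    if y: "y \<in> formal p (H0 X L) (H0 X L)" and xy: "x - y \<in> ?R" for x y
  proof
    fix z assume z: "z \<in> koszul_class X L p x"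
    then have zf: "z \<in> formal p (H0 X L) (H0 X L)" and "z - x \<in> koszul_boundaries X L p"
      by (simp_all add: koszul_class_def)
    then obtain v where v: "v \<in> formal (p + 1) (H0 X L) UNIV"
      "z - x - koszul_diff (\<lambda>v c. sect_scale c v) v \<in> ?R"
      unfolding koszul_boundaries_def by blast
    have "(z - x - koszul_diff (\<lambda>v c. sect_scale c v) v) + (x - y) \<in> ?R"
      by (rule comb.subspace_add[OF subspace_relations v(2) xy])
    moreover have "(z - x - koszul_diff (\<lambda>v c. sect_scale c v) v) + (x - y) =
        z - y - koszul_diff (\<lambda>v c. sect_scale c v) v" by simp
    ultimately have 1: "z - y - koszul_diff (\<lambda>v c. sect_scale c v) v \<in> ?R" by simp
    have 2: "z - y \<in> formal p (H0 X L) (H0 X L)" by (rule comb.subspace_diff[OF subspace_formal zf y])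
    have "z - y \<in> koszul_boundaries X L p"
      unfolding koszul_boundaries_def by (intro CollectI conjI bexI[of _ v]) (rule 1 2 v(1))+
    then show "z \<in> koszul_class X L p y" by (simp add: koszul_class_def zf)
  qed
  have yx: "y - x \<in> ?R" using comb.subspace_neg[OF subspace_relations xy] by simp
  show ?thesis by (rule subset_antisym[OF *[OF y xy] *[OF x yx]])
qed

lemma (in closed_variety) koszul_cycles_cong:
  assumes L: "line_bundle X L" and x: "x \<in> koszul_cycles X L p" and y: "y \<in> formal p (H0 X L) (H0 X L)"
    and xy: "x - y \<in> relations sect_scale sect_scale p (H0 X L) (H0 X L)"
  shows "y \<in> koszul_cycles X L p"
proof -
  let ?V = "H0 X L" and ?T = "H0 X (tensor_square L)"
  note V = H0_subspace[OF L]
  have xf: "x \<in> formal p ?V ?V" and xc: "koszul_diff sect_mult x \<in> relations sect_scale sect_scale (p - 1) ?V ?T"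
    using x by (simp_all add: koszul_cycles_def)
  have df: "x - y \<in> formal p ?V ?V" by (rule comb.subspace_diff[OF subspace_formal xf y])
  have d: "koszul_diff sect_mult (x - y) \<in> relations sect_scale sect_scale (p - 1) ?V ?T"
  proof (rule koszul_diff_relations[OF _ _ _ _ _ _ _ xy df])
    show "a + b \<in> ?V" if "a \<in> ?V" "b \<in> ?V" for a b using that V by (simp add: sect.subspace_def)
    show "sect_scale c a \<in> ?V" if "a \<in> ?V" for c a using that V by (simp add: sect.subspace_def)
    show "sect_mult v s \<in> ?T" if "v \<in> ?V" "s \<in> ?V" for v s by (rule sect_mult_H0[OF L that])
  qed (rule sect_mult_bilinear)+
  have "koszul_diff sect_mult y = koszul_diff sect_mult x - koszul_diff sect_mult (x - y)"
    unfolding koszul_diff_lin_ext[OF xf] koszul_diff_lin_ext[OF y] koszul_diff_lin_ext[OF df]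
    by (simp add: comb_target.lin_ext_diff)
  then have "koszul_diff sect_mult y \<in> relations sect_scale sect_scale (p - 1) ?V ?T"
    using comb.subspace_diff[OF subspace_relations xc d] by simp
  then show ?thesis using y by (simp add: koszul_cycles_def)
qed

text \<open>An identity between local regular functions may be checked where a nonzero section \<open>w\<close> does not
  vanish.\<close>

lemma (in smooth_curve) vanishes_if_product_vanishes:
  fixes L :: "('n, 'i, 1) vbundle"
  assumes conn: "connected_space (ztop X)" and L: "line_bundle X L" and w: "w \<in> H0 X L" "w \<noteq> 0"
    and i: "i \<in> indices L" "x \<in> patch L i" and P: "reg_at X x P"
    and z: "\<And>y. y \<in> patch L i \<Longrightarrow> w i y $ 1 \<noteq> 0 \<Longrightarrow> P y = 0"
  shows "P x = 0"
proof (rule ccontr)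
  assume "P x \<noteq> 0"
  moreover have "x \<in> X" using i vector_bundle_D(2)[OF L] by blast
  ultimately have "\<forall>\<^sub>F y in near x. P y \<noteq> 0" using reg_at_inverse(2)[OF P] by blast
  then have "\<forall>\<^sub>F y in near x. w i y $ 1 = 0"
    using eventually_near_open[OF vector_bundle_D(1)[OF L i(1)] i(2)]
    by eventually_elim (use z in blast)
  then show False using nonzero_section_not_locally_zero[OF conn L w i] by blast
qed

section \<open>Koszul classes represented over a space of dimension \<open>p + 2\<close>\<close>

text \<open>The skew matrix with the coefficients \<open>A\<close> above the diagonal for indices at least \<open>2\<close>, and \<open>w\<close> as row
  of index \<open>1\<close>.\<close>

definition skew_extension :: "(nat \<Rightarrow> 'a::ab_group_add) \<Rightarrow> (nat \<Rightarrow> nat \<Rightarrow> 'a) \<Rightarrow> nat \<Rightarrow> nat \<Rightarrow> 'a" where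
  "skew_extension w A j k =
     (if j = k then 0 else if j = 1 then w k else if k = 1 then - w j
      else if j < k then A j k else - A k j)"

text \<open>The matrix is the wedge product of \<open>(0, w 2, w 3, \<dots>)\<close> and its row of index \<open>2\<close>, divided by \<open>w 2\<close>. Only the
  relations that involve \<open>w 2\<close> are needed.\<close>

lemma skew_extension_decomposable:
  fixes w :: "nat \<Rightarrow> complex"
  assumes w2: "w 2 \<noteq> 0"
    and rel: "\<And>b c. 2 < b \<Longrightarrow> b < c \<Longrightarrow> c \<le> n \<Longrightarrow> w 2 * A b c - w b * A 2 c + w c * A 2 b = 0"
    and jk: "j \<in> {1..n}" "k \<in> {1..n}"
  shows "w 2 * skew_extension w A j k =
    (if j = 1 then 0 else w j) * skew_extension w A 2 k - (if k = 1 then 0 else w k) * skew_extension w A 2 j"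
proof -
  have lt: "w 2 * skew_extension w A j k =
    (if j = 1 then 0 else w j) * skew_extension w A 2 k - (if k = 1 then 0 else w k) * skew_extension w A 2 j"
    if "j < k" "1 \<le> j" "k \<le> n" for j k
  proof -
    have "j = 1 \<and> k = 2 \<or> j = 1 \<and> k > 2 \<or> j = 2 \<or> j > 2" using that by arith
    then consider "j = 1" "k = 2" | "j = 1" "k > 2" | "j = 2" | "j > 2" by blast
    then show ?thesis
    proof cases
      case 4
      then have "w 2 * A j k = w j * A 2 k - w k * A 2 j" using rel[of j k] that by (simp add: algebra_simps)
      then show ?thesis using 4 that by (simp add: skew_extension_def)
    qed (use that in \<open>auto simp: skew_extension_def\<close>)
  qed
  have skew: "skew_extension w A k j = - skew_extension w A j k" for j k
    by (auto simp: skew_extension_def)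
  consider "j < k" | "j = k" | "k < j" by linarith
  then show ?thesis
  proof cases
    case 1
    then show ?thesis using lt jk by simp
  next
    case 2
    then show ?thesis by (simp add: skew_extension_def)
  next
    case 3
    then show ?thesis using lt[of k j] jk by (simp add: skew[of j k])
  qed
qed

lemma skew_extension_pluecker:
  fixes w :: "nat \<Rightarrow> complex"
  assumes w2: "w 2 \<noteq> 0"
    and rel: "\<And>b c. 2 < b \<Longrightarrow> b < c \<Longrightarrow> c \<le> n \<Longrightarrow> w 2 * A b c - w b * A 2 c + w c * A 2 b = 0"
    and I: "a \<in> {1..n}" "b \<in> {1..n}" "j \<in> {1..n}" "k \<in> {1..n}"
  shows "skew_extension w A a b * skew_extension w A j k =
    skew_extension w A a j * skew_extension w A b k - skew_extension w A a k * skew_extension w A b j"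
proof -
  let ?B = "skew_extension w A"
  define r s where "r j = (if j = 1 then 0 else w j)" and "s j = ?B 2 j / w 2" for j
  have B: "?B j k = r j * s k - r k * s j" if "j \<in> {1..n}" "k \<in> {1..n}" for j k
    using skew_extension_decomposable[where w = w and A = A and n = n, OF w2 rel that] w2 by (simp add: r_def s_def field_simps)
  show ?thesis unfolding B[OF I(1,2)] B[OF I(3,4)] B[OF I(1,3)] B[OF I(2,4)] B[OF I(1,4)] B[OF I(2,3)]
    by (simp add: algebra_simps)
qed

theorem theorem3p4:
  fixes X :: "'n::finite pt set"
    and L :: "('n, 'i, 1) vbundle"
    and p :: nat
    and W :: "('n, 'i, 1) sect set"
    and \<alpha> :: "(('n, 'i, 1) sect, ('n, 'i, 1) sect) comb set"
  assumes "smooth_projective_connected_curve X"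
    and "line_bundle X L"
    and "p \<ge> 1"
    and "\<alpha> \<in> K1 X L p"
    and "\<alpha> \<noteq> koszul_class X L p 0"
    and "koszul_rank X L p \<alpha> = p + 2"
    and "W \<subseteq> H0 X L" and "subspace_of_dim (p + 2) W"
    and "represented_over X L p W \<alpha>"
  shows "\<exists>(E :: ('n, 'n pt, 2) vbundle) \<phi> t U e.
    vector_bundle X E \<and>
    bundle_iso X (det_bundle E) L \<phi> \<and>
    t \<in> H0 X E \<and>
    W \<subseteq> det_map E L \<phi> t ` H0 X E \<and>
    admissible X E L \<phi> p W t U \<and>
    basis_2_to (p + 3) e U \<and>
    gamma E L \<phi> p t e \<in> koszul_cycles X L p \<and>
    \<alpha> = koszul_class X L p (gamma E L \<phi> p t e)"
proof -
  interpret smooth_curve X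
    using assms(1) by unfold_locales (auto simp: smooth_projective_connected_curve_def)
  have conn: "connected_space (ztop X)" using assms(1) by (simp add: smooth_projective_connected_curve_def)
  note L = assms(2)
  note V = H0_subspace[OF L]
  obtain x where x: "x \<in> formal p W (H0 X L)" "x \<in> koszul_cycles X L p" "\<alpha> = koszul_class X L p x"
    using assms(9) unfolding represented_over_def by blast
  obtain B where B: "finite B" "card B = p + 2" "sect.independent B" "sect.span B = W"
    using assms(8) unfolding subspace_of_dim_def by blast
  define I where "I = {2..p + 3}"
  have "card I = card B" by (simp add: I_def B)
  then obtain w where "bij_betw w I B"
    using finite_same_card_bij[of I B] B(1) by (auto simp: I_def)
  then have w: "inj_on w I" "w ` I = B" by (auto simp: bij_betw_def)
  have wV: "w k \<in> H0 X L" if "k \<in> I" for k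
    using that w(2) B(4) assms(7) sect.span_superset[of B] by blast
  have wVI: "w ` {2..p + 3} \<subseteq> H0 X L" using wV by (auto simp: I_def)
  have "x \<in> formal p (sect.span (w ` {2..p + 3})) (H0 X L)"
    using x(1) B(4) w(2) by (simp add: I_def)
  from tensor_normal_form[OF V V wVI this]
  obtain A where AV: "\<And>i j. A i j \<in> H0 X L"
    and xA: "x - normal_tensor p w A \<in> relations sect_scale sect_scale p (H0 X L) (H0 X L)" by blast
  have nf: "normal_tensor p w A \<in> formal p (H0 X L) (H0 X L)"
    by (rule normal_tensor_formal[OF wVI]) (rule AV)
  have cyc: "normal_tensor p w A \<in> koszul_cycles X L p"
    by (rule koszul_cycles_cong[OF L x(2) nf xA])
  have cls: "\<alpha> = koszul_class X L p (normal_tensor p w A)"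
    using x(2) koszul_class_cong[OF _ nf xA] x(3) by (simp add: koszul_cycles_def)
  have ind: "inj_on w {2..p + 3}" "sect.independent (w ` {2..p + 3})"
    using w B(3) by (simp_all add: I_def)
  have rel: "w 2 i y $ 1 * A b c i y $ 1 - w b i y $ 1 * A 2 c i y $ 1 + w c i y $ 1 * A 2 b i y $ 1 = 0"
    if "2 < b" "b < c" "c \<le> p + 3" for b c i y
  proof -
    have kd: "koszul_diff sect_mult (normal_tensor p w A)
        \<in> relations sect_scale sect_scale (p - 1) (H0 X L) (H0 X (tensor_square L))"
      using cyc by (simp add: koszul_cycles_def)
    have "sect_mult (w 2) (A b c) - sect_mult (w b) (A 2 c) + sect_mult (w c) (A 2 b) = 0"
      by (rule pluecker_from_cycle[OF V wVI ind AV kd assms(3) order_refl that])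
    then have "(sect_mult (w 2) (A b c) - sect_mult (w b) (A 2 c) + sect_mult (w c) (A 2 b)) i y $ 1 = 0"
      by simp
    then show ?thesis by (simp add: sect_mult_def)
  qed
  define J where "J = {1..p + 3}"
  define Am where "Am = skew_extension w A"
  have AmV: "Am j k \<in> H0 X L" if "j \<in> J" "k \<in> J" for j k
    using that wV AV sect.subspace_neg[OF V] sect.subspace_0[OF V]
    by (auto simp: Am_def skew_extension_def I_def J_def)
  have Am_at: "Am j k i y $ 1 = skew_extension (\<lambda>k. w k i y $ 1) (\<lambda>j k. A j k i y $ 1) j k" for j k i y
    by (simp add: Am_def skew_extension_def)
  have w2: "w 2 \<in> H0 X L" "w 2 \<noteq> 0"
  proof -
    show "w 2 \<in> H0 X L" by (rule wV) (simp add: I_def)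
    have "w 2 \<in> B" using w(2) by (force simp: I_def)
    then show "w 2 \<noteq> 0" using B(3) sect.dependent_zero by metis
  qed
  have pl: "Am a b i y $ 1 * Am j k i y $ 1 = Am a j i y $ 1 * Am b k i y $ 1 - Am a k i y $ 1 * Am b j i y $ 1"
    if I: "a \<in> J" "b \<in> J" "j \<in> J" "k \<in> J" for a b j k i y
  proof (cases "i \<in> indices L \<and> y \<in> patch L i")
    case False
    have "Am j k i y = 0" if "j \<in> J" "k \<in> J" for j k by (rule H0_D(3)[OF AmV[OF that] False])
    then show ?thesis using I by simp
  next
    case True
    let ?P = "\<lambda>y. Am a b i y $ 1 * Am j k i y $ 1 - (Am a j i y $ 1 * Am b k i y $ 1 - Am a k i y $ 1 * Am b j i y $ 1)"
    have "?P y = 0"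
    proof (rule vanishes_if_product_vanishes[OF conn L w2])
      show "i \<in> indices L" "y \<in> patch L i" using True by auto
      then have r: "reg_at X y (\<lambda>y. Am j k i y $ 1)" if "j \<in> J" "k \<in> J" for j k
        using section_reg_at[OF L AmV[OF that]] by blast
      show "reg_at X y ?P" by (intro reg_at_diff reg_at_mult r I)
      fix z assume z: "w 2 i z $ 1 \<noteq> 0"
      have "Am a b i z $ 1 * Am j k i z $ 1 = Am a j i z $ 1 * Am b k i z $ 1 - Am a k i z $ 1 * Am b j i z $ 1"
        unfolding Am_at
        by (rule skew_extension_pluecker[where n = "p + 3"]) (use z rel I in \<open>auto simp: J_def\<close>)
      then show "?P z = 0" by simp
    qed
    then show ?thesis by simp
  qed
  have "\<exists>(E :: ('n, 'n pt, 2) vbundle) \<phi> s. vector_bundle X E \<and> bundle_iso X (det_bundle E) L \<phi> \<and>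
     (\<forall>j\<in>J. s j \<in> H0 X E) \<and> (\<forall>j\<in>J. \<forall>k\<in>J. det_map E L \<phi> (s j) (s k) = Am j k)"
  proof (rule bundle_of_skew_matrix[OF conn L _ AmV _ _ _ _ pl])
    show "finite J" by (simp add: J_def)
    show "1 \<in> J" "2 \<in> J" by (auto simp: J_def)
    show "Am 1 2 \<noteq> 0" using w2(2) by (simp add: Am_def skew_extension_def)
    show "Am k j i y $ 1 = - (Am j k i y $ 1)" for j k i y
      by (auto simp: Am_def skew_extension_def)
  qed
  then obtain E :: "('n, 'n pt, 2) vbundle" and \<phi> s where E: "vector_bundle X E"
    and iso: "bundle_iso X (det_bundle E) L \<phi>" and sH: "\<And>j. j \<in> J \<Longrightarrow> s j \<in> H0 X E"
    and sdet: "\<And>j k. j \<in> J \<Longrightarrow> k \<in> J \<Longrightarrow> det_map E L \<phi> (s j) (s k) = Am j k"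
    by blast
  (* t is the section of index 1: d(t, s k) is w k. *)
  define t where "t = s 1"
  define D where "D = det_map E L \<phi> t"
  have Ds: "D (s k) = w k" if "k \<in> I" for k
    using sdet[of 1 k] that by (auto simp: D_def t_def Am_def skew_extension_def I_def J_def)
  have linD: "Vector_Spaces.linear sect_scale sect_scale D" unfolding D_def by (rule det_map_linear)
  interpret D: Vector_Spaces.linear sect_scale sect_scale D by (rule linD)
  have Dim: "D ` s ` I = B" using Ds w(2) by (force simp: image_image)
  have injs: "inj_on s I" using w(1) Ds by (metis inj_on_def)
  have injD: "inj_on D (s ` I)"
    using w(1) Ds by (auto simp: inj_on_def)
  have inds: "sect.independent (s ` I)"
    by (rule independent_of_image[OF linD _ injD]) (simp_all add: I_def[symmetric] Dim B(3), simp add: I_def)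
  define U where "U = sect.span (s ` I)"
  have UH: "U \<subseteq> H0 X E" unfolding U_def
    by (rule sect.span_minimal[OF _ H0_subspace[OF E]]) (use sH in \<open>auto simp: I_def J_def\<close>)
  have DU: "D ` U = W" unfolding U_def using D.span_image[of "s ` I"] Dim B(4) by simp
  have injU: "inj_on D U" unfolding U_def
    using D.inj_on_span_iff_independent_image[of "s ` I"] Dim B(3) injD by simp
  have ker: "U \<inter> {u \<in> H0 X E. det_map E L \<phi> t u = 0} = {0}"
  proof -
    have "u = 0" if "u \<in> U" "D u = 0" for u
    proof (rule inj_onD[OF injU _ that(1)])
      show "D u = D 0" using that(2) D.zero by simp
      show "0 \<in> U" unfolding U_def by (rule sect.span_zero)
    qed
    moreover have "0 \<in> U" by (simp add: U_def sect.span_zero)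
    ultimately show ?thesis using UH D.zero unfolding D_def by blast
  qed
  have dimU: "subspace_of_dim (p + 2) U"
    unfolding subspace_of_dim_def
    by (intro exI[of _ "s ` I"]) (use inds card_image[OF injs] in \<open>auto simp: U_def I_def\<close>)
  (* The pairing of s i and s j is A i j, so gamma is the normal form of x. *)
  have gam: "gamma E L \<phi> p t s = normal_tensor p w A"
    unfolding gamma_def normal_tensor_def pairs_def[symmetric]
  proof (rule sum.cong[OF refl], clarify)
    fix i j assume P: "(i, j) \<in> pairs p"
    have 1: "map (\<lambda>k. det_map E L \<phi> t (s k)) (filter (\<lambda>k. k \<noteq> i \<and> k \<noteq> j) [2..<p + 4]) = map w (omit2 p i j)"
      unfolding omit2_def using Ds by (intro map_cong) (auto simp: D_def I_def)
    have 2: "det_map E L \<phi> (s i) (s j) = A i j"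
      using sdet[of i j] P by (auto simp: Am_def skew_extension_def J_def pairs_def)
    show "single (map (\<lambda>k. det_map E L \<phi> t (s k)) (filter (\<lambda>k. k \<noteq> i \<and> k \<noteq> j) [2..<p + 4]),
        det_map E L \<phi> (s i) (s j)) ((-1) ^ (i + j)) =
      single (map w (omit2 p i j), A i j) ((-1) ^ (i + j))"
      unfolding 1 2 ..
  qed
  show ?thesis
  proof (intro exI conjI)
    show "vector_bundle X E" "bundle_iso X (det_bundle E) L \<phi>" by (fact E, fact iso)
    show "t \<in> H0 X E" unfolding t_def by (rule sH) (simp add: J_def)
    show "W \<subseteq> det_map E L \<phi> t ` H0 X E" using DU UH unfolding D_def by blast
    show "admissible X E L \<phi> p W t U"
      unfolding admissible_def using UH dimU ker DU by (simp add: D_def)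
    show "basis_2_to (p + 3) s U"
      unfolding basis_2_to_def using injs inds by (simp add: U_def I_def)
    show "gamma E L \<phi> p t s \<in> koszul_cycles X L p" "\<alpha> = koszul_class X L p (gamma E L \<phi> p t s)"
      using cyc cls by (simp_all add: gam)
  qed
qed

end
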